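(* Let $E\in M_{2\times 2}(\mathbb{Z})$ be a non-homothety with $|\det E|>2$, and denote by the same letter the induced linear endomorphism of $\mathbb{T}^2$. Then the intersection $[E]\cap\mathcal{U}$ is non-empty, and in fact it contains maps that are real analytically homotopic to $E$.
   Context: $\mathbb{T}^2=\mathbb{R}^2/\mathbb{Z}^2$ and $\mu$ is the Lebesgue (Haar) measure on $\mathbb{T}^2$. A matrix $E$ is a homothety if $E=k\cdot Id$ for some scalar $k$; a non-homothety is a matrix that is not of this form. $End^1_\mu(\mathbb{T}^2)$ is the set of $C^1$ local diffeomorphisms of $\mathbb{T}^2$ (not necessarily invertible) that preserve $\mu$. $T^1\mathbb{T}^2$ is the unit tangent bundle of $\mathbb{T}^2$. For $f\in End^1_\mu(\mathbb{T}^2)$, $n\in\mathbb{N}$ ($n\ge 1$) and $(\overline{x},u)\in T^1\mathbb{T}^2$, put $$I(\overline{x},u;f^n)=\sum_{\overline{y}\in f^{-n}(\overline{x})}\frac{\log\|(Df^n(\overline{y}))^{-1}u\|}{|\det(Df^n(\overline{y}))|},\qquad C_\chi(f)=\sup_{n\in\mathbb{N}}\ \inf_{(\overline{x},u)\in T^1\mathbb{T}^2}\frac1n I(\overline{x},u;f^n).$$ Define $\mathcal{U}=\{f\in End^1_\mu(\mathbb{T}^2): C_\chi(f)>0\}$. For a map $f$ of $\mathbb{T}^2$, $[f]$ denotes the set of maps $g:\mathbb{T}^2\to\mathbb{T}^2$ such that there is a $C^1$ homotopy between $f$ and $g$. "Real analytically homotopic to $E$" means that there is a real analytic homotopy between the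 map and $E$. *)

theory Defs
  imports "HOL-Analysis.Analysis"
begin

section \<open>The torus and its Haar measure\<close>

quotient_type torus = "real^2" / "\<lambda>x y. \<forall>i. x $ i - y $ i \<in> \<int>"
  morphisms torus_rep torus_proj
proof (rule equivpI)
  show "reflp (\<lambda>x y :: real^2. \<forall>i. x $ i - y $ i \<in> \<int>)"
    by (auto intro: reflpI)
  show "symp (\<lambda>x y :: real^2. \<forall>i. x $ i - y $ i \<in> \<int>)"
    by (rule sympI) (metis Ints_minus minus_diff_eq)
  show "transp (\<lambda>x y :: real^2. \<forall>i. x $ i - y $ i \<in> \<int>)"
  proof (rule transpI, rule allI)
    fix x y z :: "real^2" and i
    assume "\<forall>i. x $ i - y $ i \<in> \<int>" "\<forall>i. y $ i - z $ i \<in> \<int>"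
    then have "(x $ i - y $ i) + (y $ i - z $ i) \<in> \<int>" by (intro Ints_add) auto
    then show "x $ i - z $ i \<in> \<int>" by simp
  qed
qed

text \<open>The quotient topology.\<close>

instantiation torus :: topological_space
begin

definition open_torus :: "torus set \<Rightarrow> bool" where
  "open_torus U \<longleftrightarrow> open (torus_proj -` U)"

instance
proof
  show "open (UNIV :: torus set)" by (simp add: open_torus_def)
  show "open (S \<inter> T)" if "open S" "open T" for S T :: "torus set"
    using that by (simp add: open_torus_def vimage_Int open_Int)
  show "open (\<Union>K)" if "\<forall>S\<in>K. open S" for K :: "torus set set"
    using that by (auto simp add: open_torus_def vimage_Union)
qed

end

definition torus_measure :: "torus measure" where
  "torus_measure =
     distr (restrict_space lborel {x :: real^2. \<forall>i. 0 \<le> x $ i \<and> x $ i < 1}) borel torus_proj"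


section \<open>Regularity of maps on Euclidean spaces\<close>

definition C1_on ::
  "'a::real_normed_vector set \<Rightarrow> ('a \<Rightarrow> 'b::real_normed_vector) \<Rightarrow> bool" where
  "C1_on W F \<longleftrightarrow>
     (\<exists>F' :: 'a \<Rightarrow> ('a \<Rightarrow>\<^sub>L 'b).
        (\<forall>x\<in>W. (F has_derivative blinfun_apply (F' x)) (at x)) \<and> continuous_on W F')"

text \<open>
  Local expansion into a power series in all the coordinates; \<open>\<alpha>\<close> ranges over the
  multi-indices, and the sum is unconditional.
\<close>

definition real_analytic_on ::
  "'a::euclidean_space set \<Rightarrow> ('a \<Rightarrow> 'b::real_normed_vector) \<Rightarrow> bool" where
  "real_analytic_on W F \<longleftrightarrow>
     (\<forall>p\<in>W. \<exists>r>0. \<exists>c :: ('a \<Rightarrow> nat) \<Rightarrow> 'b. \<forall>y\<in>ball p r.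
        ((\<lambda>\<alpha>. (\<Prod>b\<in>Basis. ((y - p) \<bullet> b) ^ \<alpha> b) *\<^sub>R c \<alpha>) has_sum F y)
          (Basis \<rightarrow>\<^sub>E UNIV))"


section \<open>Differentiable maps of the torus\<close>

text \<open>
  The charts of the torus are the local inverses of \<open>torus_proj\<close>, so a map of the torus is
  read in charts as a local lift to the plane.
\<close>

definition local_lift :: "(torus \<Rightarrow> torus) \<Rightarrow> (real^2) set \<Rightarrow> (real^2 \<Rightarrow> real^2) \<Rightarrow> bool" where
  "local_lift f W F \<longleftrightarrow> open W \<and> (\<forall>y\<in>W. torus_proj (F y) = f (torus_proj y))"

text \<open>Meaningful for open \<open>U\<close> only.\<close>

definition torus_C1_on :: "torus set \<Rightarrow> (torus \<Rightarrow> torus) \<Rightarrow> bool" where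
  "torus_C1_on U f \<longleftrightarrow>
     (\<forall>x. torus_proj x \<in> U \<longrightarrow> (\<exists>W F. x \<in> W \<and> local_lift f W F \<and> C1_on W F))"

text \<open>
  The differential at \<open>p\<close> in the standard trivialisation of the tangent bundle. Any two local
  lifts that are differentiable at points over \<open>p\<close> differ by integer translations near these
  points, so the matrix is unique; it is unspecified if \<open>f\<close> is not differentiable at \<open>p\<close>.
\<close>

definition torus_deriv :: "(torus \<Rightarrow> torus) \<Rightarrow> torus \<Rightarrow> real^2^2" where
  "torus_deriv f p =
     (THE D. \<exists>x W F. torus_proj x = p \<and> x \<in> W \<and> local_lift f W F \<and>
        (F has_derivative (\<lambda>v. D *v v)) (at x))"

definition C1_local_diffeo :: "(torus \<Rightarrow> torus) \<Rightarrow> bool" where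
  "C1_local_diffeo f \<longleftrightarrow>
     (\<forall>p. \<exists>U. open U \<and> p \<in> U \<and> open (f ` U) \<and> inj_on f U \<and>
        torus_C1_on U f \<and> torus_C1_on (f ` U) (inv_into U f))"

definition End1 :: "(torus \<Rightarrow> torus) set" where
  "End1 = {f. C1_local_diffeo f \<and> f \<in> measurable torus_measure torus_measure \<and>
     distr torus_measure torus_measure f = torus_measure}"


section \<open>The set of maps with positive exponent bound\<close>

definition unit_tangent_bundle :: "(torus \<times> (real^2)) set" where
  "unit_tangent_bundle = {(x, u). norm u = 1}"

text \<open>For a local diffeomorphism \<open>g\<close> the fibres are finite.\<close>

definition I_chi :: "torus \<Rightarrow> real^2 \<Rightarrow> (torus \<Rightarrow> torus) \<Rightarrow> real" where
  "I_chi x u g =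
     (\<Sum>y \<in> g -` {x}. ln (norm (matrix_inv (torus_deriv g y) *v u)) / \<bar>det (torus_deriv g y)\<bar>)"

text \<open>Extended reals make the infimum and supremum meaningful without boundedness proofs.\<close>

definition C_chi :: "(torus \<Rightarrow> torus) \<Rightarrow> ereal" where
  "C_chi f = (SUP n\<in>{1..}. INF (x, u)\<in>unit_tangent_bundle. ereal (I_chi x u (f ^^ n) / real n))"

definition U_set :: "(torus \<Rightarrow> torus) set" where
  "U_set = {f \<in> End1. C_chi f > 0}"


section \<open>Homotopies\<close>

text \<open>
  \<open>R\<close> is a local regularity notion for maps on open sets; regularity on the manifold with
  boundary \<open>torus \<times> [0,1]\<close> means that, in charts, the map extends locally to a map of that
  regularity on an open subset of \<open>\<real>\<^sup>2 \<times> \<real>\<close>.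
\<close>

definition homotopic_of_class ::
  "(((real^2) \<times> real) set \<Rightarrow> ((real^2) \<times> real \<Rightarrow> real^2) \<Rightarrow> bool) \<Rightarrow>
   (torus \<Rightarrow> torus) \<Rightarrow> (torus \<Rightarrow> torus) \<Rightarrow> bool" where
  "homotopic_of_class R f g \<longleftrightarrow>
     (\<exists>H :: torus \<times> real \<Rightarrow> torus.
        (\<forall>p. H (p, 0) = f p) \<and> (\<forall>p. H (p, 1) = g p) \<and>
        (\<forall>x. \<forall>t\<in>{0..1}. \<exists>W F. open W \<and> (x, t) \<in> W \<and> R W F \<and>
           (\<forall>(y, s)\<in>W. s \<in> {0..1} \<longrightarrow> torus_proj (F (y, s)) = H (torus_proj y, s))))"

definition C1_homotopic :: "(torus \<Rightarrow> torus) \<Rightarrow> (torus \<Rightarrow> torus) \<Rightarrow> bool" where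
  "C1_homotopic = homotopic_of_class C1_on"

definition analytically_homotopic :: "(torus \<Rightarrow> torus) \<Rightarrow> (torus \<Rightarrow> torus) \<Rightarrow> bool" where
  "analytically_homotopic = homotopic_of_class real_analytic_on"

definition homotopy_class :: "(torus \<Rightarrow> torus) \<Rightarrow> (torus \<Rightarrow> torus) set" where
  "homotopy_class f = {g. C1_homotopic f g}"


section \<open>Linear endomorphisms\<close>

definition real_matrix :: "int^2^2 \<Rightarrow> real^2^2" where
  "real_matrix E = (\<chi> i j. real_of_int (E $ i $ j))"

definition homothety :: "real^2^2 \<Rightarrow> bool" where
  "homothety A \<longleftrightarrow> (\<exists>k. A = k *\<^sub>R mat 1)"

lemma real_matrix_mult_Ints_diff:
  fixes x y :: "real^2"
  assumes "\<And>i. x $ i - y $ i \<in> \<int>"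
  shows "(real_matrix E *v x) $ i - (real_matrix E *v y) $ i \<in> \<int>"
proof -
  have "(\<Sum>j\<in>UNIV. real_of_int (E $ i $ j) * (x $ j - y $ j)) \<in> \<int>"
    using assms by (intro Ints_sum Ints_mult) auto
  then show ?thesis
    by (simp add: real_matrix_def matrix_vector_mult_def right_diff_distrib sum_subtractf)
qed

lift_definition torus_linear :: "int^2^2 \<Rightarrow> torus \<Rightarrow> torus" is
  "\<lambda>E x. real_matrix E *v x"
  by (simp add: real_matrix_mult_Ints_diff)

end

theory Submission
  imports Defs
begin

text \<open>
  The maps realising the statement are \<open>f = R \<circ> E \<circ> T\<close>, where \<open>T z = z + \<phi> (l \<bullet> z) e\<close> is a shear along a primitive
  lattice direction \<open>e\<close> with a trigonometric polynomial \<open>\<phi>\<close> of huge amplitude \<open>t\<close>, and \<open>R\<close> is the identity or, in one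
  arithmetically special case, a small shear along a transversal direction \<open>e'\<close>. Shears preserve area and the
  map differs from \<open>E\<close> by a periodic displacement, so \<open>f\<close> is an area preserving local diffeomorphism that a straight line
  homotopy of lifts joins analytically to \<open>E\<close> (\<open>F_End1\<close>, \<open>F_C1_homotopic\<close>, \<open>F_analytically_homotopic\<close>).

  The exponent is measured along inverse branches. Write \<open>X\<close> and \<open>Y\<close> for the coordinates of \<open>E\<^sup>-\<^sup>1 v\<close> transversal to
  and along \<open>e\<close>. The points of a fibre lie on \<open>n\<close> equally spaced lines \<open>l \<bullet> y = u + i/n\<close>, and the branch through
  the \<open>i\<close>-th line sends \<open>v\<close> to \<open>(X, Y - t c\<^sub>i X)\<close>, where \<open>t c\<^sub>i = \<phi>' (u + i/n)\<close>. If \<open>X\<close> is comparable to \<open>v\<close>, this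
  stretches by about \<open>t\<close>, except on the few branches for which \<open>t c\<^sub>i\<close> is close to \<open>Y/X\<close>. If \<open>X\<close> is much smaller,
  that is, \<open>v\<close> is close to the direction of \<open>E e\<close>, then less is gained; but as \<open>e\<close> is no eigenvector, a stretched vector is
  close to \<open>e\<close> and therefore far from this direction at the next step. The loss that a direction threatens is
  recorded by its \<open>badness\<close>, between \<open>0\<close> and \<open>ln t\<close> up to constants. Adding to \<open>ln \<parallel>v\<parallel>\<close> a suitable multiple of the badness (and of
  \<open>ln t\<close>) gives a potential whose mean over the fibre exceeds its value at the base point by at least \<open>1\<close>
  (\<open>drift_four_or_more\<close>, \<open>drift_three\<close>, \<open>drift_half\<close>). Summing this over \<open>N\<close> generations of preimages makes
  the sums \<open>I(x, u; f\<^sup>N)\<close> grow linearly, uniformly in \<open>(x, u)\<close> (\<open>C_chi_positive\<close>).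

  How hard the drift is to obtain depends on \<open>n\<close>. For \<open>n \<ge> 4\<close> constant coefficients do, because at most two branches
  are bad, and only one unless the badness is maximal. For \<open>n = 3\<close> two bad branches are too many; the coefficient is made
  to depend on the base point, and \<open>t\<close> is tuned so that the two bad preimages are not both exceptional. The number
  \<open>n\<close> is \<open>\<bar>det E\<bar> / q\<close> with \<open>q\<close> the content of \<open>E e\<close>, and two consecutive choices \<open>e = (1, k)\<close>, \<open>(1, k + 1)\<close> cannot both
  have \<open>n \<le> 2\<close> unless \<open>E\<close> is twice a unimodular matrix (\<open>frame_dichotomy\<close>). In that remaining case each fibre consists
  of two points on each of two lines, and the transversal shear \<open>R\<close> is used to separate the two
  points on a line. That \<open>E\<close> is no homothety enters only through the choice of \<open>k\<close>: at most two of the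
  directions \<open>(1, k)\<close> are eigendirections.
\<close>

section \<open>Distance to the integers and the shear profile\<close>

text \<open>
  A smooth substitute for the distance to the nearest integer: it is comparable to that distance, subadditive, and turns the
  product formula for \<open>cos x - cos y\<close> into a statement about distances.
\<close>
definition circ :: "real \<Rightarrow> real" where
  "circ x = \<bar>sin (pi * x)\<bar>"

lemma circ_nonneg [simp]: "0 \<le> circ x" by (simp add: circ_def)

lemma circ_minus [simp]: "circ (- x) = circ x" by (simp add: circ_def)

lemma circ_add: "circ (x + y) \<le> circ x + circ y"
proof -
  have "\<bar>sin (pi*x) * cos (pi*y)\<bar> \<le> \<bar>sin (pi*x)\<bar> * 1"
    unfolding abs_mult by (intro mult_left_mono) auto
  moreover have "\<bar>cos (pi*x) * sin (pi*y)\<bar> \<le> 1 * \<bar>sin (pi*y)\<bar>"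
    unfolding abs_mult by (intro mult_right_mono) auto
  ultimately show ?thesis
    unfolding circ_def distrib_left sin_add by linarith
qed

lemma circ_diff: "circ (x - y) \<le> circ x + circ y"
  using circ_add[of x "- y"] by simp

lemma circ_eq_0_iff: "circ x = 0 \<longleftrightarrow> x \<in> \<int>"
proof -
  have "sin (pi * x) = 0 \<longleftrightarrow> (\<exists>n. pi * x = of_int n * pi)"
    by (simp add: sin_zero_iff_int2)
  then show ?thesis by (auto simp: circ_def Ints_def)
qed

lemma circ_Ints: "x \<in> \<int> \<Longrightarrow> circ x = 0" by (simp add: circ_eq_0_iff)

lemma circ_add_Ints: assumes "n \<in> \<int>" shows "circ (x + n) = circ x"
  using circ_add[of x n] circ_diff[of "x+n" n] circ_Ints[OF assms] by simp

lemma circ_cong_Ints: assumes "x - y \<in> \<int>" shows "circ x = circ y"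
  using circ_add_Ints[OF assms, of y] by simp

lemma circ_mult_nat: "circ (of_nat n * x) \<le> of_nat n * circ x"
proof (induction n)
  case (Suc n)
  have "circ (of_nat (Suc n) * x) \<le> circ (of_nat n * x) + circ x"
    using circ_add[of "of_nat n * x" x] by (simp add: algebra_simps)
  with Suc show ?case by (simp add: algebra_simps)
qed (simp add: circ_def)

lemma circ_mult_int: "circ (of_int n * x) \<le> of_int \<bar>n\<bar> * circ x"
proof (cases "n \<ge> 0")
  case True then show ?thesis using circ_mult_nat[of "nat n" x] by simp
next
  case False then show ?thesis using circ_mult_nat[of "nat (-n)" x] by simp
qed

lemma circ_le: "circ x \<le> pi * \<bar>x\<bar>"
  using abs_sin_le_one[of "pi*x"] abs_sin_x_le_abs_x[of "pi*x"] by (simp add: circ_def abs_mult)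

lemma circ_le1: "circ x \<le> 1" by (simp add: circ_def)

text \<open>
  The derivative of the shear, up to the amplitude. The second harmonic moves the zeros away from \<open>\<plusminus>1/4\<close>, so that
  a suitable choice of \<open>a\<close> keeps them from differing by a multiple of \<open>1/n\<close>.
\<close>
definition profile :: "real \<Rightarrow> real \<Rightarrow> real" where
  "profile a u = cos (2*pi*u) + a * cos (4*pi*u)"

lemma profile_bound: "\<bar>a\<bar> \<le> 1 \<Longrightarrow> \<bar>profile a u\<bar> \<le> 2"
proof -
  assume "\<bar>a\<bar> \<le> 1"
  then have "\<bar>a * cos (4*pi*u)\<bar> \<le> 1 * 1" unfolding abs_mult by (intro mult_mono) auto
  then show ?thesis unfolding profile_def using abs_cos_le_one[of "2*pi*u"] by linarith
qed

lemma cos_diff_circ: "\<bar>cos (2*pi*u) - cos (2*pi * v)\<bar> = 2 * circ (u+v) * circ (u-v)"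
proof -
  have "circ (u - v) = circ (v - u)" using circ_minus[of "u-v"] by simp
  then show ?thesis
    unfolding cos_diff_cos circ_def
    by (simp add: abs_mult algebra_simps add_divide_distrib diff_divide_distrib)
qed

lemma profile_diff: "profile a u - profile a v =
   (cos (2*pi*u) - cos (2*pi * v)) * (1 + 2 * a * (cos (2*pi*u) + cos (2*pi * v)))"
proof -
  have *: "cos (4*pi*w) = 2 * cos (2*pi*w)^2 - 1" for w :: real
    using cos_double_cos[of "2*pi*w"] by (simp add: mult.assoc)
  show ?thesis unfolding profile_def *[of u] *[of v] by (simp add: algebra_simps power2_eq_square)
qed

text \<open>
  The profile is a monotone function of \<open>cos\<close> when \<open>a < 1/4\<close>, so two of its values are close only if the arguments are
  nearly equal or nearly opposite modulo \<open>1\<close>.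
\<close>
lemma profile_separation:
  assumes "0 \<le> a"
  shows "2 * (1 - 4*a) * circ (u+v) * circ (u-v) \<le> \<bar>profile a u - profile a v\<bar>"
proof -
  have "- 2 \<le> cos (2*pi*u) + cos (2*pi * v)"
    using cos_ge_minus_one[of "2*pi*u"] cos_ge_minus_one[of "2*pi * v"] by linarith
  then have "2 * a * (-2) \<le> 2 * a * (cos (2*pi*u) + cos (2*pi * v))"
    using assms by (intro mult_left_mono) auto
  then have "1 - 4*a \<le> \<bar>1 + 2 * a * (cos (2*pi*u) + cos (2*pi * v))\<bar>" by linarith
  then have "(2 * circ (u+v) * circ (u-v)) * (1 - 4*a) \<le> (2 * circ (u+v) * circ (u-v)) * \<bar>1 + 2 * a * (cos (2*pi*u) + cos (2*pi * v))\<bar>"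
    by (intro mult_left_mono) auto
  then show ?thesis unfolding profile_diff abs_mult cos_diff_circ by (simp add: algebra_simps)
qed

section \<open>Growth of vectors along an inverse branch\<close>

definition vnorm :: "real \<Rightarrow> real \<Rightarrow> real" where
  "vnorm v w = max \<bar>v\<bar> \<bar>w\<bar>"

text \<open>
  The logarithmic deficit of \<open>X\<close> against the norm \<open>N\<close> of the vector. It is cut off at \<open>ln t\<close> because a still smaller
  \<open>X\<close> loses nothing more: the coordinate \<open>Y\<close> already dominates \<open>t X\<close>.
\<close>
definition badness :: "real \<Rightarrow> real \<Rightarrow> real \<Rightarrow> real" where
  "badness t X N = - ln (max (\<bar>X\<bar> / N) (1 / t))"

lemma badness_le: assumes "t > 0" shows "badness t X N \<le> ln t"
proof -
  have "ln (1/t) \<le> ln (max (\<bar>X\<bar> / N) (1 / t))" using assms by (intro ln_mono) (auto simp: less_max_iff_disj)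
  then show ?thesis using assms by (simp add: badness_def ln_div)
qed

lemma badness_ge: assumes "t \<ge> 1" "N > 0" "C \<ge> 1" "\<bar>X\<bar> \<le> C * N" shows "badness t X N \<ge> - ln C"
proof -
  have "\<bar>X\<bar> / N \<le> C" using assms by (simp add: pos_divide_le_eq)
  moreover have "1 / t \<le> 1" using assms by simp
  then have "1 / t \<le> C" using assms by linarith
  ultimately have "max (\<bar>X\<bar> / N) (1 / t) \<le> C" using assms by simp
  then have "ln (max (\<bar>X\<bar> / N) (1 / t)) \<le> ln C" using assms by (intro ln_mono) (auto simp: less_max_iff_disj)
  then show ?thesis by (simp add: badness_def)
qed

lemma badness_le_of_ge: assumes "N > 0" "b > 0" "b * N \<le> \<bar>X\<bar>" "t > 0" shows "badness t X N \<le> - ln b"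
proof -
  have "b \<le> \<bar>X\<bar>/N" using assms by (simp add: pos_le_divide_eq)
  then have "ln b \<le> ln (max (\<bar>X\<bar> / N) (1 / t))" using assms by (intro ln_mono) auto
  then show ?thesis by (simp add: badness_def)
qed

lemma badness_ge_of_le: assumes "t > 0" "N > 0" "C \<ge> 1" "t * \<bar>X\<bar> \<le> C * N" shows "badness t X N \<ge> ln t - ln C"
proof -
  have "\<bar>X\<bar>/N \<le> C/t" using assms by (simp add: divide_simps mult.commute)
  moreover have "1/t \<le> C/t" using assms by (simp add: divide_simps)
  ultimately have "max (\<bar>X\<bar> / N) (1 / t) \<le> C/t" by simp
  then have "ln (max (\<bar>X\<bar> / N) (1 / t)) \<le> ln (C/t)" using assms by (intro ln_mono) (auto simp: less_max_iff_disj)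
  also have "\<dots> = ln C - ln t" using assms by (simp add: ln_div)
  finally show ?thesis by (simp add: badness_def)
qed

lemma ln_minus_badness: assumes "t > 0" "N > 0"
  shows "ln N - badness t X N = ln (max \<bar>X\<bar> (N / t))"
proof -
  have p: "max (\<bar>X\<bar> / N) (1 / t) > 0" using assms by (auto simp: less_max_iff_disj)
  have "ln N - badness t X N = ln (N * max (\<bar>X\<bar> / N) (1 / t))"
    using assms p by (simp add: badness_def ln_mult)
  also have "N * max (\<bar>X\<bar> / N) (1 / t) = max \<bar>X\<bar> (N/t)"
    using assms by (simp add: max_mult_distrib_left)
  finally show ?thesis .
qed

lemma abs_shear_le:
  fixes t c X :: real
  assumes "\<bar>c\<bar> \<le> 2" "t \<ge> 0"
  shows "\<bar>t*c*X\<bar> \<le> 2 * (t * \<bar>X\<bar>)"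
proof -
  have "\<bar>t*c*X\<bar> = \<bar>c\<bar> * (t * \<bar>X\<bar>)" using assms by (simp add: abs_mult)
  also have "\<dots> \<le> 2 * (t * \<bar>X\<bar>)" using assms by (intro mult_right_mono) auto
  finally show ?thesis .
qed

text \<open>
  Even on the worst branch the image is not shorter than \<open>max \<bar>X\<bar> (N/t)\<close> up to a constant: either \<open>X\<close> itself is that long, or
  \<open>t X\<close> is too small to cancel \<open>Y\<close>.
\<close>
lemma growth_ge:
  assumes "t \<ge> 1" "N > 0" "C \<ge> 1" "N \<le> C * max \<bar>X\<bar> \<bar>Y\<bar>" "\<bar>c\<bar> \<le> 2"
  shows "ln N - badness t X N - ln (4*C) \<le> ln (vnorm X (Y - t*c*X))"
proof -
  let ?V = "vnorm X (Y - t*c*X)"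
  have "max \<bar>X\<bar> (N / t) / (4*C) \<le> ?V"
  proof (cases "N / t \<le> 4 * C * \<bar>X\<bar>")
    case True
    have "1 * \<bar>X\<bar> \<le> 4 * C * \<bar>X\<bar>" using assms by (intro mult_right_mono) auto
    with True have "max \<bar>X\<bar> (N/t) \<le> \<bar>X\<bar> * (4*C)" by (simp add: mult_ac)
    then have "max \<bar>X\<bar> (N / t) / (4*C) \<le> \<bar>X\<bar>" using assms by (simp add: pos_divide_le_eq mult_ac)
    then show ?thesis by (simp add: vnorm_def)
  next
    case False
    then have *: "4 * C * (t * \<bar>X\<bar>) < N" using assms by (simp add: divide_simps mult_ac split: if_splits)
    have a: "1 * \<bar>X\<bar> \<le> t * \<bar>X\<bar>" using assms by (intro mult_right_mono) auto
    have "C * \<bar>X\<bar> \<le> C * (t * \<bar>X\<bar>)" using a assms by (intro mult_left_mono) auto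
    moreover have "0 \<le> C * (t * \<bar>X\<bar>)" using assms by auto
    ultimately have "C * \<bar>X\<bar> < N" using * by linarith
    then have Y: "N \<le> C * \<bar>Y\<bar>" using assms(4) by (auto simp: max_def split: if_splits)
    have "\<bar>t*c*X\<bar> \<le> 2 * (t * \<bar>X\<bar>)" by (rule abs_shear_le) (use assms in auto)
    then have "C * \<bar>t*c*X\<bar> \<le> 2 * (C * (t * \<bar>X\<bar>))" using assms mult_left_mono[of _ _ C] by fastforce
    then have 1: "C * \<bar>t*c*X\<bar> \<le> N/2" using * by linarith
    have "\<bar>Y\<bar> - \<bar>t*c*X\<bar> \<le> \<bar>Y - t*c*X\<bar>" by linarith
    then have "C * (\<bar>Y\<bar> - \<bar>t*c*X\<bar>) \<le> C * \<bar>Y - t*c*X\<bar>" using assms mult_left_mono[of _ _ C] by fastforce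
    then have 2: "N/2 \<le> C * \<bar>Y - t*c*X\<bar>" using 1 Y by (simp add: algebra_simps)
    have "max \<bar>X\<bar> (N/t) \<le> N"
    proof -
      have "1 * \<bar>X\<bar> \<le> C * \<bar>X\<bar>" using assms by (intro mult_right_mono) auto
      moreover have "N/t \<le> N" using assms by (simp add: divide_simps)
      ultimately show ?thesis using \<open>C * \<bar>X\<bar> < N\<close> by simp
    qed
    then have "max \<bar>X\<bar> (N / t) / (4*C) \<le> N / (4*C)" using assms by (intro divide_right_mono) auto
    also have "\<dots> \<le> (2 * (C * \<bar>Y - t*c*X\<bar>)) / (4*C)" using 2 assms by (intro divide_right_mono) auto
    also have "\<dots> = \<bar>Y - t*c*X\<bar> / 2" using assms by (simp add: divide_simps)
    also have "\<dots> \<le> ?V" by (auto simp: vnorm_def max_def)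
    finally show ?thesis .
  qed
  moreover have p: "max \<bar>X\<bar> (N / t) > 0" using assms by (auto simp: less_max_iff_disj)
  ultimately have "ln (max \<bar>X\<bar> (N / t) / (4*C)) \<le> ln ?V" using assms by (intro ln_mono) auto
  then show ?thesis using ln_minus_badness[of t N X] p assms by (simp add: ln_div)
qed

text \<open>
  Without cancellation between \<open>Y\<close> and \<open>t c X\<close> the image has the size of the larger of the two, which gains the factor \<open>t\<close>
  over the previous bound. The loss factor \<open>\<kappa>\<close> may depend on \<open>t\<close>.
\<close>
lemma growth_good:
  assumes "t \<ge> 1" "N > 0" "C \<ge> 1" "N \<le> C * max \<bar>X\<bar> \<bar>Y\<bar>" "\<kappa> > 0"
   and V: "\<kappa> * max \<bar>Y\<bar> (t * \<bar>X\<bar>) \<le> \<bar>V\<bar>"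
  shows "ln N + ln t - badness t X N + ln \<kappa> - ln C \<le> ln (vnorm X V)"
proof -
  let ?M = "max \<bar>Y\<bar> (t * \<bar>X\<bar>)"
  have a: "1 * \<bar>X\<bar> \<le> t * \<bar>X\<bar>" using assms by (intro mult_right_mono) auto
  have "max \<bar>X\<bar> \<bar>Y\<bar> \<le> ?M" using a by auto
  then have "C * max \<bar>X\<bar> \<bar>Y\<bar> \<le> C * ?M" using assms by (intro mult_left_mono) auto
  then have n: "N \<le> C * ?M" using assms by linarith
  then have Mp: "?M > 0" using assms a by (smt (verit, best) mult_nonneg_nonpos)
  have "1 * (t * \<bar>X\<bar>) \<le> C * ?M" using assms by (intro mult_mono) auto
  then have "t * max \<bar>X\<bar> (N/t) \<le> C * ?M" using n assms by (simp add: max_mult_distrib_left)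
  then have "t * max \<bar>X\<bar> (N/t) / C * \<kappa> \<le> ?M * \<kappa>"
    using assms by (intro mult_right_mono) (auto simp: pos_divide_le_eq mult_ac)
  also have "\<dots> \<le> vnorm X V" using V by (auto simp: vnorm_def mult_ac le_max_iff_disj)
  finally have 1: "t * max \<bar>X\<bar> (N/t) / C * \<kappa> \<le> vnorm X V" .
  have p: "max \<bar>X\<bar> (N / t) > 0" using assms by (auto simp: less_max_iff_disj)
  have "ln (t * max \<bar>X\<bar> (N/t) / C * \<kappa>) \<le> ln (vnorm X V)"
    by (intro ln_mono 1 mult_pos_pos divide_pos_pos p) (use assms(1,3,5) in simp_all)
  moreover have "ln (t * max \<bar>X\<bar> (N/t) / C * \<kappa>) = ln t + ln (max \<bar>X\<bar> (N / t)) - ln C + ln \<kappa>"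
  proof -
    define P where "P = max \<bar>X\<bar> (N / t)"
    have "P > 0" using p by (simp only: P_def)
    have t: "t > 0" using assms(1) by simp
    have C: "C > 0" using assms(3) by simp
    have "ln (t * P / C * \<kappa>) = ln (t * P / C) + ln \<kappa>" using \<open>P > 0\<close> t C assms(5) by (intro ln_mult_pos) simp_all
    also have "ln (t * P / C) = ln (t * P) - ln C" using \<open>P > 0\<close> t C by (intro ln_divide_pos) simp_all
    also have "ln (t * P) = ln t + ln P" using \<open>P > 0\<close> t by (intro ln_mult_pos)
    finally show ?thesis unfolding P_def by linarith
  qed
  ultimately show ?thesis using ln_minus_badness[of t N X] assms(1,2) by linarith
qed

text \<open>
  A stretched vector is nearly parallel to the shear direction, and \<open>b \<noteq> 0\<close> says that this direction has a transversal
  component at the next step.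
\<close>
lemma badness_child_good:
  assumes "b0 > 0" "b0 \<le> \<bar>b\<bar>" "\<bar>V1\<bar> \<le> \<bar>V2\<bar>" "2 * \<bar>\<alpha>\<bar> * \<bar>V1\<bar> \<le> b0 * \<bar>V2\<bar>" "V2 \<noteq> 0" "t > 0"
  shows "badness t (\<alpha> * V1 + b * V2) (vnorm V1 V2) \<le> - ln (b0/2)"
proof (rule badness_le_of_ge)
  have "b0 * \<bar>V2\<bar> \<le> \<bar>b * V2\<bar>" unfolding abs_mult using assms by (intro mult_right_mono) auto
  moreover have "\<bar>\<alpha> * V1\<bar> = \<bar>\<alpha>\<bar> * \<bar>V1\<bar>" by (simp add: abs_mult)
  ultimately have "b0 / 2 * \<bar>V2\<bar> \<le> \<bar>\<alpha> * V1 + b * V2\<bar>" using assms by linarith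
  then show "b0 / 2 * vnorm V1 V2 \<le> \<bar>\<alpha> * V1 + b * V2\<bar>" using assms by (simp add: vnorm_def)
next
  show "vnorm V1 V2 > 0" using assms(5) by (simp add: vnorm_def less_max_iff_disj)
qed (use assms in auto)

text \<open>
  Cancellation forces \<open>Y\<close> to be at most of the order of \<open>t X\<close>.
\<close>
lemma bad_branch:
  fixes t c X Y \<epsilon> :: real
  assumes \<epsilon>: "\<epsilon> \<le> 1/4" and c: "\<bar>c\<bar> \<le> 2" "t \<ge> 0"
    and bad: "\<bar>Y - t*c*X\<bar> < \<epsilon> * max \<bar>Y\<bar> (t * \<bar>X\<bar>)"
  shows "max \<bar>Y\<bar> (t * \<bar>X\<bar>) \<le> 3 * (t * \<bar>X\<bar>)" "t * \<bar>X\<bar> > 0"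
proof -
  define M where "M = max \<bar>Y\<bar> (t * \<bar>X\<bar>)"
  have tX: "t * \<bar>X\<bar> \<ge> 0" using c(2) by simp
  have M: "M = \<bar>Y\<bar> \<or> M = t * \<bar>X\<bar>" by (simp add: max_def M_def)
  with tX have "M \<ge> 0" by auto
  with \<epsilon> have "\<epsilon> * M \<le> (1/4) * M" by (rule mult_right_mono)
  moreover have "\<bar>t*c*X\<bar> \<le> 2 * (t * \<bar>X\<bar>)" by (rule abs_shear_le[OF c])
  ultimately have Y: "\<bar>Y\<bar> < 2 * (t * \<bar>X\<bar>) + (1/4) * M" using bad unfolding M_def[symmetric] by linarith
  show "max \<bar>Y\<bar> (t * \<bar>X\<bar>) \<le> 3 * (t * \<bar>X\<bar>)" using M Y tX unfolding M_def[symmetric] by linarith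
  show "t * \<bar>X\<bar> > 0" using M Y tX by linarith
qed

lemma two_bad_branches:
  fixes t c X Y \<epsilon> \<kappa> :: real
  assumes "\<epsilon> \<le> 1/4" "\<epsilon> > 0" "\<bar>c\<bar> \<le> 2" "\<kappa> > 0" "t \<ge> 0"
    and 1: "\<bar>Y - t*c*X\<bar> < \<epsilon> * max \<bar>Y\<bar> (t * \<bar>X\<bar>)"
    and 2: "\<bar>Y - t*c'*X\<bar> < \<kappa> * max \<bar>Y\<bar> (t * \<bar>X\<bar>)"
  shows "\<bar>c - c'\<bar> < 3 * (\<epsilon> + \<kappa>)"
proof -
  let ?M = "max \<bar>Y\<bar> (t * \<bar>X\<bar>)"
  note b = bad_branch[OF assms(1,3,5) 1]
  have "t * (c - c') * X = (Y - t*c'*X) - (Y - t*c*X)" by (simp add: algebra_simps)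
  then have "\<bar>t * (c - c') * X\<bar> < \<epsilon> * ?M + \<kappa> * ?M" using 1 2 by linarith
  also have "\<dots> = (\<epsilon> + \<kappa>) * ?M" by (simp add: algebra_simps)
  also have "\<dots> \<le> (\<epsilon> + \<kappa>) * (3 * (t * \<bar>X\<bar>))" using b(1) assms(2,4) by (intro mult_left_mono) simp_all
  finally have "\<bar>c - c'\<bar> * (t * \<bar>X\<bar>) < (3 * (\<epsilon> + \<kappa>)) * (t * \<bar>X\<bar>)" using assms(5) by (simp add: abs_mult mult_ac)
  then show ?thesis using b(2) by (simp only: mult_less_cancel_right)
qed

lemma bad_branch_flat:
  fixes t c X Y \<epsilon> :: real
  assumes "\<epsilon> \<le> 1/4" "\<epsilon> > 0" "\<bar>c\<bar> \<le> 2" "t \<ge> 0"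
    and 1: "\<bar>Y - t*c*X\<bar> < \<epsilon> * max \<bar>Y\<bar> (t * \<bar>X\<bar>)"
    and 2: "\<bar>Y\<bar> \<le> \<epsilon>' * (t * \<bar>X\<bar>)"
  shows "\<bar>c\<bar> < \<epsilon>' + 3 * \<epsilon>"
proof -
  let ?M = "max \<bar>Y\<bar> (t * \<bar>X\<bar>)"
  note b = bad_branch[OF assms(1,3,4) 1]
  have "\<epsilon> * ?M \<le> \<epsilon> * (3 * (t * \<bar>X\<bar>))" using b(1) assms(2) by (intro mult_left_mono) simp_all
  then have "\<bar>t * c * X\<bar> < \<epsilon>' * (t * \<bar>X\<bar>) + \<epsilon> * (3 * (t * \<bar>X\<bar>))" using 1 2 by linarith
  then have "\<bar>c\<bar> * (t * \<bar>X\<bar>) < (\<epsilon>' + 3 * \<epsilon>) * (t * \<bar>X\<bar>)" using assms(4) by (simp add: abs_mult algebra_simps)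
  then show ?thesis using b(2) by (simp only: mult_less_cancel_right)
qed

lemma circ_pos: "x \<notin> \<int> \<Longrightarrow> circ x > 0"
  using circ_eq_0_iff[of x] circ_nonneg[of x] by linarith

lemma finite_positive_lower_bound:
  fixes f :: "'a \<Rightarrow> real"
  assumes "finite A" "\<And>x. x \<in> A \<Longrightarrow> f x > 0"
  shows "\<exists>\<sigma>>0. \<forall>x\<in>A. \<sigma> \<le> f x"
proof (cases "A = {}")
  case False
  show ?thesis by (rule exI[of _ "Min (f ` A)"]) (use assms False in auto)
qed (auto intro: exI[of _ 1])

text \<open>
  The amplitude of the second harmonic that places a zero of the profile at \<open>1/4 - s\<close>.
\<close>
lemma profile_zero:
  fixes s :: real
  assumes "0 < s" "s \<le> 1/64"
  defines "a \<equiv> sin (2*pi* s) / cos (4*pi* s)"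
  shows "0 < a" "a < 1/4" "profile a (1/4 - s) = 0"
proof -
  have p: "pi < 4" using pi_less_4 .
  have "pi * s \<le> pi * (1/64)" using assms by (intro mult_left_mono) auto
  then have s1: "pi * s < 1/16" using p by linarith
  have s2: "0 < pi * s" using assms by simp
  have s0: "0 < sin (2*pi* s)" by (intro sin_gt_zero) (use s1 s2 pi_gt3 in linarith)+
  have s8: "sin (2*pi* s) \<le> 1/8" using sin_x_le_x[of "2*pi* s"] s1 s2 by linarith
  have "(sin (2*pi* s))^2 \<le> (1/8)^2" using s0 s8 by (intro power_mono) auto
  moreover have "cos (4*pi* s) = 1 - 2 * (sin (2*pi* s))^2" using cos_double_sin[of "2*pi* s"] by (simp add: mult.assoc)
  ultimately have c: "cos (4*pi* s) \<ge> 15/16" by (simp add: power2_eq_square)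
  show "0 < a" using c s0 unfolding a_def by (intro divide_pos_pos) auto
  have "1/4 * (15/16) \<le> 1/4 * cos (4*pi* s)" using c by simp
  then show "a < 1/4" using c s8 unfolding a_def by (simp add: pos_divide_less_eq)
  have "cos (2*pi*(1/4 - s)) = sin (2*pi* s)" by (simp add: cos_diff right_diff_distrib)
  moreover have "cos (4*pi*(1/4 - s)) = - cos (4*pi* s)" by (simp add: cos_diff right_diff_distrib)
  ultimately show "profile a (1/4 - s) = 0" using c by (simp add: profile_def a_def)
qed

text \<open>
  By \<open>profile_separation\<close>, \<open>u + i/n\<close> can have nearly the same profile value as \<open>u + j/n\<close> only if it is nearly opposite to
  it, and a point has only one opposite; this excludes three nearly equal values. Two small values would make both points
  close to one of the zeros \<open>\<plusminus>z\<close>, and the hypothesis on \<open>2 z\<close> says that no two points of the fibre can do that. The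
  constant is uniform in \<open>u\<close> because only the finitely many differences \<open>h/n\<close> occur.
\<close>
lemma profile_fibre_geometry:
  fixes a z :: real and n :: nat
  assumes a: "0 \<le> a" "a < 1/4" and z: "profile a z = 0" and n: "n \<ge> 1"
    and nz: "\<And>h::int. of_int h / n + 2 * z \<notin> \<int>"
  obtains \<epsilon> where "0 < \<epsilon>" "\<epsilon> \<le> 1/4"
    "\<And>u i j k. \<lbrakk>i < n; j < n; k < n; i \<noteq> j; i \<noteq> k; j \<noteq> k;
        \<bar>profile a (u + i/n) - profile a (u + j/n)\<bar> < 6*\<epsilon>;
        \<bar>profile a (u + i/n) - profile a (u + k/n)\<bar> < 6*\<epsilon>\<rbrakk> \<Longrightarrow> False"
    "\<And>u i j. \<lbrakk>i < n; j < n; i \<noteq> j; \<bar>profile a (u + i/n)\<bar> < 4*\<epsilon>; \<bar>profile a (u + j/n)\<bar> < 4*\<epsilon>\<rbrakk> \<Longrightarrow> False"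
proof -
  have ni: "of_int h / real n \<in> \<int> \<Longrightarrow> int n dvd h" for h
  proof -
    assume "of_int h / real n \<in> \<int>"
    then obtain k where "of_int h / real n = of_int k" by (auto elim: Ints_cases)
    then have "of_int h = (of_int (k * int n) :: real)" using n by (simp add: field_simps)
    then have "h = k * int n" by (simp only: of_int_eq_iff)
    then show ?thesis by simp
  qed
  let ?A = "{-int n<..<int n}"
  obtain \<sigma>1 where s1: "\<sigma>1 > 0" "\<And>h. h \<in> ?A - {0} \<Longrightarrow> \<sigma>1 \<le> circ (of_int h / n)"
  proof -
    have "circ (of_int h / n) > 0" if h: "h \<in> ?A - {0}" for h
    proof (rule circ_pos)
      show "of_int h / real n \<notin> \<int>"
      proof
        assume "of_int h / real n \<in> \<int>"
        then have "int n dvd h" by (rule ni)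
        then have "\<bar>int n\<bar> \<le> \<bar>h\<bar>" using h by (intro dvd_imp_le_int) auto
        then show False using h by auto
      qed
    qed
    then have "\<exists>\<sigma>>0. \<forall>h\<in>?A - {0}. \<sigma> \<le> circ (of_int h / n)" by (intro finite_positive_lower_bound) auto
    with that show ?thesis by blast
  qed
  obtain \<sigma>2 where s2: "\<sigma>2 > 0" "\<And>h. h \<in> ?A \<Longrightarrow> \<sigma>2 \<le> circ (of_int h / n + 2 * z)"
  proof -
    have "circ (of_int h / n + 2 * z) > 0" for h
      by (rule circ_pos[OF nz])
    then have "\<exists>\<sigma>>0. \<forall>h\<in>?A. \<sigma> \<le> circ (of_int h / n + 2 * z)" by (intro finite_positive_lower_bound) auto
    with that show ?thesis by blast
  qed
  define \<sigma> where "\<sigma> = min 1 (min \<sigma>1 \<sigma>2)"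
  have \<sigma>: "\<sigma> > 0" "\<sigma> \<le> 1" using s1 s2 by (auto simp: \<sigma>_def)
  have c1: "\<sigma> \<le> circ ((u + i/n) - (u + j/n))" if "i < n" "j < n" "i \<noteq> j" for i j u
  proof -
    have "(u + i/n) - (u + j/n) = of_int (int i - int j) / n" by (simp add: diff_divide_distrib)
    then show ?thesis using s1(2)[of "int i - int j"] that by (auto simp: \<sigma>_def)
  qed
  have c2: "\<sigma> \<le> circ ((u + i/n) - (u + j/n) + 2*z)" if "i < n" "j < n" for i j u
  proof -
    have "(u + i/n) - (u + j/n) + 2*z = of_int (int i - int j) / n + 2*z" by (simp add: diff_divide_distrib)
    then show ?thesis using s2(2)[of "int i - int j"] that by (auto simp: \<sigma>_def)
  qed
  define b where "b = 1 - 4*a"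
  have b: "0 < b" "b \<le> 1" using a by (auto simp: b_def)
  define P where "P = b * (\<sigma> * \<sigma>)"
  (* By the separation lemma the relevant profile values differ by at least \<open>P\<close> in the first alternative and \<open>P/2\<close> in the second. *)
  define \<epsilon> where "\<epsilon> = P / 16"
  have P: "P > 0" using b \<sigma> by (simp add: P_def)
  have "P \<le> 1 * (1 * 1)" unfolding P_def using b \<sigma> by (intro mult_mono) auto
  then have e0: "\<epsilon> > 0" and e1: "\<epsilon> \<le> 1/4" using P by (auto simp: \<epsilon>_def)
  have "2 * b * (\<sigma>/2) * \<sigma> = P" "2 * b * (\<sigma>/2) * (\<sigma>/2) = P/2" by (simp_all add: P_def)
  then have e6: "6 * \<epsilon> < 2 * b * (\<sigma>/2) * \<sigma>" and e4: "4 * \<epsilon> < 2 * b * (\<sigma>/2) * (\<sigma>/2)"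
    using P unfolding \<epsilon>_def by linarith+
  show ?thesis
  proof (rule that[OF e0 e1])
    fix u :: real and i j k :: nat
    assume ij: "i < n" "j < n" "k < n" "i \<noteq> j" "i \<noteq> k" "j \<noteq> k"
      and 1: "\<bar>profile a (u + i/n) - profile a (u + j/n)\<bar> < 6*\<epsilon>"
      and 2: "\<bar>profile a (u + i/n) - profile a (u + k/n)\<bar> < 6*\<epsilon>"
    have small: "circ ((u + i/n) + (u + l/n)) < \<sigma>/2"
      if "\<bar>profile a (u + i/n) - profile a (u + l/n)\<bar> < 6*\<epsilon>" "l < n" "i \<noteq> l" for l
    proof (rule ccontr)
      assume "\<not> ?thesis"
      then have "2 * b * (\<sigma>/2) * \<sigma> \<le> 2 * b * circ ((u + i/n) + (u + l/n)) * circ ((u + i/n) - (u + l/n))"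
        using b \<sigma> c1[of i l u] that ij by (intro mult_mono) auto
      also have "\<dots> < 6*\<epsilon>" using profile_separation[OF a(1), of "u + i/n" "u + l/n"] that unfolding b_def by linarith
      finally show False using e6 by linarith
    qed
    have "(u + j/n) - (u + k/n) = ((u + i/n) + (u + j/n)) - ((u + i/n) + (u + k/n))" by simp
    then have "circ ((u + j/n) - (u + k/n)) < \<sigma>"
      using circ_diff[of "(u + i/n) + (u + j/n)" "(u + i/n) + (u + k/n)"] small[OF 1] small[OF 2] ij by simp
    with c1[of j k u] ij show False by linarith
  next
    fix u :: real and i j :: nat
    assume ij: "i < n" "j < n" "i \<noteq> j"
      and 1: "\<bar>profile a (u + i/n)\<bar> < 4*\<epsilon>" and 2: "\<bar>profile a (u + j/n)\<bar> < 4*\<epsilon>"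
    have small: "circ (w + z) < \<sigma>/2 \<or> circ (w - z) < \<sigma>/2" if "\<bar>profile a w\<bar> < 4*\<epsilon>" for w
    proof (rule ccontr)
      assume "\<not> ?thesis"
      then have "2 * b * (\<sigma>/2) * (\<sigma>/2) \<le> 2 * b * circ (w + z) * circ (w - z)"
        using b \<sigma> by (intro mult_mono) auto
      also have "\<dots> < 4*\<epsilon>" using profile_separation[OF a(1), of w z] that z unfolding b_def by linarith
      finally show False using e4 by linarith
    qed
    let ?v = "u + i/n" and ?w = "u + j/n"
    have d: "\<sigma> \<le> circ (?v - ?w)" "\<sigma> \<le> circ (?v - ?w + 2*z)" "\<sigma> \<le> circ (?w - ?v + 2*z)"
      using c1[of i j u] c2[of i j u] c2[of j i u] ij by auto
    have e: "circ (?v - ?w) \<le> circ (?v + z) + circ (?w + z)" "circ (?v - ?w) \<le> circ (?v - z) + circ (?w - z)"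
       "circ (?v - ?w + 2*z) \<le> circ (?v + z) + circ (?w - z)"
       "circ (?w - ?v + 2*z) \<le> circ (?w + z) + circ (?v - z)"
      using circ_diff[of "?v + z" "?w + z"] circ_diff[of "?v - z" "?w - z"] circ_diff[of "?v + z" "?w - z"] circ_diff[of "?w + z" "?v - z"]
      by (simp_all add: algebra_simps)
    from small[OF 1] small[OF 2] d e show False by linarith
  qed
qed

text \<open>
  The two bounds for the growth, combined with the change of the badness term of the potential. On a bad branch the
  badness of the image is not controlled and is taken to be maximal; on a good branch it is bounded.
\<close>
lemma branch_bad:
  fixes \<phi>\<^sub>S \<phi>\<^sub>W :: real
  assumes "t \<ge> 1" "N > 0" "C \<ge> 1" "N \<le> C * max \<bar>X\<bar> \<bar>Y\<bar>" "\<bar>c\<bar> \<le> 2" "\<phi>\<^sub>W \<le> \<phi>\<^sub>S"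
  shows "ln N - badness t X N - ln (4*C) + \<phi>\<^sub>W * ln t
     \<le> ln (vnorm X (Y - t*c*X)) + \<phi>\<^sub>S * ln t + (\<phi>\<^sub>W - \<phi>\<^sub>S) * badness t X' N'"
proof -
  have "(\<phi>\<^sub>S - \<phi>\<^sub>W) * badness t X' N' \<le> (\<phi>\<^sub>S - \<phi>\<^sub>W) * ln t"
    using assms by (intro mult_left_mono badness_le) auto
  with growth_ge[OF assms(1-5)] show ?thesis by (simp add: algebra_simps)
qed

lemma branch_good:
  fixes \<phi>\<^sub>S \<phi>\<^sub>W :: real
  assumes "t \<ge> 1" "N > 0" "C \<ge> 1" "N \<le> C * max \<bar>X\<bar> \<bar>Y\<bar>" "\<kappa> > 0"
    and V: "\<kappa> * max \<bar>Y\<bar> (t * \<bar>X\<bar>) \<le> \<bar>V\<bar>"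
    and \<phi>: "\<phi>\<^sub>W \<le> \<phi>\<^sub>S" "\<phi>\<^sub>S - \<phi>\<^sub>W \<le> 4"
    and b0: "0 < b0" "b0 \<le> 1" "b0 \<le> \<bar>b\<bar>" and large: "\<kappa> * t \<ge> 1" "\<kappa> * t * b0 \<ge> 2 * \<bar>\<alpha>\<bar>"
  shows "ln N + ln t - badness t X N + ln \<kappa> - ln C + \<phi>\<^sub>S * ln t + 4 * ln (b0/2)
     \<le> ln (vnorm X V) + \<phi>\<^sub>S * ln t + (\<phi>\<^sub>W - \<phi>\<^sub>S) * badness t (\<alpha>*X + b*V) (vnorm X V)"
    and "badness t (\<alpha>*X + b*V) (vnorm X V) \<le> - ln (b0/2)"
proof -
  define M where "M = max \<bar>Y\<bar> (t * \<bar>X\<bar>)"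
  have M: "M \<ge> t * \<bar>X\<bar>" "M \<ge> \<bar>Y\<bar>" by (auto simp: M_def)
  have Mp: "M > 0"
  proof (rule ccontr)
    assume "\<not> ?thesis"
    then have "Y = 0" "t * \<bar>X\<bar> \<le> 0" using M by linarith+
    then have "X = 0" "Y = 0" using assms(1) by (auto simp: mult_le_0_iff)
    with assms(2,4) show False by simp
  qed
  have kV: "\<kappa> * M \<le> \<bar>V\<bar>" using V by (simp only: M_def)
  have V0: "V \<noteq> 0" using kV Mp assms(5) by (metis abs_0 linorder_not_le mult_pos_pos)
  have "\<kappa> * (t * \<bar>X\<bar>) \<le> \<kappa> * M" using M assms(5) by (intro mult_left_mono) auto
  then have kX: "(\<kappa> * t) * \<bar>X\<bar> \<le> \<bar>V\<bar>" using kV by (simp add: mult_ac)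
  have "1 * \<bar>X\<bar> \<le> (\<kappa> * t) * \<bar>X\<bar>" using large by (intro mult_right_mono) auto
  then have 1: "\<bar>X\<bar> \<le> \<bar>V\<bar>" using kX by linarith
  have "(2 * \<bar>\<alpha>\<bar>) * \<bar>X\<bar> \<le> (\<kappa> * t * b0) * \<bar>X\<bar>" using large by (intro mult_right_mono) auto
  also have "\<dots> = b0 * ((\<kappa> * t) * \<bar>X\<bar>)" by (simp add: mult_ac)
  also have "\<dots> \<le> b0 * \<bar>V\<bar>" using kX b0 by (intro mult_left_mono) auto
  finally have 2: "2 * \<bar>\<alpha>\<bar> * \<bar>X\<bar> \<le> b0 * \<bar>V\<bar>" .
  show 3: "badness t (\<alpha>*X + b*V) (vnorm X V) \<le> - ln (b0/2)"
    using badness_child_good[OF b0(1,3) 1 2 V0] assms(1) by simp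
  have "(\<phi>\<^sub>S - \<phi>\<^sub>W) * badness t (\<alpha>*X + b*V) (vnorm X V) \<le> (\<phi>\<^sub>S - \<phi>\<^sub>W) * (- ln (b0/2))"
    using 3 \<phi> by (intro mult_left_mono) auto
  also have "\<dots> \<le> 4 * (- ln (b0/2))"
    using \<phi> b0 by (intro mult_right_mono) auto
  finally have "(\<phi>\<^sub>S - \<phi>\<^sub>W) * badness t (\<alpha>*X + b*V) (vnorm X V) \<le> - 4 * ln (b0/2)" by simp
  with growth_good[OF assms(1-5) V]
  show "ln N + ln t - badness t X N + ln \<kappa> - ln C + \<phi>\<^sub>S * ln t + 4 * ln (b0/2)
     \<le> ln (vnorm X V) + \<phi>\<^sub>S * ln t + (\<phi>\<^sub>W - \<phi>\<^sub>S) * badness t (\<alpha>*X + b*V) (vnorm X V)"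
    by (simp add: algebra_simps)
qed

text \<open>
  The bounds are uniform over the linear maps obtained by composing with a bounded shear, which is what the derivative of the
  transversal shear does.
\<close>
lemma linear_bounds:
  fixes \<alpha> \<beta> \<gamma> \<delta> :: real
  assumes det: "\<alpha>*\<delta> - \<beta>*\<gamma> \<noteq> 0"
  obtains C where "C \<ge> 1"
    "\<And>\<rho> v w. \<bar>\<rho>\<bar> \<le> 1 \<Longrightarrow> \<bar>\<alpha>* v + (\<beta>+\<alpha>*\<rho>)*w\<bar> \<le> C * vnorm v w"
    "\<And>\<rho> v w. \<bar>\<rho>\<bar> \<le> 1 \<Longrightarrow> \<bar>\<gamma>* v + (\<delta>+\<gamma>*\<rho>)*w\<bar> \<le> C * vnorm v w"
    "\<And>\<rho> v w. \<bar>\<rho>\<bar> \<le> 1 \<Longrightarrow> vnorm v w \<le> C * max \<bar>\<alpha>* v + (\<beta>+\<alpha>*\<rho>)*w\<bar> \<bar>\<gamma>* v + (\<delta>+\<gamma>*\<rho>)*w\<bar>"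
proof -
  define S where "S = 2*\<bar>\<alpha>\<bar> + \<bar>\<beta>\<bar> + 2*\<bar>\<gamma>\<bar> + \<bar>\<delta>\<bar>"
  define D where "D = \<bar>\<alpha>*\<delta> - \<beta>*\<gamma>\<bar>"
  have D: "D > 0" using det by (simp add: D_def)
  define C where "C = 1 + S + 2 * S / D"
  have S0: "S \<ge> 0" by (simp add: S_def)
  have C1: "C \<ge> 1" "C \<ge> S" "C \<ge> 2 * S / D" using S0 D by (auto simp: C_def)
  have upper: "\<bar>p* v + (q+p*\<rho>)*w\<bar> \<le> (2*\<bar>p\<bar> + \<bar>q\<bar>) * vnorm v w" if "\<bar>\<rho>\<bar> \<le> 1" for p q \<rho> v w :: real
  proof -
    have v: "\<bar>v\<bar> \<le> vnorm v w" "\<bar>w\<bar> \<le> vnorm v w" by (auto simp: vnorm_def)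
    have "\<bar>p* v + (q+p*\<rho>)*w\<bar> \<le> \<bar>p* v\<bar> + \<bar>q*w\<bar> + \<bar>p*\<rho>*w\<bar>" by (simp add: algebra_simps)
    also have "\<dots> \<le> \<bar>p\<bar> * vnorm v w + \<bar>q\<bar> * vnorm v w + (\<bar>p\<bar> * 1) * vnorm v w"
      unfolding abs_mult using that v by (intro add_mono mult_mono) auto
    finally show ?thesis by (simp add: algebra_simps)
  qed
  have vp: "vnorm v w \<ge> 0" for v w by (simp add: vnorm_def le_max_iff_disj)
  show ?thesis
  proof (rule that[OF C1(1)])
    fix \<rho> v w :: real assume r: "\<bar>\<rho>\<bar> \<le> 1"
    have "(2*\<bar>\<alpha>\<bar> + \<bar>\<beta>\<bar>) * vnorm v w \<le> C * vnorm v w"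
      by (intro mult_right_mono vp order_trans[OF _ C1(2)]) (simp add: S_def)
    then show "\<bar>\<alpha>* v + (\<beta>+\<alpha>*\<rho>)*w\<bar> \<le> C * vnorm v w" using upper[OF r, of \<alpha> v \<beta> w] by linarith
    have "(2*\<bar>\<gamma>\<bar> + \<bar>\<delta>\<bar>) * vnorm v w \<le> C * vnorm v w"
      by (intro mult_right_mono vp order_trans[OF _ C1(2)]) (simp add: S_def)
    then show "\<bar>\<gamma>* v + (\<delta>+\<gamma>*\<rho>)*w\<bar> \<le> C * vnorm v w" using upper[OF r, of \<gamma> v \<delta> w] by linarith
    define X Y where "X = \<alpha>* v + (\<beta>+\<alpha>*\<rho>)*w" and "Y = \<gamma>* v + (\<delta>+\<gamma>*\<rho>)*w"
    define m where "m = max \<bar>X\<bar> \<bar>Y\<bar>"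
    have m: "\<bar>X\<bar> \<le> m" "\<bar>Y\<bar> \<le> m" by (auto simp: m_def)
    have bound: "\<bar>p*X + q*Y\<bar> \<le> (\<bar>p\<bar>+\<bar>q\<bar>) * m" for p q
    proof -
      have "\<bar>p*X + q*Y\<bar> \<le> \<bar>p\<bar>*\<bar>X\<bar> + \<bar>q\<bar>*\<bar>Y\<bar>" unfolding abs_mult[symmetric] by linarith
      also have "\<dots> \<le> \<bar>p\<bar>*m + \<bar>q\<bar>*m" using m by (intro add_mono mult_left_mono) auto
      finally show ?thesis by (simp add: algebra_simps)
    qed
    have m0: "m \<ge> 0" using m by linarith
    have "(\<alpha>*\<delta> - \<beta>*\<gamma>) * v = (\<delta>+\<gamma>*\<rho>) * X + (-(\<beta>+\<alpha>*\<rho>)) * Y" unfolding X_def Y_def by (simp add: algebra_simps)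
    then have "D * \<bar>v\<bar> \<le> (\<bar>\<delta>+\<gamma>*\<rho>\<bar>+\<bar>-(\<beta>+\<alpha>*\<rho>)\<bar>) * m" unfolding D_def abs_mult[symmetric] using bound by metis
    also have "\<dots> \<le> (2 * S) * m"
    proof (rule mult_right_mono[OF _ m0])
      have "\<bar>\<gamma>*\<rho>\<bar> \<le> \<bar>\<gamma>\<bar>" "\<bar>\<alpha>*\<rho>\<bar> \<le> \<bar>\<alpha>\<bar>" unfolding abs_mult using r by (simp_all add: mult_left_le)
      then show "\<bar>\<delta>+\<gamma>*\<rho>\<bar>+\<bar>-(\<beta>+\<alpha>*\<rho>)\<bar> \<le> 2 * S" using abs_triangle_ineq[of \<delta> "\<gamma>*\<rho>"] abs_triangle_ineq[of \<beta> "\<alpha>*\<rho>"] abs_ge_zero[of \<gamma>] abs_ge_zero[of \<alpha>]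
          abs_ge_zero[of \<delta>] abs_ge_zero[of \<beta>]
        unfolding S_def abs_minus_cancel by argo
    qed
    finally have 1: "\<bar>v\<bar> \<le> 2 * S / D * m" using D by (simp add: field_simps)
    have "(\<alpha>*\<delta> - \<beta>*\<gamma>) * w = (-\<gamma>) * X + \<alpha> * Y" unfolding X_def Y_def by (simp add: algebra_simps)
    then have "D * \<bar>w\<bar> \<le> (\<bar>-\<gamma>\<bar>+\<bar>\<alpha>\<bar>) * m" unfolding D_def abs_mult[symmetric] using bound by metis
    also have "\<dots> \<le> (2 * S) * m" by (rule mult_right_mono[OF _ m0]) (auto simp: S_def)
    finally have 2: "\<bar>w\<bar> \<le> 2 * S / D * m" using D by (simp add: field_simps)
    have "2 * S / D * m \<le> C * m" using C1 m0 by (intro mult_right_mono) auto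
    with 1 2 show "vnorm v w \<le> C * max \<bar>\<alpha>* v + (\<beta>+\<alpha>*\<rho>)*w\<bar> \<bar>\<gamma>* v + (\<delta>+\<gamma>*\<rho>)*w\<bar>"
      unfolding X_def[symmetric] Y_def[symmetric] m_def[symmetric] vnorm_def by simp
  qed
qed

corollary linear_bounds_untwisted:
  fixes \<alpha> \<beta> \<gamma> \<delta> :: real
  assumes det: "\<alpha>*\<delta> - \<beta>*\<gamma> \<noteq> 0"
  obtains C where "C \<ge> 1"
    "\<And>v w. \<bar>\<alpha>* v + \<beta>*w\<bar> \<le> C * vnorm v w" "\<And>v w. \<bar>\<gamma>* v + \<delta>*w\<bar> \<le> C * vnorm v w"
    "\<And>v w. vnorm v w \<le> C * max \<bar>\<alpha>* v + \<beta>*w\<bar> \<bar>\<gamma>* v + \<delta>*w\<bar>"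
proof -
  obtain C where C: "C \<ge> 1"
    "\<And>\<rho> v w. \<bar>\<rho>\<bar> \<le> 1 \<Longrightarrow> \<bar>\<alpha>* v + (\<beta>+\<alpha>*\<rho>)*w\<bar> \<le> C * vnorm v w"
    "\<And>\<rho> v w. \<bar>\<rho>\<bar> \<le> 1 \<Longrightarrow> \<bar>\<gamma>* v + (\<delta>+\<gamma>*\<rho>)*w\<bar> \<le> C * vnorm v w"
    "\<And>\<rho> v w. \<bar>\<rho>\<bar> \<le> 1 \<Longrightarrow> vnorm v w \<le> C * max \<bar>\<alpha>* v + (\<beta>+\<alpha>*\<rho>)*w\<bar> \<bar>\<gamma>* v + (\<delta>+\<gamma>*\<rho>)*w\<bar>"
    using linear_bounds[OF det] by blast
  from C(2)[of 0] C(3)[of 0] C(4)[of 0] that[OF C(1)] show ?thesis by simp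
qed

lemma sum_ge_two_levels:
  fixes f :: "'a \<Rightarrow> real"
  assumes "finite I" "B \<subseteq> I" "\<And>i. i \<in> B \<Longrightarrow> lo \<le> f i" "\<And>i. i \<in> I - B \<Longrightarrow> hi \<le> f i"
  shows "real (card B) * lo + (real (card I) - real (card B)) * hi \<le> sum f I"
proof -
  have fB: "finite B" using assms finite_subset by blast
  have "sum f I = sum f B + sum f (I - B)" using sum.subset_diff[OF assms(2,1), of f] by simp
  moreover have "real (card B) * lo \<le> sum f B" using sum_bounded_below[of B lo f] assms(3) by simp
  moreover have "real (card (I - B)) * hi \<le> sum f (I - B)" using sum_bounded_below[of "I - B" hi f] assms(4) by simp
  moreover have "real (card (I - B)) = real (card I) - real (card B)"
    using card_Diff_subset[OF fB assms(2)] card_mono[OF assms(1,2)] by simp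
  ultimately show ?thesis by simp
qed

section \<open>Fibres with at least four slopes\<close>

text \<open>
  Either \<open>Y\<close> is negligible against \<open>t X\<close>, so that a bad branch must have a small slope \<open>c\<close>, or \<open>X\<close> is as small as it matters and the
  badness is maximal up to a constant.
\<close>
lemma flat_or_vertical:
  assumes "t > 0" "N > 0" "C \<ge> 1" "0 < \<epsilon>" "\<epsilon> \<le> 1" "\<bar>Y\<bar> \<le> C * N"
  obtains "\<bar>Y\<bar> \<le> \<epsilon> * (t * \<bar>X\<bar>)" | "ln t - ln (C / \<epsilon>) \<le> badness t X N"
proof (cases "\<bar>Y\<bar> \<le> \<epsilon> * (t * \<bar>X\<bar>)")
  case False
  then have "\<epsilon> * (t * \<bar>X\<bar>) \<le> C * N" using assms(6) by linarith
  then have "t * \<bar>X\<bar> \<le> C / \<epsilon> * N" using assms(4) by (simp add: field_simps)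
  moreover have "1 * \<epsilon> \<le> C" using assms by linarith
  then have "1 \<le> C / \<epsilon>" using assms(4) by (simp add: pos_le_divide_eq)
  ultimately show ?thesis using badness_ge_of_le[OF assms(1,2)] that(2) by blast
qed

text \<open>
  Up to constants, a direction of badness \<open>0\<close> is credited \<open>\<phi>\<^sub>S ln t\<close> and one of maximal badness \<open>\<phi>\<^sub>W ln t\<close>, with linear
  interpolation between; \<open>p v + q w\<close> is the coordinate \<open>X\<close> of the inverse image of \<open>(v, w)\<close>.
\<close>
definition fibre_potential ::
  "real \<Rightarrow> real \<Rightarrow> real \<Rightarrow> real \<Rightarrow> real \<Rightarrow> real \<Rightarrow> real \<Rightarrow> real" where
  "fibre_potential t \<phi>\<^sub>S \<phi>\<^sub>W p q v w =
     ln (vnorm v w) + \<phi>\<^sub>S * ln t + (\<phi>\<^sub>W - \<phi>\<^sub>S) * badness t (p* v + q*w) (vnorm v w)"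

lemma vnorm_pos: "(v, w) \<noteq> (0, 0) \<Longrightarrow> vnorm v w > 0"
  by (auto simp: vnorm_def less_max_iff_disj)

text \<open>
  With \<open>b\<close> bad branches and badness \<open>\<omega>\<close> the inequality reduces to \<open>n \<omega> + (n - 3 b) ln t \<ge> const\<close>. For \<open>b \<le> 1\<close> the
  second term is positive, as \<open>n \<ge> 4\<close>. There are at most two bad branches, and if there are two, then \<open>Y\<close> is not negligible (at
  most one slope is small), so \<open>\<omega>\<close> is \<open>ln t\<close> up to a constant and \<open>2 n - 6 > 0\<close> decides.
\<close>
lemma drift_four_or_more:
  fixes \<alpha> \<beta> \<gamma> \<delta> a z :: real and n :: nat
  assumes \<beta>: "\<beta> \<noteq> 0" and det: "\<alpha>*\<delta> - \<beta>*\<gamma> \<noteq> 0" and n: "n \<ge> 4"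
    and a: "0 \<le> a" "a < 1/4" and z: "profile a z = 0"
    and nz: "\<And>h::int. of_int h / n + 2 * z \<notin> \<int>"
  obtains t\<^sub>0 where "t\<^sub>0 \<ge> 1"
    "\<And>t u v w. \<lbrakk>t \<ge> t\<^sub>0; (v,w) \<noteq> (0,0)\<rbrakk> \<Longrightarrow>
       real n * (fibre_potential t 0 (-2) \<alpha> \<beta> v w + 1) \<le>
       (\<Sum>i<n. fibre_potential t 0 (-2) \<alpha> \<beta> (\<alpha>* v + \<beta>*w)
          (\<gamma>* v + \<delta>*w - t * profile a (u + i/n) * (\<alpha>* v + \<beta>*w)))"
proof -
  obtain C where C: "C \<ge> 1"
    "\<And>v w. \<bar>\<alpha>* v + \<beta>*w\<bar> \<le> C * vnorm v w" "\<And>v w. \<bar>\<gamma>* v + \<delta>*w\<bar> \<le> C * vnorm v w"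
    "\<And>v w. vnorm v w \<le> C * max \<bar>\<alpha>* v + \<beta>*w\<bar> \<bar>\<gamma>* v + \<delta>*w\<bar>"
    using linear_bounds_untwisted[OF det] by blast
  have n1: "n \<ge> 1" using n by simp
  obtain \<epsilon> where \<epsilon>: "0 < \<epsilon>" "\<epsilon> \<le> 1/4" and
    three: "\<And>u i j k. \<lbrakk>i < n; j < n; k < n; i \<noteq> j; i \<noteq> k; j \<noteq> k;
        \<bar>profile a (u + i/n) - profile a (u + j/n)\<bar> < 6*\<epsilon>;
        \<bar>profile a (u + i/n) - profile a (u + k/n)\<bar> < 6*\<epsilon>\<rbrakk> \<Longrightarrow> False" and
    two: "\<And>u i j. \<lbrakk>i < n; j < n; i \<noteq> j; \<bar>profile a (u + i/n)\<bar> < 4*\<epsilon>; \<bar>profile a (u + j/n)\<bar> < 4*\<epsilon>\<rbrakk> \<Longrightarrow> False"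
    using profile_fibre_geometry[OF a z n1 nz] by blast
  define b0 where "b0 = min 1 \<bar>\<beta>\<bar>"
  have b0: "0 < b0" "b0 \<le> 1" "b0 \<le> \<bar>\<beta>\<bar>" using \<beta> by (auto simp: b0_def)
  define K where "K = ln (4*C) + ln C - ln \<epsilon> - 4 * ln (b0/2)"
  have K1: "ln (4*C) \<le> K" "ln C - ln \<epsilon> - 4 * ln (b0/2) \<le> K" "0 \<le> ln C"
  proof -
    have "0 \<le> ln C" "0 \<le> ln (4*C)" using C(1) by simp_all
    moreover have "ln \<epsilon> \<le> 0" using \<epsilon> by simp
    moreover have "ln (b0/2) \<le> 0" using b0 by simp
    ultimately show "ln (4*C) \<le> K" "ln C - ln \<epsilon> - 4 * ln (b0/2) \<le> K" "0 \<le> ln C" by (simp_all add: K_def)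
  qed
  (* In each case at least one multiple of \<open>ln t\<close> is left over; it has to absorb the constants of all n branches. *)
  define Q where "Q = real n * (K + ln C + ln (C/\<epsilon>) + 1)"
  (* The last two bounds make stretched vectors so nearly parallel to the shear direction that their badness is bounded. *)
  define t0 where "t0 = max (max 1 (exp Q)) (max (1/\<epsilon>) (2*\<bar>\<alpha>\<bar> / (\<epsilon> * b0)))"
  show ?thesis
  proof (rule that)
    show "t0 \<ge> 1" by (simp add: t0_def)
    fix t u v w :: real
    assume t: "t \<ge> t0" and vw: "(v,w) \<noteq> (0,0)"
    have t1: "t \<ge> 1" and tQ: "exp Q \<le> t" and te: "1/\<epsilon> \<le> t" "2*\<bar>\<alpha>\<bar> / (\<epsilon> * b0) \<le> t" using t by (simp_all add: t0_def)
    have "ln (exp Q) \<le> ln t" using tQ by (intro ln_mono) simp_all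
    then have LQ: "Q \<le> ln t" by simp
    have large: "\<epsilon> * t \<ge> 1" "\<epsilon> * t * b0 \<ge> 2 * \<bar>\<alpha>\<bar>"
      using te \<epsilon> b0 by (simp_all add: pos_divide_le_eq mult_ac)
    define N where "N = vnorm v w"
    have N: "N > 0" unfolding N_def by (rule vnorm_pos[OF vw])
    define X where "X = \<alpha>* v + \<beta>*w"
    define Y where "Y = \<gamma>* v + \<delta>*w"
    have XY: "\<bar>X\<bar> \<le> C * N" "\<bar>Y\<bar> \<le> C * N" "N \<le> C * max \<bar>X\<bar> \<bar>Y\<bar>"
      using C(2-4)[of v w] unfolding X_def Y_def N_def by blast+
    define c where "c i = profile a (u + real i/n)" for i :: nat
    have c: "\<bar>c i\<bar> \<le> 2" for i using a unfolding c_def by (intro profile_bound) simp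
    define om where "om = badness t X N"
    have om: "- ln C \<le> om" unfolding om_def by (rule badness_ge[OF t1 N C(1) XY(1)])
    define f where "f i = fibre_potential t 0 (-2) \<alpha> \<beta> X (Y - t * c i * X)" for i
    define B where "B = {i. i < n \<and> \<bar>Y - t * c i * X\<bar> < \<epsilon> * max \<bar>Y\<bar> (t * \<bar>X\<bar>)}"
    have fbad: "ln N - om - K - 2 * ln t \<le> f i" for i
      using branch_bad[OF t1 N C(1) XY(3) c[of i], of "-2" 0 "\<alpha>*X + \<beta>*(Y - t * c i * X)" "vnorm X (Y - t * c i * X)"] K1(1)
      unfolding f_def fibre_potential_def om_def by simp
    have fgood: "ln N + ln t - om - K \<le> f i" if "i \<in> {..<n} - B" for i
    proof -
      have "\<epsilon> * max \<bar>Y\<bar> (t * \<bar>X\<bar>) \<le> \<bar>Y - t * c i * X\<bar>" using that by (auto simp: B_def)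
      from branch_good(1)[OF t1 N C(1) XY(3) \<epsilon>(1) this, where \<phi>\<^sub>S = 0 and \<phi>\<^sub>W = "-2" and ?b0.0 = b0 and b = \<beta> and \<alpha> = \<alpha>, OF _ _ b0 large] K1(2)
      show ?thesis unfolding f_def fibre_potential_def om_def by simp
    qed
    have fB: "finite B" "B \<subseteq> {..<n}" by (auto simp: B_def)
    define b where "b = card B"
    have sum: "real b * (ln N - om - K - 2 * ln t) + (real n - real b) * (ln N + ln t - om - K) \<le> sum f {..<n}"
      using sum_ge_two_levels[OF _ fB(2), of _ f, OF _ fbad fgood] unfolding b_def by simp
    have dist: "\<bar>c i - c j\<bar> < 6 * \<epsilon>" if "i \<in> B" "j \<in> B" for i j
    proof -
      from that have "\<bar>Y - t * c i * X\<bar> < \<epsilon> * max \<bar>Y\<bar> (t * \<bar>X\<bar>)" "\<bar>Y - t * c j * X\<bar> < \<epsilon> * max \<bar>Y\<bar> (t * \<bar>X\<bar>)" by (auto simp: B_def)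
      from two_bad_branches[OF \<epsilon>(2,1) c \<epsilon>(1) _ this] t1 show ?thesis by simp
    qed
    have b2: "b \<le> 2"
    proof (rule ccontr)
      assume "\<not> b \<le> 2"
      then have "card B \<ge> 3" by (simp add: b_def)
      then obtain T where "T \<subseteq> B" "card T = 3" by (meson obtain_subset_with_card_n)
      then obtain i j k where "i \<in> B" "j \<in> B" "k \<in> B" "i \<noteq> j" "i \<noteq> k" "j \<noteq> k"
        by (auto simp: card_Suc_eq numeral_3_eq_3)
      with three[of i j k u] dist[of i j] dist[of i k] show False by (auto simp: B_def c_def)
    qed
    have b2om: "ln t - ln (C/\<epsilon>) \<le> om" if "b = 2"
    proof -
      from that obtain i j where ij: "i \<in> B" "j \<in> B" "i \<noteq> j" by (auto simp: b_def card_2_iff)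
      from t1 have tp: "t > 0" by simp
      show ?thesis
      proof (rule flat_or_vertical[OF tp N C(1) \<epsilon>(1) _ XY(2), of X])
        show "\<epsilon> \<le> 1" using \<epsilon> by simp
        assume flat: "\<bar>Y\<bar> \<le> \<epsilon> * (t * \<bar>X\<bar>)"
        have "\<bar>c l\<bar> < 4 * \<epsilon>" if "l \<in> B" for l
          using bad_branch_flat[OF \<epsilon>(2,1) c[of l] _ _ flat] that t1 by (simp add: B_def)
        with ij two[of i j u] show ?thesis by (auto simp: B_def c_def)
      qed (simp add: om_def)
    qed
    have "real n * (ln N - 2 * om + 1) \<le> real b * (ln N - om - K - 2 * ln t) + (real n - real b) * (ln N + ln t - om - K)"
    proof -
      define M where "M = real n * om"
      have M1: "- real n * ln C \<le> M" using om mult_left_mono[of "- ln C" om "real n"] by (simp add: M_def)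
      have Q1: "real n * K + real n * ln C + real n * ln (C/\<epsilon>) + real n \<le> ln t"
        using LQ by (simp add: Q_def algebra_simps)
      have lCe: "0 \<le> ln (C/\<epsilon>)" using C(1) \<epsilon> by simp
      have nl: "0 \<le> real n * ln (C/\<epsilon>)" "0 \<le> real n * ln C" using lCe K1(3) by simp_all
      have L0: "ln t \<ge> 0" using t1 by simp
      have nL: "4 * ln t \<le> real n * ln t" using n L0 by (intro mult_right_mono) simp_all
      have diff: "real b * (ln N - om - K - 2 * ln t) + (real n - real b) * (ln N + ln t - om - K) - real n * (ln N - 2 * om + 1)
         = (real n * ln t - 3 * (real b * ln t)) + M - real n * K - real n" by (simp add: M_def algebra_simps)
      consider "b = 0" | "b = 1" | "b = 2" using b2 by linarith
      then show ?thesis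
      proof cases
        case 3
        have "real n * (ln t - ln (C/\<epsilon>)) \<le> M" unfolding M_def using b2om[OF 3] by (intro mult_left_mono) simp_all
        then have "real n * ln t - real n * ln (C/\<epsilon>) \<le> M" by (simp add: algebra_simps)
        then show ?thesis using diff 3 nL Q1 nl L0 by simp
      qed (use diff M1 Q1 nL nl L0 in simp_all)
    qed
    with sum have "real n * (ln N - 2 * om + 1) \<le> sum f {..<n}" by linarith
    then show "real n * (fibre_potential t 0 (-2) \<alpha> \<beta> v w + 1) \<le>
       (\<Sum>i<n. fibre_potential t 0 (-2) \<alpha> \<beta> (\<alpha>* v + \<beta>*w)
          (\<gamma>* v + \<delta>*w - t * profile a (u + i/n) * (\<alpha>* v + \<beta>*w)))"
      unfolding f_def c_def X_def Y_def N_def om_def fibre_potential_def by simp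
  qed
qed

section \<open>Fibres with three slopes\<close>

lemma circ_abs [simp]: "circ \<bar>x\<bar> = circ x"
  by (cases "x \<ge> 0") simp_all

lemma circ_thirds: assumes "i < 3" "j < 3" "i \<noteq> j" shows "circ ((u + real i/3) - (u + real j/3)) = sqrt 3 / 2"
proof -
  have 1: "circ (1/3) = sqrt 3 / 2" by (simp add: circ_def sin_60)
  have "circ (2/3) = circ (-(1/3) + 1)" by simp
  also have "\<dots> = circ (-(1/3))" by (rule circ_add_Ints) simp
  finally have 2: "circ (2/3) = sqrt 3 / 2" using 1 by (simp only: circ_minus)
  have 3: "circ (-(1/3)) = sqrt 3 / 2" "circ (-(2/3)) = sqrt 3 / 2" using 1 2 by (simp_all only: circ_minus)
  consider "i=0 \<and> j=1" | "i=0 \<and> j=2" | "i=1 \<and> j=0" | "i=1 \<and> j=2" | "i=2 \<and> j=0" | "i=2 \<and> j=1" using assms by linarith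
  then show ?thesis using 1 2 3 by cases simp_all
qed

lemma circ_half_odd: assumes "x - 1/2 \<in> \<int>" shows "circ x = 1"
proof -
  have "circ x = circ (1/2)" by (rule circ_cong_Ints[OF assms])
  then show ?thesis by (simp add: circ_def)
qed

text \<open>
  Two branches \<open>u\<close>, \<open>v\<close> of slopes that agree up to \<open>t\<^sup>-\<^sup>1\<^sup>/\<^sup>2\<close> are nearly opposite, and then their displacements differ by
  \<open>t \<surd>3 / (2\<pi>)\<close> up to an error of order \<open>\<eta>\<close>, independently of \<open>u\<close>. If \<open>t\<close> is such that this difference, multiplied by \<open>6 D \<beta>\<close>,
  is a half-integer, the phases \<open>\<theta>\<close>, \<open>\<theta>'\<close> of the two preimages cannot both be close to the resonant values, whose
  multiples by \<open>6 D\<close> are integers.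
\<close>
lemma tuned_shear_separates:
  fixes D :: nat and \<beta> t \<eta> u v \<Delta> \<theta> \<theta>' :: real and h h' :: int
  assumes t: "t \<ge> 1" and tuned: "6 * real D * t * \<beta> * sqrt 3 / (2*pi) - 1/2 \<in> \<int>"
    and \<eta>: "0 < \<eta>" "\<eta> \<le> 1" "(12 * D + 12 * D * \<bar>\<beta>\<bar>) * \<eta> < 1"
    and uv: "circ (u - v) = sqrt 3 / 2" "circ (u + v) \<le> \<eta> / sqrt t"
    and \<Delta>: "D * \<Delta> \<in> \<int>"
    and \<theta>: "\<theta> - \<theta>' = \<Delta> - t * \<beta> * (sin (2*pi*u) / (2*pi) - sin (2*pi * v) / (2*pi))"
    and near: "circ (2*\<theta> + h/3) \<le> \<eta> / sqrt t" "circ (2*\<theta>' + h'/3) \<le> \<eta> / sqrt t"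
  shows False
proof -
  have st: "sqrt t \<ge> 1" "sqrt t > 0" using t by simp_all
  have \<eta>t: "\<eta> / sqrt t \<le> \<eta>" using st \<eta> by (simp add: divide_le_eq_1 pos_divide_le_eq mult_le_cancel_left1)
  have one: "circ (6 * D * x) \<le> 3 * D * \<eta>" if "circ (2*x + of_int k/3) \<le> \<eta> / sqrt t" for x :: real and k :: int
  proof -
    have "6 * D * x = of_nat (3*D) * (2*x + of_int k/3) - of_int (int D * k)" by (simp add: algebra_simps)
    then have "circ (6 * D * x) = circ (of_nat (3*D) * (2*x + of_int k/3))"
      by (intro circ_cong_Ints) simp
    also have "\<dots> \<le> of_nat (3*D) * circ (2*x + of_int k/3)" by (rule circ_mult_nat)
    also have "\<dots> \<le> of_nat (3*D) * \<eta>" using that \<eta>t by (intro mult_left_mono) auto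
    finally show ?thesis by simp
  qed
  define W where "W = 6 * real D * t * \<beta> * sqrt 3 / (2*pi)"
  (* The displacements differ by \<open>sin (pi (u - v)) cos (pi (u + v)) / pi\<close>, where the second factor is \<open>\<plusminus>1\<close> up to an error of
     order \<open>1/t\<close>: this is why closeness of order \<open>t\<^sup>-\<^sup>1\<^sup>/\<^sup>2\<close> suffices against the factor t. *)
  define \<sigma> where "\<sigma> = cos (pi * (u + v))"
  have S: "\<bar>sin (2*pi*u) / (2*pi) - sin (2*pi * v) / (2*pi)\<bar> = sqrt 3 / (2*pi) * \<bar>\<sigma>\<bar>"
  proof -
    have "sin (2*pi*u) - sin (2*pi * v) = 2 * sin (pi * (u - v)) * \<sigma>"
      unfolding sin_diff_sin \<sigma>_def by (simp add: algebra_simps add_divide_distrib diff_divide_distrib)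
    then have "\<bar>sin (2*pi*u) - sin (2*pi * v)\<bar> = sqrt 3 * \<bar>\<sigma>\<bar>"
      using uv(1) by (simp add: abs_mult circ_def)
    moreover have "sin (2*pi*u) / (2*pi) - sin (2*pi * v) / (2*pi) = (sin (2*pi*u) - sin (2*pi * v)) / (2*pi)" by (simp add: diff_divide_distrib)
    ultimately show ?thesis by (simp add: abs_divide)
  qed
  define A where "A = 6 * D * (t * \<beta> * (sin (2*pi*u) / (2*pi) - sin (2*pi * v) / (2*pi)))"
  have "\<bar>A\<bar> = 6 * D * t * \<bar>\<beta>\<bar> * (sqrt 3 / (2*pi) * \<bar>\<sigma>\<bar>)" unfolding A_def abs_mult S using t by simp
  also have "\<dots> = \<bar>W\<bar> * \<bar>\<sigma>\<bar>" unfolding W_def using t by (simp add: abs_mult abs_divide)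
  finally have A: "\<bar>A\<bar> = \<bar>W\<bar> * \<bar>\<sigma>\<bar>" .
  have "circ A \<le> 6 * D * \<eta>"
  proof -
    have Z: "t * \<beta> * (sin (2*pi*u) / (2*pi) - sin (2*pi * v) / (2*pi)) = \<Delta> - (\<theta> - \<theta>')" using \<theta> by simp
    have "A = 6 * D * \<theta>' - 6 * D * \<theta> + 6 * (D * \<Delta>)" unfolding A_def Z by (simp add: algebra_simps)
    moreover have "6 * (D * \<Delta>) \<in> \<int>" by (intro Ints_mult \<Delta>) simp
    ultimately have "circ A = circ (6 * D * \<theta>' - 6 * D * \<theta>)" by (intro circ_cong_Ints) simp
    also have "\<dots> \<le> 3 * D * \<eta> + 3 * D * \<eta>" using circ_diff one[OF near(1)] one[OF near(2)] by (smt (verit))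
    finally show ?thesis by (simp add: mult_ac)
  qed
  then have cA: "circ (\<bar>W\<bar> * \<bar>\<sigma>\<bar>) \<le> 6 * D * \<eta>" using A circ_abs by metis
  have "circ \<bar>W\<bar> = 1" using circ_half_odd[OF tuned] by (simp only: W_def circ_abs)
  also have "\<bar>W\<bar> = \<bar>W\<bar> * \<bar>\<sigma>\<bar> + \<bar>W\<bar> * (1 - \<bar>\<sigma>\<bar>)" by (simp add: algebra_simps)
  finally have "1 \<le> 6 * D * \<eta> + circ (\<bar>W\<bar> * (1 - \<bar>\<sigma>\<bar>))"
    using circ_add[of "\<bar>W\<bar> * \<bar>\<sigma>\<bar>" "\<bar>W\<bar> * (1 - \<bar>\<sigma>\<bar>)"] cA by linarith
  moreover have "circ (\<bar>W\<bar> * (1 - \<bar>\<sigma>\<bar>)) \<le> 6 * D * \<bar>\<beta>\<bar> * \<eta>"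
  proof -
    have s1: "\<bar>\<sigma>\<bar> \<le> 1" by (simp add: \<sigma>_def)
    have "\<bar>\<sigma>\<bar> * \<bar>\<sigma>\<bar> \<le> \<bar>\<sigma>\<bar> * 1" using s1 by (intro mult_left_mono) auto
    moreover have "\<bar>\<sigma>\<bar> * \<bar>\<sigma>\<bar> = 1 - circ (u+v) * circ (u+v)"
      unfolding \<sigma>_def circ_def by (simp add: abs_mult_self_eq) (metis cos_squared_eq power2_eq_square)
    moreover have "circ (u+v) * circ (u+v) \<le> (\<eta> / sqrt t) * (\<eta> / sqrt t)" using uv(2) order_trans[OF circ_nonneg uv(2)] by (intro mult_mono) auto
    moreover have "(\<eta> / sqrt t) * (\<eta> / sqrt t) = \<eta> * \<eta> / t" using t by simp
    ultimately have "1 - \<bar>\<sigma>\<bar> \<le> \<eta> * \<eta> / t" by linarith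
    moreover have "\<eta> * \<eta> / t \<le> \<eta> / t" using \<eta> t by (intro divide_right_mono) (auto simp: mult_left_le)
    ultimately have s2: "1 - \<bar>\<sigma>\<bar> \<le> \<eta> / t" by linarith
    have "circ (\<bar>W\<bar> * (1 - \<bar>\<sigma>\<bar>)) \<le> pi * \<bar>\<bar>W\<bar> * (1 - \<bar>\<sigma>\<bar>)\<bar>" by (rule circ_le)
    also have "\<dots> = pi * \<bar>W\<bar> * (1 - \<bar>\<sigma>\<bar>)" using s1 by (simp add: abs_mult)
    also have "\<dots> \<le> pi * \<bar>W\<bar> * (\<eta> / t)" using s2 by (intro mult_left_mono) auto
    also have "\<dots> = 3 * D * \<bar>\<beta>\<bar> * sqrt 3 * \<eta>" unfolding W_def using t by (simp add: abs_mult abs_divide field_simps)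
    also have "\<dots> \<le> 3 * D * \<bar>\<beta>\<bar> * 2 * \<eta>" using \<eta> by (intro mult_right_mono mult_left_mono) (auto intro: real_le_lsqrt)
    finally show ?thesis by simp
  qed
  ultimately show False using \<eta>(3) by (simp add: algebra_simps)
qed

text \<open>
  The phase \<open>\<theta>\<close> of a point is the coordinate \<open>u\<close> of its preimages; it is resonant when two of the three slopes
  \<open>cos (2\<pi>(\<theta> + i/3))\<close> nearly coincide.
\<close>
definition resonance_weight :: "real \<Rightarrow> real \<Rightarrow> real \<Rightarrow> real" where
  "resonance_weight \<eta> t \<theta> = (if \<exists>h::int. circ (2*\<theta> + h/3) \<le> \<eta> / sqrt t then - 9/5 else - 13/10)"

lemma resonance_weight_bounds: "- 9/5 \<le> resonance_weight \<eta> t \<theta>" "resonance_weight \<eta> t \<theta> \<le> - 13/10"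
  by (auto simp: resonance_weight_def)

text \<open>
  With one bad branch the balance is \<open>2 - 9/5 > 0\<close> multiples of \<open>ln t\<close>. With two bad branches the badness of the base
  vector is maximal and contributes \<open>3 (\<kappa> - 1)\<close>, where \<open>-\<kappa>\<close> is the weight at the base point. At a resonant point this is
  \<open>12/5\<close>, and the two bad preimages cost at most \<open>9/5 + 13/10\<close> because they are not both resonant: \<open>1 + 12/5 - 31/10 > 0\<close>. At a
  nonresonant point it is only \<open>9/10\<close>, but the two slopes differ by \<open>t\<^sup>-\<^sup>1\<^sup>/\<^sup>2\<close>, so that one of the bad branches still gains
  \<open>t\<^sup>1\<^sup>/\<^sup>2\<close> and leads to bounded badness: \<open>1 + 1/2 - 9/5 + 9/10 > 0\<close>.
\<close>
lemma drift_three: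
  fixes \<alpha> \<beta> \<gamma> \<delta> \<sigma> :: real and q D :: nat
  assumes \<beta>: "\<beta> \<noteq> 0" and det: "\<alpha>*\<delta> - \<beta>*\<gamma> \<noteq> 0" and D: "D * (\<alpha>/3 + \<beta>*\<sigma>) \<in> \<int>"
  obtains t\<^sub>0 \<eta> :: real where "t\<^sub>0 \<ge> 1"
    "\<And>t u s v w. \<lbrakk>t \<ge> t\<^sub>0; 6 * real D * t * \<beta> * sqrt 3 / (2*pi) - 1/2 \<in> \<int>; (v,w) \<noteq> (0,0)\<rbrakk> \<Longrightarrow>
       3 * real q * (fibre_potential t 0 (resonance_weight \<eta> t u) \<alpha> \<beta> v w + 1) \<le>
       (\<Sum>i<3. \<Sum>l<q. fibre_potential t 0
           (resonance_weight \<eta> t (\<alpha> * (u + real i/3) + \<beta> * (s + real i*\<sigma> + real l/q - t * (sin (2*pi*(u + real i/3)) / (2*pi))))) \<alpha> \<beta> (\<alpha>* v + \<beta>*w)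
          (\<gamma>* v + \<delta>*w - t * profile 0 (u + real i/3) * (\<alpha>* v + \<beta>*w)))"
proof -
  obtain C where C: "C \<ge> 1"
    "\<And>v w. \<bar>\<alpha>* v + \<beta>*w\<bar> \<le> C * vnorm v w" "\<And>v w. \<bar>\<gamma>* v + \<delta>*w\<bar> \<le> C * vnorm v w"
    "\<And>v w. vnorm v w \<le> C * max \<bar>\<alpha>* v + \<beta>*w\<bar> \<bar>\<gamma>* v + \<delta>*w\<bar>"
    using linear_bounds_untwisted[OF det] by blast
  have z: "profile 0 (1/4) = 0" by (simp add: profile_def)
  have nz: "of_int h / real 3 + 2 * (1/4) \<notin> \<int>" for h :: int
  proof
    assume "of_int h / real 3 + 2 * (1/4) \<in> \<int>"
    then obtain k :: int where "of_int h / real 3 + 2 * (1/4) = of_int k" by (auto elim: Ints_cases)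
    then have "real_of_int (2*h + 3) = real_of_int (6*k)" by simp
    then have "2*h + 3 = 6*k" by (simp only: of_int_eq_iff)
    then show False by presburger
  qed
  obtain \<epsilon> where \<epsilon>: "0 < \<epsilon>" "\<epsilon> \<le> 1/4" and
    three: "\<And>u i j k. \<lbrakk>i < (3::nat); j < 3; k < 3; i \<noteq> j; i \<noteq> k; j \<noteq> k;
        \<bar>profile 0 (u + real i/3) - profile 0 (u + real j/3)\<bar> < 6*\<epsilon>;
        \<bar>profile 0 (u + real i/3) - profile 0 (u + real k/3)\<bar> < 6*\<epsilon>\<rbrakk> \<Longrightarrow> False" and
    two: "\<And>u i j. \<lbrakk>i < (3::nat); j < 3; i \<noteq> j; \<bar>profile 0 (u + real i/3)\<bar> < 4*\<epsilon>; \<bar>profile 0 (u + real j/3)\<bar> < 4*\<epsilon>\<rbrakk> \<Longrightarrow> False"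
    using profile_fibre_geometry[of 0 "1/4" 3, OF _ _ z _ nz] by auto
  define \<eta> where "\<eta> = 1 / (2 + 12 * D + 12 * D * \<bar>\<beta>\<bar>)"
  have \<eta>: "0 < \<eta>" "\<eta> \<le> 1" "(12 * D + 12 * D * \<bar>\<beta>\<bar>) * \<eta> < 1"
  proof -
    define P where "P = 2 + 12 * D + 12 * D * \<bar>\<beta>\<bar>"
    have "0 \<le> 12 * D * \<bar>\<beta>\<bar>" by simp
    then have P: "P \<ge> 1" unfolding P_def by linarith
    have \<eta>P: "\<eta> = 1 / P" by (simp add: \<eta>_def P_def)
    show "0 < \<eta>" "\<eta> \<le> 1" unfolding \<eta>P using P by simp_all
    have "(P - 2) * \<eta> < 1" unfolding \<eta>P using P by (simp add: divide_simps)
    then show "(12 * D + 12 * D * \<bar>\<beta>\<bar>) * \<eta> < 1" unfolding P_def by (simp add: algebra_simps)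
  qed
  (* The threshold \<open>\<kappa>0 / sqrt t\<close> of the second alternative; slopes that are both this bad differ by less than \<open>6 \<kappa>0 / sqrt t\<close>. *)
  define \<kappa>0 where "\<kappa>0 = \<eta> / 6"
  have \<kappa>0: "0 < \<kappa>0" "\<kappa>0 \<le> 1/4" using \<eta> by (simp_all add: \<kappa>0_def)
  define b0 where "b0 = min 1 \<bar>\<beta>\<bar>"
  have b0: "0 < b0" "b0 \<le> 1" "b0 \<le> \<bar>\<beta>\<bar>" using \<beta> by (auto simp: b0_def)
  define K where "K = ln (4*C) + ln C - ln \<epsilon> - ln \<kappa>0 - 4 * ln (b0/2)"
  have K1: "ln (4*C) \<le> K" "ln C - ln \<epsilon> - 4 * ln (b0/2) \<le> K" "ln C - ln \<kappa>0 - 4 * ln (b0/2) \<le> K" "0 \<le> ln C" "0 \<le> K"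
  proof -
    have "0 \<le> ln C" "0 \<le> ln (4*C)" using C(1) by simp_all
    moreover have "ln \<epsilon> \<le> 0" using \<epsilon> by simp
    moreover have "ln \<kappa>0 \<le> 0" using \<kappa>0 by simp
    moreover have "ln (b0/2) \<le> 0" using b0 by simp
    ultimately show "ln (4*C) \<le> K" "ln C - ln \<epsilon> - 4 * ln (b0/2) \<le> K" "ln C - ln \<kappa>0 - 4 * ln (b0/2) \<le> K" "0 \<le> ln C" "0 \<le> K" by (simp_all add: K_def)
  qed
  (* The smallest margin in the three balances is \<open>ln t / 5\<close>. *)
  define Q where "Q = 20 * (K + ln C + ln (C/\<epsilon>) + 1)"
  (* The same requirement as for \<open>\<epsilon> t\<close>, for the product of the threshold and t, which is \<open>\<kappa>0 sqrt t\<close>. *)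
  define R where "R = max (1/\<kappa>0) (2*\<bar>\<alpha>\<bar> / (\<kappa>0 * b0))"
  define t0 where "t0 = Max {1, exp Q, 1/\<epsilon>, 2*\<bar>\<alpha>\<bar> / (\<epsilon> * b0), R^2}"
  show ?thesis
  proof (rule that[of t0 \<eta>])
    show "t0 \<ge> 1" by (simp add: t0_def)
    fix t u s v w :: real
    assume t: "t \<ge> t0" and tuned: "6 * real D * t * \<beta> * sqrt 3 / (2*pi) - 1/2 \<in> \<int>" and vw: "(v,w) \<noteq> (0,0)"
    have t1: "t \<ge> 1" and tQ: "exp Q \<le> t" and te: "1/\<epsilon> \<le> t" "2*\<bar>\<alpha>\<bar> / (\<epsilon> * b0) \<le> t"
      and tk: "R^2 \<le> t" using t by (simp_all add: t0_def)
    have tp: "t > 0" using t1 by simp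
    have "ln (exp Q) \<le> ln t" using tQ by (intro ln_mono) simp_all
    then have LQ: "Q \<le> ln t" by simp
    have large: "\<epsilon> * t \<ge> 1" "\<epsilon> * t * b0 \<ge> 2 * \<bar>\<alpha>\<bar>"
      using te \<epsilon> b0 by (simp_all add: pos_divide_le_eq mult_ac)
    define \<kappa> where "\<kappa> = \<kappa>0 / sqrt t"
    have \<kappa>: "\<kappa> > 0" using \<kappa>0 t1 by (simp add: \<kappa>_def)
    have "R \<le> sqrt t" using tk by (rule real_le_rsqrt)
    then have "1/\<kappa>0 \<le> sqrt t" "2*\<bar>\<alpha>\<bar> / (\<kappa>0 * b0) \<le> sqrt t" by (simp_all add: R_def)
    moreover have kt: "\<kappa> * t = \<kappa>0 * sqrt t" using t1 by (simp add: \<kappa>_def field_simps)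
    ultimately have large2: "\<kappa> * t \<ge> 1" "\<kappa> * t * b0 \<ge> 2 * \<bar>\<alpha>\<bar>"
      unfolding kt using \<kappa>0 b0 by (simp_all add: pos_divide_le_eq mult_ac)
    have ln\<kappa>: "ln \<kappa> = ln \<kappa>0 - ln t / 2" unfolding \<kappa>_def using \<kappa>0 tp by (simp add: ln_div ln_sqrt)
    define N where "N = vnorm v w"
    have N: "N > 0" unfolding N_def by (rule vnorm_pos[OF vw])
    define X where "X = \<alpha>* v + \<beta>*w"
    define Y where "Y = \<gamma>* v + \<delta>*w"
    have XY: "\<bar>X\<bar> \<le> C * N" "\<bar>Y\<bar> \<le> C * N" "N \<le> C * max \<bar>X\<bar> \<bar>Y\<bar>"
      using C(2-4)[of v w] unfolding X_def Y_def N_def by blast+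
    define c where "c i = profile 0 (u + real i/3)" for i :: nat
    have c: "\<bar>c i\<bar> \<le> 2" for i unfolding c_def by (intro profile_bound) simp
    define om where "om = badness t X N"
    have om: "- ln C \<le> om" unfolding om_def by (rule badness_ge[OF t1 N C(1) XY(1)])
    define \<theta> where "\<theta> i l = \<alpha> * (u + real i/3) + \<beta> * (s + real i*\<sigma> + real l/q - t * (sin (2*pi*(u + real i/3)) / (2*pi)))" for i l :: nat
    define wt where "wt i l = resonance_weight \<eta> t (\<theta> i l)" for i l
    have wt: "- 9/5 \<le> wt i l" "wt i l \<le> - 13/10" "wt i l \<le> 0" "0 - wt i l \<le> 4" for i l
      using resonance_weight_bounds[of \<eta> t "\<theta> i l"] by (simp_all add: wt_def)
    define f where "f i l = fibre_potential t 0 (wt i l) \<alpha> \<beta> X (Y - t * c i * X)" for i l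
    define g where "g = ln N - om - K"
    define M where "M = max \<bar>Y\<bar> (t * \<bar>X\<bar>)"
    define bad where "bad i \<longleftrightarrow> \<bar>Y - t * c i * X\<bar> < \<epsilon> * M" for i
    have L0: "ln t \<ge> 0" using t1 by simp
    have fbad': "g + wt i l * ln t \<le> f i l" for i l
      using branch_bad[OF t1 N C(1) XY(3) c[of i] wt(3)[of i l], of "\<alpha>*X + \<beta>*(Y - t * c i * X)" "vnorm X (Y - t * c i * X)"] K1(1)
      unfolding f_def fibre_potential_def om_def g_def by simp
    have fbad: "g - 9/5 * ln t \<le> f i l" for i l
      using fbad'[of i l] mult_right_mono[OF wt(1)[of i l] L0] by simp
    have fgood: "g + ln t \<le> f i l" if "\<not> bad i" for i l
    proof -
      have "\<epsilon> * max \<bar>Y\<bar> (t * \<bar>X\<bar>) \<le> \<bar>Y - t * c i * X\<bar>" using that unfolding bad_def M_def by linarith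
      from branch_good(1)[OF t1 N C(1) XY(3) \<epsilon>(1) this, where \<phi>\<^sub>S = 0 and \<phi>\<^sub>W = "wt i l" and ?b0.0 = b0 and b = \<beta> and \<alpha> = \<alpha>, OF wt(3,4) b0 large] K1(2)
      show ?thesis unfolding f_def fibre_potential_def om_def g_def by simp
    qed
    have fhalf: "g + ln t / 2 \<le> f i l" if "\<kappa> * M \<le> \<bar>Y - t * c i * X\<bar>" for i l
      using branch_good(1)[OF t1 N C(1) XY(3) \<kappa> that[unfolded M_def], where \<phi>\<^sub>S = 0 and \<phi>\<^sub>W = "wt i l" and ?b0.0 = b0 and b = \<beta> and \<alpha> = \<alpha>, OF wt(3,4) b0 large2] K1(3)
      unfolding f_def fibre_potential_def om_def g_def ln\<kappa> by simp
    have Fbad: "real q * (g - 9/5 * ln t) \<le> (\<Sum>l<q. f i l)" for i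
      using sum_bounded_below[of "{..<q}" _ "f i", OF fbad] by simp
    have Fgood: "real q * (g + ln t) \<le> (\<Sum>l<q. f i l)" if "\<not> bad i" for i
      using sum_bounded_below[of "{..<q}" _ "f i", OF fgood[OF that]] by simp
    have dist: "\<bar>c i - c j\<bar> < 6 * \<epsilon>" if "bad i" "bad j" for i j
      using two_bad_branches[OF \<epsilon>(2,1) c[of i] \<epsilon>(1) _ that[unfolded bad_def M_def]] t1 by simp
    define \<kappa>x where "\<kappa>x = - resonance_weight \<eta> t u"
    have \<kappa>x: "13/10 \<le> \<kappa>x" "\<kappa>x \<le> 9/5" using resonance_weight_bounds[of \<eta> t u] by (simp_all add: \<kappa>x_def)
    have lCe: "0 \<le> ln (C/\<epsilon>)" using C(1) \<epsilon> by simp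
    have QL: "20 * K + 20 * ln C + 20 * ln (C/\<epsilon>) + 20 \<le> ln t" using LQ by (simp add: Q_def)
    have \<kappa>om: "(\<kappa>x - 1) * om \<ge> - ln C"
    proof -
      have "(\<kappa>x - 1) * (- ln C) \<le> (\<kappa>x - 1) * om" using om \<kappa>x by (intro mult_left_mono) auto
      moreover have "(\<kappa>x - 1) * ln C \<le> 1 * ln C" using \<kappa>x K1(4) by (intro mult_right_mono) auto
      ultimately show ?thesis by simp
    qed
    define Z where "Z = ln N - \<kappa>x * om + 1"
    have total: "3 * real q * (ln N - \<kappa>x * om + 1) \<le> (\<Sum>i<3. \<Sum>l<q. f i l)"
      if "3 * (ln N - \<kappa>x * om + 1) \<le> A" "real q * A \<le> (\<Sum>i<3. \<Sum>l<q. f i l)" for A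
    proof -
      have "real q * (3 * Z) \<le> real q * A" using that(1) unfolding Z_def by (intro mult_left_mono) simp_all
      moreover have "3 * real q * Z = real q * (3 * Z)" by simp
      ultimately show ?thesis using that(2) unfolding Z_def by linarith
    qed
    have perm: "(\<Sum>i<3. \<Sum>l<q. f i l) = (\<Sum>l<q. f i l) + (\<Sum>l<q. f j l) + (\<Sum>l<q. f k l)"
      if "i < 3" "j < 3" "k < 3" "i \<noteq> j" "i \<noteq> k" "j \<noteq> k" for i j k
    proof -
      have "{..<3} = {i,j,k}" using that by auto
      then show ?thesis using that by simp
    qed
    have "3 * real q * (ln N - \<kappa>x * om + 1) \<le> (\<Sum>i<3. \<Sum>l<q. f i l)"
    proof (cases "\<exists>i j. i < 3 \<and> j < 3 \<and> i \<noteq> j \<and> bad i \<and> bad j")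
      case False
      then obtain i where i: "i < 3" "\<And>j. j < 3 \<Longrightarrow> j \<noteq> i \<Longrightarrow> \<not> bad j"
      proof -
        show ?thesis
        proof (cases "\<exists>i<3. bad i")
          case True then show ?thesis using that False by blast
        next
          case no: False then show ?thesis using that[of 0] by auto
        qed
      qed
      obtain j k where jk: "j < 3" "k < 3" "i \<noteq> j" "i \<noteq> k" "j \<noteq> k"
      proof -
        have "\<exists>j k. j < 3 \<and> k < 3 \<and> i \<noteq> j \<and> i \<noteq> k \<and> j \<noteq> k" using i(1) by presburger
        then show ?thesis using that by blast
      qed
      show ?thesis
      proof (rule total)
        have "real q * (g - 9/5 * ln t) + real q * (g + ln t) + real q * (g + ln t) \<le> (\<Sum>i<3. \<Sum>l<q. f i l)"
          unfolding perm[OF i(1) jk] using Fbad[of i] Fgood[OF i(2)[OF jk(1) jk(3)[symmetric]]] Fgood[OF i(2)[OF jk(2) jk(4)[symmetric]]] by linarith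
        then show "real q * (3 * g + 1/5 * ln t) \<le> (\<Sum>i<3. \<Sum>l<q. f i l)" by (simp add: algebra_simps)
        have "3 * g + 1/5 * ln t - 3 * (ln N - \<kappa>x * om + 1) = 1/5 * ln t - 3 * K + 3 * ((\<kappa>x - 1) * om) - 3" by (simp add: g_def algebra_simps)
        then show "3 * (ln N - \<kappa>x * om + 1) \<le> 3 * g + 1/5 * ln t" using \<kappa>om QL K1(4,5) lCe by linarith
      qed
    next
      case True
      then obtain i j where ij: "i < 3" "j < 3" "i \<noteq> j" "bad i" "bad j" by blast
      obtain k where k: "k < 3" "i \<noteq> k" "j \<noteq> k"
      proof -
        have "\<exists>k. k < 3 \<and> i \<noteq> k \<and> j \<noteq> k" using ij(1-3) by presburger
        then show ?thesis using that by blast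
      qed
      have "\<not> bad k" using three[of i j k u] dist[of i j] dist[of i k] ij k unfolding c_def by blast
      note Fk = Fgood[OF this]
      have omL: "ln t - ln (C/\<epsilon>) \<le> om"
      proof (rule flat_or_vertical[OF tp N C(1) \<epsilon>(1) _ XY(2), of X])
        show "\<epsilon> \<le> 1" using \<epsilon> by simp
        assume flat: "\<bar>Y\<bar> \<le> \<epsilon> * (t * \<bar>X\<bar>)"
        have "\<bar>c l\<bar> < 4 * \<epsilon>" if "bad l" for l
          using bad_branch_flat[OF \<epsilon>(2,1) c[of l] _ _ flat] that t1 by (simp add: bad_def M_def)
        with ij two[of i j u] show ?thesis unfolding c_def by blast
      qed (simp add: om_def)
      show ?thesis
      proof (cases "circ ((u + i/3) + (u + j/3)) \<le> \<eta> / sqrt t")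
        case True
        have "circ (2 * u + of_int (int i + int j)/3) \<le> \<eta> / sqrt t"
          using True by (simp add: algebra_simps add_divide_distrib)
        then have ex: "\<exists>h::int. circ (2 * u + of_int h/3) \<le> \<eta> / sqrt t" by blast
        have \<kappa>x2: "\<kappa>x = 9/5" unfolding \<kappa>x_def resonance_weight_def if_P[OF ex] by simp
        have pair: "2 * g - 31/10 * ln t \<le> f i l + f j l" for l
        proof -
          have "\<not> (\<exists>h h'. circ (2 * \<theta> i l + of_int h/3) \<le> \<eta> / sqrt t \<and> circ (2 * \<theta> j l + of_int h'/3) \<le> \<eta> / sqrt t)"
          proof (intro notI, elim exE conjE)
            fix h h' :: int
            assume near: "circ (2 * \<theta> i l + of_int h/3) \<le> \<eta> / sqrt t" "circ (2 * \<theta> j l + of_int h'/3) \<le> \<eta> / sqrt t"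
            define \<Delta> where "\<Delta> = (real i - real j) * (\<alpha>/3 + \<beta> * \<sigma>)"
            have "D * \<Delta> = of_int (int i - int j) * (D * (\<alpha>/3 + \<beta>*\<sigma>))" by (simp add: \<Delta>_def mult_ac)
            then have \<Delta>: "D * \<Delta> \<in> \<int>" using D by (metis Ints_mult Ints_of_int)
            show False
              by (rule tuned_shear_separates[OF t1 tuned \<eta> circ_thirds[OF ij(1-3)] True \<Delta> _ near])
                 (simp add: \<theta>_def \<Delta>_def field_simps)
          qed
          then have "- 31/10 \<le> wt i l + wt j l"
            unfolding wt_def resonance_weight_def by auto
          from mult_right_mono[OF this L0] fbad'[of i l] fbad'[of j l] show ?thesis by (simp add: algebra_simps)
        qed
        have "real q * (2 * g - 31/10 * ln t) \<le> (\<Sum>l<q. f i l + f j l)"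
          using sum_bounded_below[of "{..<q}" _ "\<lambda>l. f i l + f j l", OF pair] by simp
        then have P: "real q * (2 * g - 31/10 * ln t) \<le> (\<Sum>l<q. f i l) + (\<Sum>l<q. f j l)" by (simp add: sum.distrib)
        show ?thesis
        proof (rule total)
          have "real q * (2 * g - 31/10 * ln t) + real q * (g + ln t) \<le> (\<Sum>i<3. \<Sum>l<q. f i l)"
            unfolding perm[OF ij(1,2) k(1) ij(3) k(2,3)] using P Fk by linarith
          then show "real q * (3 * g - 21/10 * ln t) \<le> (\<Sum>i<3. \<Sum>l<q. f i l)" by (simp add: algebra_simps)
          show "3 * (ln N - \<kappa>x * om + 1) \<le> 3 * g - 21/10 * ln t"
            unfolding \<kappa>x2 g_def using omL QL K1(4,5) lCe by (simp add: algebra_simps)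
        qed
      next
        case far: False
        have "sqrt 3 * (\<eta> / sqrt t) \<le> \<bar>c i - c j\<bar>"
        proof -
          have "2 * (1 - 4*0) * circ ((u + i/3) + (u + j/3)) * circ ((u + i/3) - (u + j/3)) \<le> \<bar>c i - c j\<bar>"
            unfolding c_def by (rule profile_separation) simp
          then have "sqrt 3 * circ ((u + i/3) + (u + j/3)) \<le> \<bar>c i - c j\<bar>" unfolding circ_thirds[OF ij(1-3)] by (simp add: mult_ac)
          moreover have "sqrt 3 * (\<eta> / sqrt t) \<le> sqrt 3 * circ ((u + i/3) + (u + j/3))" using far by (intro mult_left_mono) auto
          ultimately show ?thesis by linarith
        qed
        moreover have "1 * (\<eta> / sqrt t) \<le> sqrt 3 * (\<eta> / sqrt t)" using \<eta> t1 by (intro mult_right_mono) auto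
        ultimately have far': "6 * \<kappa> \<le> \<bar>c i - c j\<bar>" by (simp add: \<kappa>_def \<kappa>0_def)
        have "\<kappa>0 / sqrt t \<le> \<kappa>0 / 1" using \<kappa>0 t1 by (intro divide_left_mono) auto
        then have \<kappa>4: "\<kappa> \<le> 1/4" using \<kappa>0(2) unfolding \<kappa>_def by linarith
        have "\<not> (\<bar>Y - t * c i * X\<bar> < \<kappa> * M \<and> \<bar>Y - t * c j * X\<bar> < \<kappa> * M)"
          using two_bad_branches[OF \<kappa>4 \<kappa> c[of i] \<kappa>, of t Y X "c j"] far' t1 unfolding M_def by auto
        then consider "\<kappa> * M \<le> \<bar>Y - t * c i * X\<bar>" | "\<kappa> * M \<le> \<bar>Y - t * c j * X\<bar>" by linarith
        then have "real q * (g + ln t / 2) + real q * (g - 9/5 * ln t) \<le> (\<Sum>l<q. f i l) + (\<Sum>l<q. f j l)"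
        proof cases
          case 1
          have "real q * (g + ln t / 2) \<le> (\<Sum>l<q. f i l)"
            using sum_bounded_below[of "{..<q}" _ "f i", OF fhalf[OF 1]] by simp
          then show ?thesis using Fbad[of j] by linarith
        next
          case 2
          have "real q * (g + ln t / 2) \<le> (\<Sum>l<q. f j l)"
            using sum_bounded_below[of "{..<q}" _ "f j", OF fhalf[OF 2]] by simp
          then show ?thesis using Fbad[of i] by linarith
        qed
        then have P: "real q * (2 * g - 13/10 * ln t) \<le> (\<Sum>l<q. f i l) + (\<Sum>l<q. f j l)" by (simp add: algebra_simps)
        show ?thesis
        proof (rule total)
          have "real q * (2 * g - 13/10 * ln t) + real q * (g + ln t) \<le> (\<Sum>i<3. \<Sum>l<q. f i l)"
            unfolding perm[OF ij(1,2) k(1) ij(3) k(2,3)] using P Fk by linarith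
          then show "real q * (3 * g - 3/10 * ln t) \<le> (\<Sum>i<3. \<Sum>l<q. f i l)" by (simp add: algebra_simps)
          have om0: "0 \<le> om" using omL QL K1(4,5) lCe by linarith
          have "3/10 * om \<le> (\<kappa>x - 1) * om" using \<kappa>x om0 by (intro mult_right_mono) auto
          moreover have "3 * g - 3/10 * ln t - 3 * (ln N - \<kappa>x * om + 1) = - 3/10 * ln t - 3 * K + 3 * ((\<kappa>x - 1) * om) - 3" by (simp add: g_def algebra_simps)
          ultimately show "3 * (ln N - \<kappa>x * om + 1) \<le> 3 * g - 3/10 * ln t" using omL QL K1(4,5) lCe by linarith
        qed
      qed
    qed
    then show "3 * real q * (fibre_potential t 0 (resonance_weight \<eta> t u) \<alpha> \<beta> v w + 1) \<le>
       (\<Sum>i<3. \<Sum>l<q. fibre_potential t 0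
           (resonance_weight \<eta> t (\<alpha> * (u + real i/3) + \<beta> * (s + real i*\<sigma> + real l/q - t * (sin (2*pi*(u + real i/3)) / (2*pi))))) \<alpha> \<beta> (\<alpha>* v + \<beta>*w)
          (\<gamma>* v + \<delta>*w - t * profile 0 (u + real i/3) * (\<alpha>* v + \<beta>*w)))"
      unfolding f_def c_def X_def Y_def N_def om_def fibre_potential_def \<kappa>x_def wt_def \<theta>_def by simp
  qed
qed

section \<open>Fibres with two slopes\<close>

lemma circ_ge: assumes "\<bar>x\<bar> \<le> 1/3" shows "3/2 * \<bar>x\<bar> \<le> circ x"
proof -
  have *: "y / 2 \<le> sin y" if "0 \<le> y" "y \<le> pi/3" for y :: real
  proof -
    have "sin 0 - 0/2 \<le> sin y - y/2"
    proof (rule DERIV_nonneg_imp_nondecreasing[OF that(1), of "\<lambda>y. sin y - y/2"])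
      fix x assume x: "0 \<le> x" "x \<le> y"
      have "cos (pi/3) \<le> cos x" by (rule cos_monotone_0_pi_le) (use x that pi_gt_zero in linarith)+
      then show "\<exists>d. ((\<lambda>y. sin y - y/2) has_real_derivative d) (at x) \<and> 0 \<le> d"
        by (intro exI[of _ "cos x - 1/2"]) (auto intro!: derivative_eq_intros simp: cos_60)
    qed
    then show ?thesis by simp
  qed
  have "3/2 * \<bar>x\<bar> \<le> (pi * \<bar>x\<bar>) / 2" using pi_gt3 mult_right_mono[of 3 pi "\<bar>x\<bar>"] by simp
  also have "\<dots> \<le> sin (pi * \<bar>x\<bar>)"
    using mult_left_mono[OF assms, of pi] by (intro *) simp_all
  also have "\<dots> \<le> circ \<bar>x\<bar>" unfolding circ_def by simp
  finally show ?thesis by simp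
qed

lemma circ_le4: "circ x \<le> 4 * \<bar>x\<bar>"
  using circ_le[of x] mult_right_mono[of pi 4 "\<bar>x\<bar>"] pi_less_4 by simp

lemma circ_half [simp]: "circ (1/2) = 1" by (simp add: circ_def)

lemma circ_quarter_shift: "circ (2*y - 1/2) = \<bar>cos (2*pi*y)\<bar>"
  by (simp add: circ_def right_diff_distrib sin_diff mult_ac)

lemma circ_three: "x = p - q + r \<or> x = p - q - r \<or> x = p + q + r \<Longrightarrow> circ x \<le> circ p + circ q + circ r"
  using circ_add[of "p - q" r] circ_diff[of "p - q" r] circ_add[of "p + q" r] circ_diff[of p q] circ_add[of p q]
  by auto

text \<open>
  The coordinates of \<open>E\<^sup>-\<^sup>1 e'\<close> and \<open>E\<^sup>-\<^sup>1 e\<close> transversal to \<open>e\<close> are \<open>A/2\<close> and \<open>B/2\<close>; the preimages of a point with coordinates \<open>(u, y)\<close>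
  lie on the lines \<open>phase u y / 2\<close> and \<open>phase u y / 2 + 1/2\<close>, two on each of them at distance \<open>1/2\<close>.

  The profile has its zeros at \<open>\<plusminus>(1/4 - s)\<close> modulo \<open>1\<close>. A point is called flat if one of the slopes over it nearly vanishes, and resonant
  if the two slopes nearly coincide; both happen only for phases near \<open>1/2\<close>. The parameters satisfy
  \<open>\<tau> \<ll> \<bar>A\<bar> r \<ll> s \<ll> 1/\<bar>A\<bar>\<close>: the tolerance \<open>\<tau>\<close> is smaller than the effect \<open>2 A r cos (2\<pi>y)\<close> of the transversal shear on the phase, except
  where the cosine is of size \<open>\<nu>\<close>, and that effect is smaller than the separation \<open>2 s\<close> of flat and resonant phases.
\<close>
locale half_twist =
  fixes A B :: int
  assumes odd_A: "odd A" and B_nonzero: "B \<noteq> 0"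
begin

definition s :: real where "s = 1 / (128 * \<bar>real_of_int A\<bar>)"
definition r :: real where "r = s / (16 * \<bar>real_of_int A\<bar>)"
definition \<nu> :: real where "\<nu> = 1 / (8 * (\<bar>real_of_int B\<bar> + 1))"
definition \<tau> :: real where "\<tau> = \<bar>real_of_int A\<bar> * r * \<nu>"
definition phase :: "real \<Rightarrow> real \<Rightarrow> real" where "phase u y = real_of_int A * (u + r * cos (2*pi*y)) + real_of_int B * y"
definition flat :: "real \<Rightarrow> real \<Rightarrow> bool" where "flat u y \<longleftrightarrow> circ (phase u y - 1/2 - 2* s) \<le> \<tau> \<or> circ (phase u y - 1/2 + 2* s) \<le> \<tau>"
definition resonant :: "real \<Rightarrow> real \<Rightarrow> bool" where "resonant u y \<longleftrightarrow> circ (phase u y - 1/2) \<le> \<tau>"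

lemma abs_A: "\<bar>real_of_int A\<bar> \<ge> 1"
proof -
  have "A \<noteq> 0" using odd_A by auto
  then have "\<bar>A\<bar> \<ge> 1" by linarith
  then show ?thesis by linarith
qed

lemma params:
  "s > 0" "s \<le> 1/128" "\<bar>real_of_int A\<bar> * s = 1/128" "r > 0" "\<bar>real_of_int A\<bar> * r = s/16" "r \<le> s/16"
  "\<nu> > 0" "\<nu> \<le> 1/8" "\<bar>real_of_int B\<bar> * \<nu> \<le> 1/8" "\<tau> > 0" "\<tau> \<le> s/128" "\<bar>real_of_int A\<bar> * \<tau> \<le> 1/128"
proof -
  define a where "a = \<bar>real_of_int A\<bar>"
  define b where "b = \<bar>real_of_int B\<bar>"
  have a: "a \<ge> 1" and b: "b \<ge> 0" using abs_A by (simp_all add: a_def b_def)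
  have s: "s = 1/(128*a)" and rr: "r = s/(16*a)" and n: "\<nu> = 1/(8*(b+1))" and t: "\<tau> = a * r * \<nu>"
    by (simp_all add: s_def r_def \<nu>_def \<tau>_def a_def b_def)
  show 1: "s > 0" and 2: "s \<le> 1/128" and 3: "\<bar>real_of_int A\<bar> * s = 1/128" unfolding a_def[symmetric] s using a by (simp_all add: divide_simps)
  show 4: "r > 0" and 5: "\<bar>real_of_int A\<bar> * r = s/16" and 6: "r \<le> s/16"
    unfolding a_def[symmetric] rr using a 1 by (simp_all add: divide_simps)
  show 7: "\<nu> > 0" and 8: "\<nu> \<le> 1/8" and 9: "\<bar>real_of_int B\<bar> * \<nu> \<le> 1/8" unfolding b_def[symmetric] n using b by (simp_all add: divide_simps)
  have t2: "\<tau> = s/16 * \<nu>" using 5 unfolding t a_def by simp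
  show 10: "\<tau> > 0" unfolding t2 using 1 7 by simp
  have "s/16 * \<nu> \<le> s/16 * (1/8)" using 8 1 by (intro mult_left_mono) auto
  then show 11: "\<tau> \<le> s/128" unfolding t2 by simp
  have "a * \<tau> \<le> a * (s/128)" using 11 a by (intro mult_left_mono) auto
  also have "\<dots> = (a * s)/128" by simp
  also have "\<dots> \<le> 1/128" using 3 by (simp add: a_def)
  finally show "\<bar>real_of_int A\<bar> * \<tau> \<le> 1/128" by (simp add: a_def)
qed

lemma circ_2s: "circ (2* s) \<le> 8 * s" "3 * s \<le> circ (2* s)" "circ (4* s) \<le> 16 * s" "6 * s \<le> circ (4* s)"
  using circ_le4[of "2* s"] circ_ge[of "2* s"] circ_le4[of "4* s"] circ_ge[of "4* s"] params(1,2) by simp_all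

lemma circ_2r: "circ (2 * real_of_int A * (r * cos (2*pi*y))) \<le> s/2"
proof -
  have "\<bar>2 * real_of_int A * (r * cos (2*pi*y))\<bar> = 2 * (\<bar>real_of_int A\<bar> * r) * \<bar>cos (2*pi*y)\<bar>"
    using params(4) by (simp add: abs_mult)
  also have "\<dots> \<le> 2 * (\<bar>real_of_int A\<bar> * r) * 1" using params(4) by (intro mult_left_mono) auto
  finally have "\<bar>2 * real_of_int A * (r * cos (2*pi*y))\<bar> \<le> s/8" using params(5) by simp
  then show ?thesis using circ_le4[of "2 * real_of_int A * (r * cos (2*pi*y))"] by linarith
qed

lemma circ_2r_ge: "3 * (\<bar>real_of_int A\<bar> * r) * \<bar>cos (2*pi*y)\<bar> \<le> circ (2 * real_of_int A * (r * cos (2*pi*y)))"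
proof -
  have eq: "\<bar>2 * real_of_int A * (r * cos (2*pi*y))\<bar> = 2 * (\<bar>real_of_int A\<bar> * r) * \<bar>cos (2*pi*y)\<bar>"
    using params(4) by (simp add: abs_mult)
  also have "\<dots> \<le> 2 * (\<bar>real_of_int A\<bar> * r) * 1" using params(4) by (intro mult_left_mono) auto
  finally have "\<bar>2 * real_of_int A * (r * cos (2*pi*y))\<bar> \<le> 1/3" using params(5,2) by simp
  from circ_ge[OF this] show ?thesis unfolding eq by (simp add: mult_ac)
qed

lemma near_half: assumes "flat u y \<or> resonant u y" shows "circ (phase u y - 1/2) \<le> \<tau> + circ (2* s)"
proof -
  have "circ (phase u y - 1/2) \<le> circ (phase u y - 1/2 - 2* s) + circ (2* s)"
    using circ_add[of "phase u y - 1/2 - 2* s" "2* s"] by simp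
  moreover have "circ (phase u y - 1/2) \<le> circ (phase u y - 1/2 + 2* s) + circ (2* s)"
    using circ_diff[of "phase u y - 1/2 + 2* s" "2* s"] by simp
  ultimately show ?thesis using assms circ_nonneg[of "2* s"] unfolding flat_def resonant_def by argo
qed

lemma near_half': "flat u y \<or> resonant u y \<Longrightarrow> circ (phase u y - 1/2) \<le> 9 * s"
  using near_half[of u y] circ_2s(1) params(11) params(1) by linarith

text \<open>
  The two preimages on one line have phases that differ by this amount. The next lemmas draw the consequences: for odd \<open>B\<close>
  the term \<open>B/2\<close> keeps the two phases apart, for even \<open>B\<close> the transversal shear does, unless the cosine is small.
\<close>
lemma sibling: "phase u (y + 1/2) = phase u y - 2 * real_of_int A * (r * cos (2*pi*y)) + real_of_int B/2"
proof -
  have "cos (2*pi*(y + 1/2)) = - cos (2*pi*y)" by (simp add: distrib_left)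
  then show ?thesis by (simp add: phase_def algebra_simps)
qed

lemma circ_B: assumes "even B" "circ (2*x) \<le> c" shows "circ (real_of_int B * x) \<le> \<bar>real_of_int B\<bar> * c"
proof -
  obtain m where m: "B = 2 * m" using assms(1) by blast
  have c: "0 \<le> c" using assms(2) circ_nonneg[of "2*x"] by linarith
  have "circ (real_of_int B * x) = circ (of_int m * (2 * x))" unfolding m by (simp add: mult_ac)
  also have "\<dots> \<le> of_int \<bar>m\<bar> * circ (2*x)" by (rule circ_mult_int)
  also have "\<dots> \<le> \<bar>real_of_int B\<bar> * c" unfolding m using assms(2) c by (intro mult_mono) auto
  finally show ?thesis .
qed

lemma odd_half: "odd m \<Longrightarrow> of_int m / 2 - 1/2 \<in> (\<int> :: real set)"
proof -
  assume "odd m"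
  then obtain k where "m = 2*k + 1" by (rule oddE)
  then have "of_int m / 2 - 1/2 = (of_int k :: real)" by (simp add: field_simps)
  then show ?thesis by simp
qed

lemma even_half: "even m \<Longrightarrow> of_int m / 2 \<in> (\<int> :: real set)"
  by (auto elim!: evenE)

lemma odd_B_sibling:
  assumes "odd B" "flat u y \<or> resonant u y" "flat u (y+1/2) \<or> resonant u (y+1/2)"
  shows False
proof -
  let ?\<rho> = "2 * real_of_int A * (r * cos (2*pi*y))"
  have "circ (of_int B / 2) = 1" by (intro circ_half_odd odd_half assms)
  moreover have "real_of_int B / 2 = (phase u (y+1/2) - 1/2) - (phase u y - 1/2) + ?\<rho>" unfolding sibling by simp
  then have "circ (of_int B / 2) \<le> circ (phase u (y+1/2) - 1/2) + circ (phase u y - 1/2) + circ ?\<rho>"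
    by (intro circ_three disjI1)
  ultimately show False using near_half'[OF assms(2)] near_half'[OF assms(3)] circ_2r[of y] params(2) by linarith
qed

lemma even_B_sibling: assumes "even B" shows "circ (phase u (y+1/2) + c) = circ (phase u y + c - 2 * real_of_int A * (r * cos (2*pi*y)))"
proof (rule circ_cong_Ints)
  have "phase u (y+1/2) + c - (phase u y + c - 2 * real_of_int A * (r * cos (2*pi*y))) = of_int B / 2" unfolding sibling by simp
  then show "phase u (y+1/2) + c - (phase u y + c - 2 * real_of_int A * (r * cos (2*pi*y))) \<in> \<int>" using even_half[OF assms] by (simp only:)
qed

lemma both_flat: assumes "flat u y" "flat u (y+1/2)" shows "even B" "circ (2 * real_of_int A * (r * cos (2*pi*y))) \<le> 2*\<tau>" "circ (2*y - 1/2) \<le> \<nu>"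
proof -
  let ?\<rho> = "2 * real_of_int A * (r * cos (2*pi*y))"
  let ?p = "phase u y - 1/2"
  show e: "even B" using odd_B_sibling assms by blast
  have sib: "circ (?p - 2* s - ?\<rho>) \<le> \<tau> \<or> circ (?p + 2* s - ?\<rho>) \<le> \<tau>"
    using assms(2) even_B_sibling[OF e, of u y "-1/2 - 2* s"] even_B_sibling[OF e, of u y "-1/2 + 2* s"]
    unfolding flat_def by (simp add: algebra_simps)
  have own: "circ (?p - 2* s) \<le> \<tau> \<or> circ (?p + 2* s) \<le> \<tau>" using assms(1) unfolding flat_def .
  have small: "circ ?\<rho> \<le> s/2" by (rule circ_2r)
  have cross: False if "circ (4* s) \<le> \<tau> + \<tau> + circ ?\<rho>"
    using that small circ_2s(4) params(11) params(1) by linarith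
  from sib own show r: "circ ?\<rho> \<le> 2*\<tau>"
  proof (elim disjE)
    assume h: "circ (?p - 2* s - ?\<rho>) \<le> \<tau>" "circ (?p - 2* s) \<le> \<tau>"
    then show ?thesis using circ_diff[of "?p - 2* s" "?p - 2* s - ?\<rho>"] by simp
  next
    assume h: "circ (?p + 2* s - ?\<rho>) \<le> \<tau>" "circ (?p + 2* s) \<le> \<tau>"
    then show ?thesis using circ_diff[of "?p + 2* s" "?p + 2* s - ?\<rho>"] by simp
  next
    assume h: "circ (?p - 2* s - ?\<rho>) \<le> \<tau>" "circ (?p + 2* s) \<le> \<tau>"
    have "4* s = (?p + 2* s) - (?p - 2* s - ?\<rho>) - ?\<rho>" by simp
    then have "circ (4* s) \<le> circ (?p + 2* s) + circ (?p - 2* s - ?\<rho>) + circ ?\<rho>"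
      by (intro circ_three disjI2 disjI1)
    with h have "circ (4* s) \<le> \<tau> + \<tau> + circ ?\<rho>" by linarith
    then show ?thesis using cross by blast
  next
    assume h: "circ (?p + 2* s - ?\<rho>) \<le> \<tau>" "circ (?p - 2* s) \<le> \<tau>"
    have "4* s = (?p + 2* s - ?\<rho>) - (?p - 2* s) + ?\<rho>" by simp
    then have "circ (4* s) \<le> circ (?p + 2* s - ?\<rho>) + circ (?p - 2* s) + circ ?\<rho>"
      by (intro circ_three disjI1)
    with h have "circ (4* s) \<le> \<tau> + \<tau> + circ ?\<rho>" by linarith
    then show ?thesis using cross by blast
  qed
  have "(\<bar>real_of_int A\<bar> * r) * (3 * \<bar>cos (2*pi*y)\<bar>) \<le> (\<bar>real_of_int A\<bar> * r) * (2 * \<nu>)"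
    using circ_2r_ge[of y] r unfolding \<tau>_def by (simp add: mult_ac)
  then have "3 * \<bar>cos (2*pi*y)\<bar> \<le> 2 * \<nu>" using params(1,5) by (simp only: mult_le_cancel_left_pos)
  then show "circ (2*y - 1/2) \<le> \<nu>" unfolding circ_quarter_shift using params(7) by linarith
qed

lemma resonant_flat: assumes "resonant u y \<and> flat u (y+1/2) \<or> flat u y \<and> resonant u (y+1/2)" shows False
proof -
  let ?\<rho> = "2 * real_of_int A * (r * cos (2*pi*y))"
  let ?p = "phase u y - 1/2"
  have e: "even B" using odd_B_sibling assms by blast
  have small: "circ ?\<rho> \<le> s/2" by (rule circ_2r)
  have key: False if "circ (2* s) \<le> \<tau> + \<tau> + circ ?\<rho>"
    using that small circ_2s(2) params(11) params(1) by linarith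
  have sib: "circ (phase u (y+1/2) - 1/2 + c) = circ (?p + c - ?\<rho>)" for c
    using even_B_sibling[OF e, of u y "-1/2 + c"] by (simp add: algebra_simps)
  have 1: "circ (2* s) \<le> circ p1 + circ p2 + circ ?\<rho>" if "2* s = p1 - p2 + ?\<rho> \<or> 2* s = p1 - p2 - ?\<rho>" for p1 p2
    using that by (intro circ_three) blast
  from assms show False
  proof (elim disjE conjE)
    assume h: "resonant u y" "flat u (y+1/2)"
    then have "circ ?p \<le> \<tau>" "circ (?p - 2* s - ?\<rho>) \<le> \<tau> \<or> circ (?p + 2* s - ?\<rho>) \<le> \<tau>"
      using sib[of "-2* s"] sib[of "2* s"] unfolding resonant_def flat_def by simp_all
    then show False using 1[of ?p "?p - 2* s - ?\<rho>"] 1[of "?p + 2* s - ?\<rho>" ?p] key by fastforce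
  next
    assume h: "flat u y" "resonant u (y+1/2)"
    then have "circ (?p - ?\<rho>) \<le> \<tau>" "circ (?p - 2* s) \<le> \<tau> \<or> circ (?p + 2* s) \<le> \<tau>"
      using sib[of 0] unfolding resonant_def flat_def by simp_all
    then show False using 1[of "?p - ?\<rho>" "?p - 2* s"] 1[of "?p + 2* s" "?p - ?\<rho>"] key by fastforce
  qed
qed

lemma both_resonant: assumes "resonant u y" "resonant u (y+1/2)" "circ (2*y) \<le> \<nu>" shows False
proof -
  let ?\<rho> = "2 * real_of_int A * (r * cos (2*pi*y))"
  have e: "even B" using odd_B_sibling assms by blast
  have "circ (phase u y - 1/2 - ?\<rho>) \<le> \<tau>" using assms(2) even_B_sibling[OF e, of u y "-1/2"] unfolding resonant_def by simp
  then have "circ ?\<rho> \<le> 2*\<tau>" using assms(1) circ_diff[of "phase u y - 1/2" "phase u y - 1/2 - ?\<rho>"] unfolding resonant_def by simp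
  then have "3 * (\<bar>real_of_int A\<bar> * r) * \<bar>cos (2*pi*y)\<bar> \<le> 2*\<tau>" using circ_2r_ge[of y] by linarith
  then have "(\<bar>real_of_int A\<bar> * r) * (3 * \<bar>cos (2*pi*y)\<bar>) \<le> (\<bar>real_of_int A\<bar> * r) * (2 * \<nu>)" unfolding \<tau>_def by (simp add: mult_ac)
  then have c: "3 * \<bar>cos (2*pi*y)\<bar> \<le> 2 * \<nu>" using params(1,5) by (simp only: mult_le_cancel_left_pos)
  have s: "\<bar>sin (2*pi*y)\<bar> \<le> 1/8" using assms(3) params(8) by (simp add: circ_def mult_ac)
  have c': "\<bar>cos (2*pi*y)\<bar> \<le> 1/8" using c params(8) by linarith
  have "(sin (2*pi*y))^2 \<le> (1/8)^2" "(cos (2*pi*y))^2 \<le> (1/8)^2" using s c' by (simp_all add: abs_le_square_iff[symmetric])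
  then show False using sin_cos_squared_add[of "2*pi*y"] by (simp add: power2_eq_square)
qed

text \<open>
  Over a point of phase near \<open>1/2\<close> the preimages have a coordinate \<open>u\<close> near \<open>\<plusminus>1/4\<close>. As \<open>A\<close> is odd, this puts their
  phases near \<open>\<plusminus>1/4\<close> again, and only \<open>B y\<close> can move them to \<open>1/2\<close>.
\<close>
lemma double_phase:
  assumes u: "circ (2*u - 1/2) \<le> 9 * s"
  shows "circ (2 * phase u y - 1/2) \<le> 9/128 + circ (2 * real_of_int A * (r * cos (2*pi*y))) + circ (real_of_int B * (2*y))"
proof -
  let ?\<rho> = "2 * real_of_int A * (r * cos (2*pi*y))"
  have "circ (real_of_int A * (2*u) - 1/2) \<le> \<bar>real_of_int A\<bar> * (9 * s)"
  proof -
    have "circ (real_of_int A * (2*u) - 1/2) = circ (real_of_int A * (2*u - 1/2))"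
      using odd_half[OF odd_A] by (intro circ_cong_Ints) (simp add: algebra_simps)
    also have "\<dots> \<le> of_int \<bar>A\<bar> * circ (2*u - 1/2)" by (rule circ_mult_int)
    also have "\<dots> \<le> \<bar>real_of_int A\<bar> * (9* s)" using u by (simp add: mult_left_mono)
    finally show ?thesis .
  qed
  then have "circ (real_of_int A * (2*u) - 1/2) \<le> 9/128" using params(3) by simp
  moreover have "2 * phase u y - 1/2 = (real_of_int A * (2*u) - 1/2) + ?\<rho> + real_of_int B * (2*y)" by (simp add: phase_def algebra_simps)
  then have "circ (2 * phase u y - 1/2) \<le> circ (real_of_int A * (2*u) - 1/2) + circ ?\<rho> + circ (real_of_int B * (2*y))"
    by (intro circ_three disjI2)
  ultimately show ?thesis by linarith
qed

lemma double_near_half: "circ (2 * p) \<le> 2 * circ (p - 1/2)"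
proof -
  have "circ (2*p) = circ (of_nat 2 * (p - 1/2))" by (intro circ_cong_Ints) simp
  also have "\<dots> \<le> 2 * circ (p - 1/2)" using circ_mult_nat[of 2 "p - 1/2"] by simp
  finally show ?thesis .
qed

lemma no_resonance:
  assumes u: "circ (2*u - 1/2) \<le> 9 * s" and y: "circ (2*y) \<le> \<nu>" and res: "resonant u y"
  shows False
proof -
  have "circ (real_of_int B * (2*y)) \<le> \<bar>real_of_int B\<bar> * \<nu>" using circ_mult_int[of B "2*y"] y mult_left_mono[OF y, of "\<bar>real_of_int B\<bar>"] by simp
  then have "circ (2 * phase u y - 1/2) \<le> 1/2" using double_phase[OF u, of y] circ_2r[of y] params(2,9) by linarith
  moreover have "circ (2 * phase u y) \<le> 1/4" using double_near_half[of "phase u y"] near_half'[of u y] res params(2) by simp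
  ultimately show False using circ_diff[of "2 * phase u y" "2 * phase u y - 1/2"] by simp
qed

lemma no_double_flat:
  assumes u: "circ (2*u - 1/2) \<le> 9 * s" and f: "flat u y" "flat u (y+1/2)"
  shows False
proof -
  note b = both_flat[OF f]
  have "circ (2 * (2*y)) \<le> 2 * \<nu>"
  proof -
    have "circ (2 * (2*y)) = circ (of_nat 2 * (2*y - 1/2))" by (intro circ_cong_Ints) simp
    also have "\<dots> \<le> 2 * circ (2*y - 1/2)" using circ_mult_nat[of 2 "2*y - 1/2"] by simp
    finally show ?thesis using b(3) by simp
  qed
  from circ_B[OF b(1) this] have "circ (real_of_int B * (2*y)) \<le> 1/4" using params(9) by simp
  then have "circ (2 * phase u y - 1/2) \<le> 1/2" using double_phase[OF u, of y] circ_2r[of y] params(2,9) by linarith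
  moreover have "circ (2 * phase u y) \<le> 1/4" using double_near_half[of "phase u y"] near_half'[of u y] f params(2) by simp
  ultimately show False using circ_diff[of "2 * phase u y" "2 * phase u y - 1/2"] by simp
qed

text \<open>
  On the two lines the phases differ by about \<open>A/2\<close>, a half-integer, once \<open>B y\<close> is controlled through the position of the flat
  siblings.
\<close>
lemma not_all_flat:
  assumes f: "flat u y" "flat u (y+1/2)" and f': "flat (u+1/2) y'" "flat (u+1/2) (y'+1/2)"
  shows False
proof -
  note b = both_flat[OF f] and b' = both_flat[OF f']
  have half: "circ (real_of_int A * (r * cos (2*pi*x))) \<le> 1/8" for x
  proof -
    have "\<bar>real_of_int A * (r * cos (2*pi*x))\<bar> = (\<bar>real_of_int A\<bar> * r) * \<bar>cos (2*pi*x)\<bar>" using params(4) by (simp add: abs_mult)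
    also have "\<dots> \<le> (\<bar>real_of_int A\<bar> * r) * 1" using params(4) by (intro mult_left_mono) auto
    finally have "\<bar>real_of_int A * (r * cos (2*pi*x))\<bar> \<le> s/16" using params(5) by simp
    then show ?thesis using circ_le4[of "real_of_int A * (r * cos (2*pi*x))"] params(2) by linarith
  qed
  have "circ (2 * (y' - y)) \<le> 2 * \<nu>"
    using circ_diff[of "2*y' - 1/2" "2*y - 1/2"] b(3) b'(3) by (simp add: algebra_simps)
  from circ_B[OF b(1) this] have B: "circ (real_of_int B * (y' - y)) \<le> 1/4" using params(9) by simp
  have "real_of_int A/2 = (phase (u+1/2) y' - 1/2) - (phase u y - 1/2) - real_of_int A * (r * cos (2*pi*y')) + real_of_int A * (r * cos (2*pi*y)) - real_of_int B * (y' - y)"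
    by (simp add: phase_def algebra_simps)
  also have "circ \<dots> \<le> circ (phase (u+1/2) y' - 1/2) + circ (phase u y - 1/2) + circ (real_of_int A * (r * cos (2*pi*y'))) + circ (real_of_int A * (r * cos (2*pi*y))) + circ (real_of_int B * (y' - y))"
    by (intro order_trans[OF circ_diff] order_trans[OF circ_add] add_mono order_refl)
  also have "\<dots> \<le> 9* s + 9* s + 1/8 + 1/8 + 1/4" by (intro add_mono half B near_half') (use f f' in auto)
  also have "\<dots> < 1" using params(2) by simp
  finally show False using circ_half_odd[OF odd_half[OF odd_A]] by simp
qed

end

text \<open>
  The transversal shear has opposite slopes at the two preimages on a line, so a common image vector can be in the direction of
  large badness for at most one of them, quantitatively where that slope is not small.
\<close>
lemma siblings_not_both_vertical:
  fixes \<alpha> \<beta> \<rho> \<mu> V1 V2 :: real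
  assumes "\<alpha> \<noteq> 0" "\<beta> \<noteq> 0" "0 < \<epsilon>" "\<epsilon> \<le> \<bar>\<rho>\<bar>" "(V1,V2) \<noteq> (0,0)"
    and \<mu>: "0 < \<mu>" "\<mu> \<le> \<bar>\<alpha>\<bar> * \<epsilon>" "\<mu> \<le> \<bar>\<alpha>\<bar> / 2" "\<mu> \<le> \<bar>\<alpha>\<bar> * \<epsilon> * \<bar>\<alpha>\<bar> / (2 * \<bar>\<beta>\<bar>)"
  shows "\<mu> * vnorm V1 V2 \<le> \<bar>\<alpha>*V1 + (\<beta>+\<alpha>*\<rho>)*V2\<bar> \<or> \<mu> * vnorm V1 V2 \<le> \<bar>\<alpha>*V1 + (\<beta>-\<alpha>*\<rho>)*V2\<bar>"
proof (rule ccontr)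
  assume neg: "\<not> ?thesis"
  define N where "N = vnorm V1 V2"
  have N: "N > 0" "\<bar>V1\<bar> \<le> N" "\<bar>V2\<bar> \<le> N" "N = \<bar>V1\<bar> \<or> N = \<bar>V2\<bar>"
    using vnorm_pos[OF assms(5)] by (auto simp: N_def vnorm_def max_def)
  define p where "p = \<alpha>*V1 + \<beta>*V2"
  define q where "q = \<alpha>*\<rho>*V2"
  have pq: "\<bar>p + q\<bar> < \<mu> * N" "\<bar>p - q\<bar> < \<mu> * N"
    using neg unfolding N_def p_def q_def by (simp_all add: algebra_simps)
  then have p: "\<bar>p\<bar> < \<mu> * N" and q: "\<bar>q\<bar> < \<mu> * N" by linarith+
  have "\<bar>\<alpha>\<bar> * \<epsilon> * \<bar>V2\<bar> \<le> \<bar>\<alpha>\<bar> * \<bar>\<rho>\<bar> * \<bar>V2\<bar>" using assms by (intro mult_right_mono mult_left_mono) auto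
  also have "\<dots> = \<bar>q\<bar>" by (simp add: q_def abs_mult)
  finally have 1: "\<bar>\<alpha>\<bar> * \<epsilon> * \<bar>V2\<bar> < \<mu> * N" using q by linarith
  from N(4) show False
  proof
    assume e: "N = \<bar>V2\<bar>"
    have "\<mu> * N \<le> \<bar>\<alpha>\<bar> * \<epsilon> * N" using \<mu>(2) N(1) by (intro mult_right_mono) auto
    with 1 e show False by simp
  next
    assume e: "N = \<bar>V1\<bar>"
    have "\<bar>\<alpha>\<bar> * N = \<bar>\<alpha>*V1\<bar>" using e by (simp add: abs_mult)
    also have "\<dots> \<le> \<bar>p\<bar> + \<bar>\<beta>*V2\<bar>" unfolding p_def by linarith
    finally have "\<bar>\<alpha>\<bar> * N \<le> \<bar>p\<bar> + \<bar>\<beta>\<bar> * \<bar>V2\<bar>" by (simp add: abs_mult)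
    moreover have "\<mu> * N \<le> \<bar>\<alpha>\<bar> / 2 * N" using \<mu>(3) N(1) by (intro mult_right_mono) auto
    ultimately have "\<bar>\<alpha>\<bar> / 2 * N \<le> \<bar>\<beta>\<bar> * \<bar>V2\<bar>" using p by linarith
    then have "\<bar>\<alpha>\<bar> / (2 * \<bar>\<beta>\<bar>) * N \<le> \<bar>V2\<bar>" using assms(2) by (simp add: field_simps)
    then have "\<bar>\<alpha>\<bar> * \<epsilon> * (\<bar>\<alpha>\<bar> / (2 * \<bar>\<beta>\<bar>) * N) \<le> \<bar>\<alpha>\<bar> * \<epsilon> * \<bar>V2\<bar>" using assms by (intro mult_left_mono) auto
    moreover have "\<mu> * N \<le> \<bar>\<alpha>\<bar> * \<epsilon> * \<bar>\<alpha>\<bar> / (2 * \<bar>\<beta>\<bar>) * N" using \<mu>(4) N(1) by (intro mult_right_mono) auto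
    ultimately show False using 1 by (simp add: mult_ac)
  qed
qed

context half_twist
begin

text \<open>
  The weights must pay for the following configurations: \<open>-13/10\<close> for a flat point, where a bad branch may occur although the
  badness is small, and the extra \<open>-27/25\<close> for a resonant one, where both branches may be bad.
\<close>
definition "twist_slope y = - 2 * pi * r * sin (2*pi*y)"
definition "good_weight u y = (if flat u y then - 13/10 else 0 :: real)"
definition "bad_weight u y = (if resonant u y then - 99/25 else - 72/25 :: real)"

lemma weights: "- 13/10 \<le> good_weight u y" "good_weight u y \<le> 0" "- 99/25 \<le> bad_weight u y" "bad_weight u y \<le> - 72/25"
  "bad_weight u y \<le> good_weight u y" "good_weight u y - bad_weight u y \<le> 4"
  by (auto simp: good_weight_def bad_weight_def)

lemma twist_slope_shift: "twist_slope (y + 1/2) = - twist_slope y"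
proof -
  have "sin (2*pi*(y + 1/2)) = - sin (2*pi*y)" by (simp add: distrib_left)
  then show ?thesis by (simp add: twist_slope_def)
qed

lemma twist_slope_circ: "\<bar>twist_slope y\<bar> = 2 * pi * r * circ (2*y)"
  using params(4) by (simp add: twist_slope_def circ_def abs_mult mult_ac)

lemma twist_slope_small: "\<bar>twist_slope y\<bar> \<le> 1/256" "\<bar>real_of_int A\<bar> * \<bar>twist_slope y\<bar> \<le> 1/256"
proof -
  have "\<bar>twist_slope y\<bar> \<le> 2 * pi * r * 1" unfolding twist_slope_circ using params(4) circ_le1 by (intro mult_left_mono) auto
  also have "\<dots> \<le> 2 * 4 * r" using pi_less_4 params(4) by simp
  finally have t: "\<bar>twist_slope y\<bar> \<le> 8 * r" by simp
  then show "\<bar>twist_slope y\<bar> \<le> 1/256" using params(2,6) by simp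
  have "\<bar>real_of_int A\<bar> * \<bar>twist_slope y\<bar> \<le> \<bar>real_of_int A\<bar> * (8*r)" using t by (intro mult_left_mono) auto
  also have "\<dots> = 8 * (\<bar>real_of_int A\<bar> * r)" by simp
  finally show "\<bar>real_of_int A\<bar> * \<bar>twist_slope y\<bar> \<le> 1/256" using params(2,5) by simp
qed

definition "amp = sin (2*pi* s) / cos (4*pi* s)"

lemma amp: "0 < amp" "amp < 1/4" "profile amp (1/4 - s) = 0"
  using profile_zero[of s] params(1,2) unfolding amp_def by simp_all

text \<open>
  Instance of \<open>profile_fibre_geometry\<close> for two slopes, together with the translation of small or nearly equal slopes into the
  phase of the base point.
\<close>
lemma half_fibre_geometry:
  obtains \<epsilon> where "0 < \<epsilon>" "\<epsilon> \<le> 1/4"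
    "\<And>u i j. \<lbrakk>i < (2::nat); j < 2; i \<noteq> j; \<bar>profile amp (u + real i/2)\<bar> < 4*\<epsilon>; \<bar>profile amp (u + real j/2)\<bar> < 4*\<epsilon>\<rbrakk> \<Longrightarrow> False"
    "\<And>x y u i. \<lbrakk>2 * u = phase x y; \<bar>profile amp (u + real i/2)\<bar> < 4*\<epsilon>\<rbrakk> \<Longrightarrow> flat x y"
    "\<And>x y u. \<lbrakk>2 * u = phase x y; \<bar>profile amp u - profile amp (u + 1/2)\<bar> < 6*\<epsilon>\<rbrakk> \<Longrightarrow> resonant x y"
proof -
  have nz: "of_int h / real 2 + 2 * (1/4 - s) \<notin> \<int>" for h :: int
  proof
    assume "of_int h / real 2 + 2 * (1/4 - s) \<in> \<int>"
    then obtain k :: int where "of_int h / real 2 + 2 * (1/4 - s) = of_int k" by (auto elim: Ints_cases)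
    then have *: "real_of_int (h + 1 - 2*k) = 4 * s" by simp
    then have "0 < real_of_int (h + 1 - 2*k)" "real_of_int (h + 1 - 2*k) < 1" using params(1,2) by linarith+
    then have "0 < h + 1 - 2*k" "h + 1 - 2*k < 1" by linarith+
    then show False by simp
  qed
  obtain \<epsilon>1 where e1: "0 < \<epsilon>1" "\<epsilon>1 \<le> 1/4" and
    two: "\<And>u i j. \<lbrakk>i < 2; j < 2; i \<noteq> j; \<bar>profile amp (u + real i/real 2)\<bar> < 4*\<epsilon>1; \<bar>profile amp (u + real j/real 2)\<bar> < 4*\<epsilon>1\<rbrakk> \<Longrightarrow> False"
    using profile_fibre_geometry[OF less_imp_le[OF amp(1)] amp(2,3) _ nz] by auto
  define b where "b = 1 - 4 * amp"
  have b: "b > 0" using amp(2) by (simp add: b_def)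
  define \<epsilon>2 where "\<epsilon>2 = b * (\<tau>/2) * (\<tau>/2) / 3"
  have e2: "\<epsilon>2 > 0" using b params(10) by (simp add: \<epsilon>2_def)
  define \<epsilon>3 where "\<epsilon>3 = b * \<tau> / 6"
  have e3: "\<epsilon>3 > 0" using b params(10) by (simp add: \<epsilon>3_def)
  define \<epsilon> where "\<epsilon> = min \<epsilon>1 (min \<epsilon>2 \<epsilon>3)"
  have \<epsilon>: "\<epsilon> \<le> \<epsilon>1" "\<epsilon> \<le> \<epsilon>2" "\<epsilon> \<le> \<epsilon>3" "0 < \<epsilon>" "\<epsilon> \<le> 1/4" using e1 e2 e3 by (auto simp: \<epsilon>_def)
  show ?thesis
  proof (rule that[OF \<epsilon>(4,5)])
    fix u and i j :: nat
    assume h: "i < 2" "j < 2" "i \<noteq> j" "\<bar>profile amp (u + real i/2)\<bar> < 4*\<epsilon>" "\<bar>profile amp (u + real j/2)\<bar> < 4*\<epsilon>"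
    show False by (rule two[OF h(1-3), of u]) (use h(4,5) \<epsilon>(1) in simp_all)
  next
    fix x y u and i :: nat
    assume u: "2 * u = phase x y" and c: "\<bar>profile amp (u + real i/2)\<bar> < 4*\<epsilon>"
    define v where "v = u + real i/2"
    define z where "z = 1/4 - s"
    have v: "2 * v = phase x y + real i" using u by (simp add: v_def)
    have small: "circ (v + z) \<le> \<tau>/2 \<or> circ (v - z) \<le> \<tau>/2"
    proof (rule ccontr)
      assume "\<not> ?thesis"
      then have "2 * b * (\<tau>/2) * (\<tau>/2) \<le> 2 * b * circ (v + z) * circ (v - z)"
        using b params(10) by (intro mult_mono) auto
      also have "\<dots> \<le> \<bar>profile amp v\<bar>" using profile_separation[of amp v z] amp unfolding b_def z_def by simp
      also have "\<dots> < 4*\<epsilon>2" using c \<epsilon>(2) unfolding v_def by linarith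
      also have "\<dots> = 4/3 * (b * (\<tau>/2) * (\<tau>/2))" by (simp add: \<epsilon>2_def)
      finally have "2 * (b * (\<tau>/2) * (\<tau>/2)) < 4/3 * (b * (\<tau>/2) * (\<tau>/2))" by (simp only: mult.assoc)
      moreover have "b * (\<tau>/2) * (\<tau>/2) > 0" using b params(10) by simp
      ultimately show False by linarith
    qed
    have dbl: "circ (2 * w) \<le> \<tau>" if "circ w \<le> \<tau>/2" for w
      using circ_mult_nat[of 2 w] that by simp
    from small show "flat x y"
    proof
      assume "circ (v + z) \<le> \<tau>/2"
      then have "circ (2 * (v + z)) \<le> \<tau>" by (rule dbl)
      moreover have "circ (phase x y - 1/2 - 2* s) = circ (2 * (v + z))"
      proof (rule circ_cong_Ints)
        have "phase x y - 1/2 - 2* s - 2 * (v + z) = - real (i + 1)" using v by (simp add: z_def)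
        then show "phase x y - 1/2 - 2* s - 2 * (v + z) \<in> \<int>" by (simp only: Ints_minus Ints_of_nat)
      qed
      ultimately show ?thesis by (simp add: flat_def)
    next
      assume "circ (v - z) \<le> \<tau>/2"
      then have "circ (2 * (v - z)) \<le> \<tau>" by (rule dbl)
      moreover have "circ (phase x y - 1/2 + 2* s) = circ (2 * (v - z))"
      proof (rule circ_cong_Ints)
        have "phase x y - 1/2 + 2* s - 2 * (v - z) = - real i" using v by (simp add: z_def)
        then show "phase x y - 1/2 + 2* s - 2 * (v - z) \<in> \<int>" by (simp only: Ints_minus Ints_of_nat)
      qed
      ultimately show ?thesis by (simp add: flat_def)
    qed
  next
    fix x y u
    assume u: "2 * u = phase x y" and c: "\<bar>profile amp u - profile amp (u + 1/2)\<bar> < 6*\<epsilon>"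
    have "2 * b * circ (u + (u + 1/2)) * circ (u - (u + 1/2)) \<le> \<bar>profile amp u - profile amp (u + 1/2)\<bar>"
      using profile_separation[of amp u "u + 1/2"] amp unfolding b_def by simp
    moreover have "circ (u - (u + 1/2)) = 1" using circ_minus[of "1/2"] by simp
    ultimately have "2 * b * circ (u + (u + 1/2)) \<le> 6 * \<epsilon>3" using c \<epsilon>(3) by simp
    then have "b * circ (u + (u + 1/2)) \<le> b * \<tau>" using mult_nonneg_nonneg[OF less_imp_le[OF b] circ_nonneg[of "u + (u + 1/2)"]] by (simp add: \<epsilon>3_def)
    then have "circ (u + (u + 1/2)) \<le> \<tau>" using b by simp
    moreover have "circ (phase x y - 1/2) = circ (u + (u + 1/2))" using u by (intro circ_cong_Ints) simp
    ultimately show "resonant x y" by (simp add: resonant_def)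
  qed
qed

text \<open>
  The total weight of the two preimages on a bad line, where \<open>w0\<close>, \<open>w1\<close> are their badnesses and \<open>L = ln t\<close>. Where the slopes of
  the transversal shear are not small, one of the two badnesses is bounded, and the cost is at most
  \<open>99/25 + 0\<close> or \<open>72/25 + 13/10 = 209/50\<close>, since a resonant point has no flat sibling. Elsewhere both may be maximal, but then the two
  points are not both resonant, which leaves \<open>99/25 + 72/25 = 171/25\<close>, or \<open>2 \<cdot> 72/25 = 144/25\<close> if the base point is flat or
  resonant and so excludes resonance.
\<close>
lemma bad_pair_weight:
  fixes w0 w1 L K u y :: real
  assumes L: "0 \<le> L" and K: "0 \<le> K"
    and w: "w0 \<le> L" "w1 \<le> L"
    and alt: "\<nu> < circ (2*y) \<Longrightarrow> w0 \<le> K \<or> w1 \<le> K"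
  defines "\<Sigma> \<equiv> good_weight u y * L + (bad_weight u y - good_weight u y) * w0
     + (good_weight u (y+1/2) * L + (bad_weight u (y+1/2) - good_weight u (y+1/2)) * w1)"
  shows "- 171/25 * L - 4 * K \<le> \<Sigma>"
    and "circ (2*u - 1/2) \<le> 9 * s \<Longrightarrow> - 144/25 * L - 4 * K \<le> \<Sigma>"
proof -
  have full: "bad_weight u y * L \<le> good_weight u y * L + (bad_weight u y - good_weight u y) * w" if "w \<le> L" for u y w
    using mult_left_mono_neg[OF that, of "bad_weight u y - good_weight u y"] weights(5)[of u y] by (simp add: algebra_simps)
  have part: "good_weight u y * L - 4 * K \<le> good_weight u y * L + (bad_weight u y - good_weight u y) * w" if "w \<le> K" for u y w
  proof -
    have "(good_weight u y - bad_weight u y) * w \<le> (good_weight u y - bad_weight u y) * K"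
      using that weights(5)[of u y] by (intro mult_left_mono) auto
    also have "\<dots> \<le> 4 * K" using weights(6)[of u y] K by (intro mult_right_mono) auto
    finally show ?thesis by (simp add: algebra_simps)
  qed
  have mixed: "- 209/50 \<le> bad_weight u y + good_weight u (y+1/2)" "- 209/50 \<le> good_weight u y + bad_weight u (y+1/2)"
    using resonant_flat[of u y] by (auto simp: good_weight_def bad_weight_def)
  have c': "circ (2*(y+1/2)) = circ (2*y)" by (rule circ_cong_Ints) simp
  have far: "- 144/25 * L - 4 * K \<le> \<Sigma>" if "\<nu> < circ (2*y)"
  proof -
    from alt[OF that] have "- 209/50 * L - 4 * K \<le> \<Sigma>"
    proof
      assume k: "w0 \<le> K"
      show ?thesis using part[OF k, of u y] full[OF w(2), of u "y+1/2"] mult_right_mono[OF mixed(2) L]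
        unfolding \<Sigma>_def by (simp add: algebra_simps)
    next
      assume k: "w1 \<le> K"
      show ?thesis using part[OF k, of u "y+1/2"] full[OF w(1), of u y] mult_right_mono[OF mixed(1) L]
        unfolding \<Sigma>_def by (simp add: algebra_simps)
    qed
    then show ?thesis using L by simp
  qed
  have near: "(bad_weight u y + bad_weight u (y+1/2)) * L \<le> \<Sigma>"
    using full[OF w(1), of u y] full[OF w(2), of u "y+1/2"] unfolding \<Sigma>_def by (simp add: algebra_simps)
  show "- 171/25 * L - 4 * K \<le> \<Sigma>"
  proof (cases "\<nu> < circ (2*y)")
    case True then show ?thesis using far[OF True] L by simp
  next
    case False
    then have "- 171/25 \<le> bad_weight u y + bad_weight u (y+1/2)"
      using both_resonant[of u y] by (auto simp: bad_weight_def)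
    from mult_right_mono[OF this L] near K show ?thesis by simp
  qed
  assume u: "circ (2*u - 1/2) \<le> 9 * s"
  show "- 144/25 * L - 4 * K \<le> \<Sigma>"
  proof (cases "\<nu> < circ (2*y)")
    case True then show ?thesis using far[OF True] L by simp
  next
    case False
    then have "- 144/25 \<le> bad_weight u y + bad_weight u (y+1/2)"
      using no_resonance[OF u, of y] no_resonance[OF u, of "y+1/2"] c' by (auto simp: bad_weight_def)
    from mult_right_mono[OF this L] near K show ?thesis by simp
  qed
qed

end

lemma sum_lessThan_two: "(\<Sum>i<(2::nat). h i) = h 0 + (h 1 :: real)"
  by (simp add: numeral_2_eq_2)

context half_twist
begin

text \<open>
  Relative to the goal, in multiples of \<open>ln t\<close>. No bad line: the gain is \<open>4\<close>, and the weights cost at most \<open>39/10\<close>, as not all four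
  preimages are flat, or \<open>52/10\<close> against a credit of \<open>52/10\<close> at a flat base point. One bad line over a flat point:
  \<open>2 - 144/25 - 13/10\<close> against \<open>-52/10\<close>. One bad line over a point that is not flat: the slope is not small, hence the badness is
  maximal, and \<open>2 - 171/25 - 26/10\<close> competes with \<open>-4 \<cdot> 47/25\<close>. Two bad lines: the point is resonant and the badness is maximal,
  and \<open>-2 \<cdot> 144/25\<close> competes with \<open>-296/25\<close>.
\<close>
lemma drift_half:
  fixes \<gamma> \<delta> :: real
  assumes det: "real_of_int A / 2 * \<delta> - real_of_int B / 2 * \<gamma> \<noteq> 0"
  obtains t\<^sub>0 :: real where "t\<^sub>0 \<ge> 1"
    "\<And>t u x1 x2 v w (y :: nat \<Rightarrow> real). \<lbrakk>t \<ge> t\<^sub>0; (v,w) \<noteq> (0,0); 2 * u = phase x1 x2\<rbrakk> \<Longrightarrow>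
       4 * (fibre_potential t (good_weight x1 x2) (bad_weight x1 x2) (A/2) (B/2 + A/2 * twist_slope x2) v w + 1) \<le>
       (\<Sum>i<2. \<Sum>j<2. fibre_potential t (good_weight (u + real i/2) (y i + real j/2)) (bad_weight (u + real i/2) (y i + real j/2))
          (A/2) (B/2 + A/2 * twist_slope (y i + real j/2)) (A/2 * v + (B/2 + A/2 * twist_slope x2) * w)
          (\<gamma> * v + (\<delta> + \<gamma> * twist_slope x2) * w - t * profile amp (u + real i/2) * (A/2 * v + (B/2 + A/2 * twist_slope x2) * w)))"
proof -
  define \<alpha> where "\<alpha> = real_of_int A / 2"
  define \<beta> where "\<beta> = real_of_int B / 2"
  have det': "\<alpha> * \<delta> - \<beta> * \<gamma> \<noteq> 0" using det by (simp add: \<alpha>_def \<beta>_def)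
  obtain C where C: "C \<ge> 1"
      "\<And>\<rho> v w. \<bar>\<rho>\<bar> \<le> 1 \<Longrightarrow> \<bar>\<alpha>* v + (\<beta>+\<alpha>*\<rho>)*w\<bar> \<le> C * vnorm v w"
      "\<And>\<rho> v w. \<bar>\<rho>\<bar> \<le> 1 \<Longrightarrow> \<bar>\<gamma>* v + (\<delta>+\<gamma>*\<rho>)*w\<bar> \<le> C * vnorm v w"
      "\<And>\<rho> v w. \<bar>\<rho>\<bar> \<le> 1 \<Longrightarrow> vnorm v w \<le> C * max \<bar>\<alpha>* v + (\<beta>+\<alpha>*\<rho>)*w\<bar> \<bar>\<gamma>* v + (\<delta>+\<gamma>*\<rho>)*w\<bar>"
    using linear_bounds[OF det'] by blast
  obtain \<epsilon> where \<epsilon>: "0 < \<epsilon>" "\<epsilon> \<le> 1/4" and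
    two: "\<And>u i j. \<lbrakk>i < (2::nat); j < 2; i \<noteq> j; \<bar>profile amp (u + real i/2)\<bar> < 4*\<epsilon>; \<bar>profile amp (u + real j/2)\<bar> < 4*\<epsilon>\<rbrakk> \<Longrightarrow> False" and
    is_flat: "\<And>x y u i. \<lbrakk>2 * u = phase x y; \<bar>profile amp (u + real i/2)\<bar> < 4*\<epsilon>\<rbrakk> \<Longrightarrow> flat x y" and
    is_resonant: "\<And>x y u. \<lbrakk>2 * u = phase x y; \<bar>profile amp u - profile amp (u + 1/2)\<bar> < 6*\<epsilon>\<rbrakk> \<Longrightarrow> resonant x y"
    using half_fibre_geometry by blast
  have \<alpha>0: "\<alpha> \<noteq> 0" and \<beta>0: "\<beta> \<noteq> 0" using abs_A B_nonzero by (auto simp: \<alpha>_def \<beta>_def)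
  have b0: "(0::real) < 1/4" "(1/4::real) \<le> 1" "\<And>y. 1/4 \<le> \<bar>\<beta> + \<alpha> * twist_slope y\<bar>"
  proof -
    fix y
    have "\<bar>B\<bar> \<ge> 1" using B_nonzero by linarith
    then have "\<bar>\<beta>\<bar> \<ge> 1/2" by (simp add: \<beta>_def)
    moreover have "\<bar>\<alpha> * twist_slope y\<bar> \<le> 1/256" using twist_slope_small(2)[of y] by (simp add: \<alpha>_def abs_mult)
    ultimately show "1/4 \<le> \<bar>\<beta> + \<alpha> * twist_slope y\<bar>" by linarith
  qed simp_all
  define \<epsilon>' where "\<epsilon>' = 2 * pi * r * \<nu>"
  have \<epsilon>': "\<epsilon>' > 0" using params(4,7) by (simp add: \<epsilon>'_def)
  (* The constant of \<open>siblings_not_both_vertical\<close> for transversal slopes of modulus at least \<open>\<epsilon>'\<close>. *)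
  define \<mu> where "\<mu> = Min {1, \<bar>\<alpha>\<bar> * \<epsilon>', \<bar>\<alpha>\<bar> / 2, \<bar>\<alpha>\<bar> * \<epsilon>' * \<bar>\<alpha>\<bar> / (2 * \<bar>\<beta>\<bar>)}"
  have \<mu>: "0 < \<mu>" "\<mu> \<le> 1" "\<mu> \<le> \<bar>\<alpha>\<bar> * \<epsilon>'" "\<mu> \<le> \<bar>\<alpha>\<bar> / 2" "\<mu> \<le> \<bar>\<alpha>\<bar> * \<epsilon>' * \<bar>\<alpha>\<bar> / (2 * \<bar>\<beta>\<bar>)"
  proof -
    show "0 < \<mu>" unfolding \<mu>_def using \<alpha>0 \<beta>0 \<epsilon>' by (subst Min_gr_iff) auto
  qed (unfold \<mu>_def, (rule Min_le; simp)+)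
  define K2 where "K2 = - ln \<mu>"
  have K2: "K2 \<ge> 0" using \<mu>(1,2) by (simp add: K2_def)
  define K where "K = ln (4*C) + ln C - ln \<epsilon> - 4 * ln (1/4/2) + 2 * K2"
  have K1: "ln (4*C) + 2 * K2 \<le> K" "ln C - ln \<epsilon> - 4 * ln (1/4/2) \<le> K" "0 \<le> ln C" "0 \<le> K"
  proof -
    have "0 \<le> ln C" "0 \<le> ln (4*C)" using C(1) by simp_all
    moreover have "ln \<epsilon> \<le> 0" using \<epsilon> by simp
    moreover have "ln (1/4/2::real) \<le> 0" by simp
    ultimately show "ln (4*C) + 2 * K2 \<le> K" "ln C - ln \<epsilon> - 4 * ln (1/4/2) \<le> K" "0 \<le> ln C" "0 \<le> K" using K2 unfolding K_def by linarith+
  qed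
  (* The smallest margin is \<open>2/25 ln t\<close>, in the case of one bad line over a point that is not flat. *)
  define Q where "Q = 1000 * (K + ln C + ln (C/\<epsilon>) + 1)"
  define t0 where "t0 = Max {1, exp Q, 1/\<epsilon>, 2*\<bar>\<alpha>\<bar> / (\<epsilon> * (1/4))}"
  show ?thesis
  proof (rule that[of t0])
    show "t0 \<ge> 1" by (simp add: t0_def)
    fix t u x1 x2 v w :: real and y :: "nat \<Rightarrow> real"
    assume t: "t \<ge> t0" and vw: "(v,w) \<noteq> (0,0)" and u: "2 * u = phase x1 x2"
    have t1: "t \<ge> 1" and tQ: "exp Q \<le> t" and te: "1/\<epsilon> \<le> t" "2*\<bar>\<alpha>\<bar> / (\<epsilon> * (1/4)) \<le> t" using t by (simp_all add: t0_def)
    have tp: "t > 0" using t1 by simp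
    have "ln (exp Q) \<le> ln t" using tQ by (intro ln_mono) simp_all
    then have LQ: "1000 * K + 1000 * ln C + 1000 * ln (C/\<epsilon>) + 1000 \<le> ln t" by (simp add: Q_def)
    have large: "\<epsilon> * t \<ge> 1" "\<epsilon> * t * (1/4) \<ge> 2 * \<bar>\<alpha>\<bar>"
      using te \<epsilon> by (simp_all add: pos_divide_le_eq mult_ac)
    have L0: "ln t \<ge> 0" using t1 by simp
    define N where "N = vnorm v w"
    have N: "N > 0" unfolding N_def by (rule vnorm_pos[OF vw])
    define X where "X = \<alpha> * v + (\<beta> + \<alpha> * twist_slope x2) * w"
    define Y where "Y = \<gamma> * v + (\<delta> + \<gamma> * twist_slope x2) * w"
    have ts1: "\<bar>twist_slope x2\<bar> \<le> 1" using twist_slope_small(1)[of x2] by simp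
    have XY: "\<bar>X\<bar> \<le> C * N" "\<bar>Y\<bar> \<le> C * N" "N \<le> C * max \<bar>X\<bar> \<bar>Y\<bar>"
      using C(2-4)[OF ts1, of v w] unfolding X_def Y_def N_def by blast+
    define c where "c i = profile amp (u + real i/2)" for i :: nat
    have c: "\<bar>c i\<bar> \<le> 2" for i unfolding c_def using amp by (intro profile_bound) simp
    define om where "om = badness t X N"
    have om: "- ln C \<le> om" unfolding om_def by (rule badness_ge[OF t1 N C(1) XY(1)])
    define V where "V i = Y - t * c i * X" for i
    have V0: "(X, V i) \<noteq> (0,0)" for i using XY(3) N by (auto simp: V_def)
    define f where "f i j = fibre_potential t (good_weight (u + real i/2) (y i + real j/2)) (bad_weight (u + real i/2) (y i + real j/2))
       \<alpha> (\<beta> + \<alpha> * twist_slope (y i + real j/2)) X (V i)" for i j :: nat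
    define g where "g = ln N - om - K"
    define M where "M = max \<bar>Y\<bar> (t * \<bar>X\<bar>)"
    define bad where "bad i \<longleftrightarrow> \<bar>V i\<bar> < \<epsilon> * M" for i
    define gw where "gw i j = good_weight (u + real i/2) (y i + real j/2)" for i j :: nat
    define F where "F i = f i 0 + f i 1" for i
    have fgood: "g + ln t + gw i j * ln t \<le> f i j" if "\<not> bad i" for i j
    proof -
      have "\<epsilon> * max \<bar>Y\<bar> (t * \<bar>X\<bar>) \<le> \<bar>V i\<bar>" using that unfolding bad_def M_def by linarith
      from branch_good(1)[OF t1 N C(1) XY(3) \<epsilon>(1) this, where \<phi>\<^sub>S = "gw i j" and \<phi>\<^sub>W = "bad_weight (u + real i/2) (y i + real j/2)"
          and ?b0.0 = "1/4" and b = "\<beta> + \<alpha> * twist_slope (y i + real j/2)" and \<alpha> = \<alpha>, OF _ _ b0 large] K1(2) weights(5,6)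
      show ?thesis unfolding f_def fibre_potential_def om_def g_def gw_def by simp
    qed
    have Fgood: "2 * g + 2 * ln t + (gw i 0 + gw i 1) * ln t \<le> F i" if "\<not> bad i" for i
      using fgood[OF that, of 0] fgood[OF that, of 1] unfolding F_def by (simp add: algebra_simps)
    have gw1: "- 13/10 \<le> gw i j" for i j using weights(1) unfolding gw_def .
    have gw2: "- 26/10 \<le> gw i 0 + gw i 1" for i using gw1[of i 0] gw1[of i 1] by linarith
    define bd where "bd i j = badness t (\<alpha> * X + (\<beta> + \<alpha> * twist_slope (y i + real j/2)) * V i) (vnorm X (V i))" for i j :: nat
    have growth: "ln N - om - ln (4*C) \<le> ln (vnorm X (V i))" for i
      using growth_ge[OF t1 N C(1) XY(3) c[of i]] unfolding om_def V_def .
    have bdL: "bd i j \<le> ln t" for i j unfolding bd_def by (rule badness_le[OF tp])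
    have alt: "bd i 0 \<le> K2 \<or> bd i 1 \<le> K2" if "\<nu> < circ (2 * y i)" for i
    proof -
      have slope: "\<epsilon>' \<le> \<bar>twist_slope (y i)\<bar>" unfolding twist_slope_circ \<epsilon>'_def using that params(4) by (intro mult_left_mono) auto
      have "\<mu> * vnorm X (V i) \<le> \<bar>\<alpha>*X + (\<beta> + \<alpha> * twist_slope (y i)) * V i\<bar> \<or> \<mu> * vnorm X (V i) \<le> \<bar>\<alpha>*X + (\<beta> - \<alpha> * twist_slope (y i)) * V i\<bar>"
        by (rule siblings_not_both_vertical[OF \<alpha>0 \<beta>0 \<epsilon>' slope V0 \<mu>(1,3-5)])
      then show ?thesis
      proof
        assume h: "\<mu> * vnorm X (V i) \<le> \<bar>\<alpha>*X + (\<beta> + \<alpha> * twist_slope (y i)) * V i\<bar>"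
        have "bd i 0 \<le> K2" unfolding bd_def K2_def using badness_le_of_ge[OF vnorm_pos[OF V0[of i]] \<mu>(1) _ tp] h by simp
        then show ?thesis ..
      next
        assume h: "\<mu> * vnorm X (V i) \<le> \<bar>\<alpha>*X + (\<beta> - \<alpha> * twist_slope (y i)) * V i\<bar>"
        have "bd i 1 \<le> K2" unfolding bd_def K2_def using badness_le_of_ge[OF vnorm_pos[OF V0[of i]] \<mu>(1) _ tp] h by (simp add: twist_slope_shift)
        then show ?thesis ..
      qed
    qed
    have Fsplit: "F i = 2 * ln (vnorm X (V i)) + (good_weight (u + real i/2) (y i) * ln t + (bad_weight (u + real i/2) (y i) - good_weight (u + real i/2) (y i)) * bd i 0
     + (good_weight (u + real i/2) (y i+1/2) * ln t + (bad_weight (u + real i/2) (y i+1/2) - good_weight (u + real i/2) (y i+1/2)) * bd i 1))" for i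
      unfolding F_def f_def fibre_potential_def bd_def by simp
    have Fbad: "2 * g - 171/25 * ln t \<le> F i" for i
      using bad_pair_weight(1)[where u = "u + real i/2" and y = "y i", OF L0 K2 bdL[of i 0] bdL[of i 1] alt[of i]] growth[of i] K1(1)
      unfolding Fsplit g_def by (simp add: algebra_simps)
    have Fbad': "2 * g - 144/25 * ln t \<le> F i" if "circ (2 * (u + real i/2) - 1/2) \<le> 9 * s" for i
      using bad_pair_weight(2)[where u = "u + real i/2" and y = "y i", OF L0 K2 bdL[of i 0] bdL[of i 1] alt[of i] that] growth[of i] K1(1)
      unfolding Fsplit g_def by (simp add: algebra_simps)
    define \<phi>\<^sub>S where "\<phi>\<^sub>S = good_weight x1 x2"
    define \<phi>\<^sub>W where "\<phi>\<^sub>W = bad_weight x1 x2"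
    define D where "D = \<phi>\<^sub>S - \<phi>\<^sub>W - 1"
    have D: "29/50 \<le> D" "D \<le> 3" using weights(1,4)[of x1 x2] weights(6)[of x1 x2] unfolding D_def \<phi>\<^sub>S_def \<phi>\<^sub>W_def by linarith+
    have Dom: "- 3 * ln C \<le> D * om"
    proof -
      have "D * (- ln C) \<le> D * om" using om D by (intro mult_left_mono) auto
      moreover have "D * ln C \<le> 3 * ln C" using D K1(3) by (intro mult_right_mono) auto
      ultimately show ?thesis by simp
    qed
    have lCe: "0 \<le> ln (C/\<epsilon>)" using C(1) \<epsilon> by simp
    define W where "W = D * om"
    have near: "circ (2 * (u + real i/2) - 1/2) \<le> 9 * s" if "flat x1 x2 \<or> resonant x1 x2" for i
    proof -
      have "circ (2 * (u + real i/2) - 1/2) = circ (phase x1 x2 - 1/2)" using u by (intro circ_cong_Ints) simp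
      then show ?thesis using near_half'[OF that] by simp
    qed
    have vertical: "ln t - ln (C/\<epsilon>) \<le> om \<or> (bad i \<longrightarrow> \<bar>c i\<bar> < 4 * \<epsilon>) \<and> (bad j \<longrightarrow> \<bar>c j\<bar> < 4 * \<epsilon>)" for i j
    proof (rule flat_or_vertical[OF tp N C(1) \<epsilon>(1) _ XY(2), of X])
      show "\<epsilon> \<le> 1" using \<epsilon> by simp
      assume flat: "\<bar>Y\<bar> \<le> \<epsilon> * (t * \<bar>X\<bar>)"
      have "\<bar>c l\<bar> < 4 * \<epsilon>" if "bad l" for l
        using bad_branch_flat[OF \<epsilon>(2,1) c[of l] _ _ flat] that t1 by (simp add: bad_def M_def V_def)
      then show ?thesis by blast
    qed (simp add: om_def)
    have goal: "4 * (ln N + \<phi>\<^sub>S * ln t + (\<phi>\<^sub>W - \<phi>\<^sub>S) * om + 1) = 4 * g + 4 * \<phi>\<^sub>S * ln t - 4 * (D * om) + 4 * K + 4"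
      by (simp add: g_def D_def algebra_simps)
    have nonflat: "\<phi>\<^sub>S = 0" "47/25 \<le> D" if "\<not> flat x1 x2"
      using that weights(4)[of x1 x2] by (simp_all add: D_def \<phi>\<^sub>S_def \<phi>\<^sub>W_def good_weight_def)
    have isflat: "\<phi>\<^sub>S = - 13/10" if "flat x1 x2" using that by (simp add: \<phi>\<^sub>S_def good_weight_def)
    have one_bad: "4 * g + 4 * \<phi>\<^sub>S * ln t - 4 * (D * om) + 4 * K + 4 \<le> F i + F j"
      if ij: "i < 2" "j < 2" "i \<noteq> j" and bi: "bad i" and bj: "\<not> bad j" for i j
    proof (cases "flat x1 x2")
      case True
      have "\<not> (flat (u + real j/2) (y j) \<and> flat (u + real j/2) (y j + 1/2))"
        using no_double_flat[OF near[OF disjI1[OF True], of j]] by blast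
      then have "- 13/10 \<le> gw j 0 + gw j 1" by (auto simp: gw_def good_weight_def)
      from mult_right_mono[OF this L0] Fgood[OF bj] Fbad'[OF near[OF disjI1[OF True], of i]] Dom LQ K1(3,4) lCe
      show ?thesis unfolding isflat[OF True] by (simp add: algebra_simps)
    next
      case False
      have "\<not> \<bar>c i\<bar> < 4 * \<epsilon>" using False is_flat[OF u, of i] by (auto simp: c_def)
      then have omL: "ln t - ln (C/\<epsilon>) \<le> om" using vertical[of i i] bi by blast
      then have "47/25 * om \<le> W" unfolding W_def using nonflat(2)[OF False] LQ K1(3,4) lCe by (intro mult_right_mono) auto
      with mult_right_mono[OF gw2[of j] L0] Fgood[OF bj] Fbad[of i] omL LQ K1(3,4) lCe
      show ?thesis unfolding nonflat(1)[OF False] W_def[symmetric] by (simp add: algebra_simps)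
    qed
    have "4 * g + 4 * \<phi>\<^sub>S * ln t - 4 * (D * om) + 4 * K + 4 \<le> F 0 + F 1"
    proof -
      consider "\<not> bad 0 \<and> \<not> bad 1" | "bad 0 \<and> \<not> bad 1" | "\<not> bad 0 \<and> bad 1" | "bad 0 \<and> bad 1" by blast
      then show ?thesis
      proof cases
        case 1
        have lower: "4 * g + 4 * ln t + (gw 0 0 + gw 0 1 + (gw 1 0 + gw 1 1)) * ln t \<le> F 0 + F 1"
          using Fgood[of 0] Fgood[of 1] 1 by (simp add: algebra_simps)
        show ?thesis
        proof (cases "flat x1 x2")
          case True
          have "- 52/10 \<le> gw 0 0 + gw 0 1 + (gw 1 0 + gw 1 1)" using gw2[of 0] gw2[of 1] by linarith
          from mult_right_mono[OF this L0] lower Dom LQ K1(3,4) lCe show ?thesis unfolding isflat[OF True] by (simp add: algebra_simps)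
        next
          case False
          have "\<not> (flat u (y 0) \<and> flat u (y 0 + 1/2) \<and> flat (u + 1/2) (y 1) \<and> flat (u + 1/2) (y 1 + 1/2))"
            using not_all_flat by blast
          then have "- 39/10 \<le> gw 0 0 + gw 0 1 + (gw 1 0 + gw 1 1)" by (auto simp: gw_def good_weight_def)
          from mult_right_mono[OF this L0] lower Dom LQ K1(3,4) lCe show ?thesis unfolding nonflat(1)[OF False] by (simp add: algebra_simps)
        qed
      next
        case 2 then show ?thesis using one_bad[of 0 1] by simp
      next
        case 3 then show ?thesis using one_bad[of 1 0] by simp
      next
        case 4
        have "\<not> (\<bar>c 0\<bar> < 4 * \<epsilon> \<and> \<bar>c 1\<bar> < 4 * \<epsilon>)" using two[of 0 1 u] by (auto simp: c_def)
        then have omL: "ln t - ln (C/\<epsilon>) \<le> om" using vertical[of 0 1] 4 by blast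
        have "\<bar>c 0 - c 1\<bar> < 3 * (\<epsilon> + \<epsilon>)"
          by (rule two_bad_branches[OF \<epsilon>(2,1) c[of 0] \<epsilon>(1), of t Y X "c 1"]) (use 4 t1 in \<open>simp_all add: bad_def M_def V_def\<close>)
        then have res: "resonant x1 x2" by (intro is_resonant[OF u]) (simp add: c_def)
        have D4: "4 * D = 4 * \<phi>\<^sub>S + 296/25" using res by (simp add: D_def \<phi>\<^sub>W_def bad_weight_def)
        have "4 * (D * om) = (4 * D) * om" by simp
        also have "\<dots> = 4 * (\<phi>\<^sub>S * om) + 296/25 * om" unfolding D4 by (simp add: algebra_simps)
        finally have D5: "4 * (D * om) = 4 * (\<phi>\<^sub>S * om) + 296/25 * om" .
        have S: "- 13/10 \<le> \<phi>\<^sub>S" "\<phi>\<^sub>S \<le> 0" using weights(1,2) by (simp_all add: \<phi>\<^sub>S_def)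
        have "om \<le> ln t" unfolding om_def by (rule badness_le[OF tp])
        then have "\<phi>\<^sub>S * ln t \<le> \<phi>\<^sub>S * om" using S(2) by (intro mult_left_mono_neg)
        then show ?thesis using D5 Fbad'[OF near[OF disjI2[OF res], of 0]] Fbad'[OF near[OF disjI2[OF res], of 1]] omL LQ K1(3,4) lCe
          by (simp add: algebra_simps)
      qed
    qed
    then have "4 * (ln N + \<phi>\<^sub>S * ln t + (\<phi>\<^sub>W - \<phi>\<^sub>S) * om + 1) \<le> F 0 + F 1" unfolding goal .
    then show "4 * (fibre_potential t (good_weight x1 x2) (bad_weight x1 x2) (A/2) (B/2 + A/2 * twist_slope x2) v w + 1) \<le>
       (\<Sum>i<2. \<Sum>j<2. fibre_potential t (good_weight (u + real i/2) (y i + real j/2)) (bad_weight (u + real i/2) (y i + real j/2))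
          (A/2) (B/2 + A/2 * twist_slope (y i + real j/2)) (A/2 * v + (B/2 + A/2 * twist_slope x2) * w)
          (\<gamma> * v + (\<delta> + \<gamma> * twist_slope x2) * w - t * profile amp (u + real i/2) * (A/2 * v + (B/2 + A/2 * twist_slope x2) * w)))"
      unfolding sum_lessThan_two F_def f_def c_def V_def X_def Y_def N_def om_def fibre_potential_def \<phi>\<^sub>S_def \<phi>\<^sub>W_def \<alpha>_def \<beta>_def by simp
  qed
qed

end

section \<open>Torus maps from equivariant lifts\<close>

abbreviation integral_vector :: "real^2 \<Rightarrow> bool" where
  "integral_vector k \<equiv> \<forall>i. k $ i \<in> \<int>"

definition equivariant :: "(real^2 \<Rightarrow> real^2) \<Rightarrow> bool" where
  "equivariant F \<longleftrightarrow> (\<forall>x y. integral_vector (x - y) \<longrightarrow> integral_vector (F x - F y))"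

definition torus_map :: "(real^2 \<Rightarrow> real^2) \<Rightarrow> torus \<Rightarrow> torus" where
  "torus_map F p = torus_proj (F (torus_rep p))"

lemma torus_proj_eq_iff: "torus_proj x = torus_proj y \<longleftrightarrow> integral_vector (x - y)"
  using torus.abs_eq_iff[of x y] by simp

lemma torus_proj_rep [simp]: "torus_proj (torus_rep p) = p"
  using Quotient3_torus by (rule Quotient3_abs_rep)

lemma torus_exhaust: obtains x where "p = torus_proj x"
  using torus_proj_rep[of p] by metis

lemma torus_map_proj: "equivariant F \<Longrightarrow> torus_map F (torus_proj x) = torus_proj (F x)"
  unfolding torus_map_def torus_proj_eq_iff equivariant_def
  by (metis torus_proj_eq_iff torus_proj_rep)

lemma torus_linear_proj: "torus_linear E (torus_proj x) = torus_proj (real_matrix E *v x)"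
  by (rule torus_linear.abs_eq)

lemma equivariant_compose: "equivariant F \<Longrightarrow> equivariant G \<Longrightarrow> equivariant (F \<circ> G)"
  by (simp add: equivariant_def)

lemma torus_map_compose: "equivariant F \<Longrightarrow> torus_map (F \<circ> G) = torus_map F \<circ> torus_map G"
  by (rule ext) (simp add: torus_map_def[of "F \<circ> G"] torus_map_def[of G] torus_map_proj)

lemma equivariant_funpow: "equivariant F \<Longrightarrow> equivariant (F ^^ n)"
  by (induction n) (auto intro: equivariant_compose simp: equivariant_def)

lemma torus_map_funpow: "equivariant F \<Longrightarrow> torus_map F ^^ n = torus_map (F ^^ n)"
proof (induction n)
  case 0 show ?case by (rule ext) (simp add: torus_map_def)
next
  case (Suc n)
  have "torus_map F ^^ Suc n = torus_map F \<circ> torus_map (F ^^ n)" using Suc by simp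
  also have "\<dots> = torus_map (F ^^ Suc n)" using torus_map_compose[OF Suc.prems, of "F ^^ n"] by simp
  finally show ?case .
qed

lemma open_torus_proj_image: assumes "open W" shows "open (torus_proj ` W)"
proof -
  have "torus_proj -` (torus_proj ` W) = (\<Union>k\<in>{k. integral_vector k}. (+) k ` W)"
  proof (intro set_eqI iffI)
    fix x assume "x \<in> torus_proj -` (torus_proj ` W)"
    then obtain y where y: "y \<in> W" "integral_vector (x - y)" by (auto simp: torus_proj_eq_iff)
    then have "x \<in> (+) (x - y) ` W" by (auto intro!: image_eqI[of _ _ y])
    with y show "x \<in> (\<Union>k\<in>{k. integral_vector k}. (+) k ` W)" by blast
  next
    fix x assume "x \<in> (\<Union>k\<in>{k. integral_vector k}. (+) k ` W)"
    then obtain k y where "integral_vector k" "y \<in> W" "x = k + y" by blast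
    then show "x \<in> torus_proj -` (torus_proj ` W)" by (auto simp: torus_proj_eq_iff intro!: image_eqI[of _ _ y])
  qed
  moreover have "open (\<Union>k\<in>{k. integral_vector k}. (+) k ` W)"
    by (intro open_UN ballI open_translation assms)
  ultimately show ?thesis by (simp add: open_torus_def)
qed

lemma small_integral_vector: assumes "integral_vector k" "norm k < 1" shows "k = 0"
proof -
  have "k $ i = 0" for i
  proof -
    have "\<bar>k $ i\<bar> < 1" using component_le_norm_cart[of k i] assms(2) by linarith
    moreover obtain n where "k $ i = of_int n" using assms(1) by (auto elim: Ints_cases)
    ultimately show ?thesis by simp
  qed
  then show ?thesis by (simp add: vec_eq_iff)
qed

text \<open>
  The difference of two lifts is continuous and takes integral values, so it is locally constant.
\<close>
lemma derivative_unique_mod_integral: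
  fixes F G :: "real^2 \<Rightarrow> real^2"
  assumes W: "open W" "x \<in> W" and F: "(F has_derivative A) (at x)" and G: "(G has_derivative B) (at x)"
    and d: "\<And>y. y \<in> W \<Longrightarrow> integral_vector (F y - G y)"
  shows "A = B"
proof -
  define H where "H y = F y - G y" for y
  have H: "(H has_derivative (\<lambda>v. A v - B v)) (at x)" unfolding H_def by (intro derivative_intros F G)
  then have "isCont H x" by (rule has_derivative_continuous)
  then have "\<forall>\<^sub>F y in at x. dist (H y) (H x) < 1"
    by (intro tendstoD) (simp_all add: isCont_def)
  then have "\<forall>\<^sub>F y in at x. H y = H x"
    using eventually_at_in_open'[OF W]
  proof eventually_elim
    case (elim y)
    have "integral_vector (H y - H x)"
      using d[OF elim(2)] d[OF W(2)] by (auto simp: H_def intro: Ints_diff)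
    then have "H y - H x = 0" using elim(1) by (intro small_integral_vector) (auto simp: dist_norm)
    then show ?case by simp
  qed
  then have "\<forall>\<^sub>F y in at x. H x = H y" by (simp add: eq_commute)
  then have "(H has_derivative (\<lambda>_. 0)) (at x)"
    by (intro has_derivative_transform_eventually[OF has_derivative_const[of "H x"]]) simp_all
  with H have "(\<lambda>v. A v - B v) = (\<lambda>_. 0)" by (rule has_derivative_unique)
  then show ?thesis by (auto simp: fun_eq_iff)
qed

lemma torus_deriv_eq:
  assumes F: "equivariant F" and D: "(F has_derivative (\<lambda>v. D *v v)) (at x)"
  shows "torus_deriv (torus_map F) (torus_proj x) = D"
  unfolding torus_deriv_def
proof (rule the_equality)
  show "\<exists>x' W F'. torus_proj x' = torus_proj x \<and> x' \<in> W \<and> local_lift (torus_map F) W F' \<and> (F' has_derivative (*v) D) (at x')"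
    using D F by (intro exI[of _ x] exI[of _ UNIV] exI[of _ F]) (auto simp: local_lift_def torus_map_proj)
next
  fix D' assume "\<exists>x' W F'. torus_proj x' = torus_proj x \<and> x' \<in> W \<and> local_lift (torus_map F) W F' \<and> (F' has_derivative (*v) D') (at x')"
  then obtain x' W F' where h: "torus_proj x' = torus_proj x" "x' \<in> W" "open W"
    "\<And>y. y \<in> W \<Longrightarrow> torus_proj (F' y) = torus_map F (torus_proj y)" "(F' has_derivative (*v) D') (at x')"
    by (auto simp: local_lift_def)
  define k where "k = x' - x"
  have k: "integral_vector k" using h(1) by (simp add: torus_proj_eq_iff k_def)
  have x': "x' = k + x" by (simp add: k_def)
  have "((\<lambda>y. F' (k + y)) has_derivative (*v) D') (at x)"
  proof -
    have "((\<lambda>y. k + y) has_derivative (\<lambda>v. v)) (at x)" by (auto intro!: derivative_eq_intros)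
    from has_derivative_compose[OF this h(5)[unfolded x']] show ?thesis .
  qed
  moreover have "integral_vector (F' (k + y) - F y)" if "y \<in> (+) (- k) ` W" for y
  proof -
    have "k + y \<in> W" using that by auto
    then have "torus_proj (F' (k + y)) = torus_proj (F (k + y))" using h(4) F by (simp add: torus_map_proj)
    also have "\<dots> = torus_proj (F y)" using F k by (simp add: torus_proj_eq_iff equivariant_def)
    finally show ?thesis by (simp add: torus_proj_eq_iff)
  qed
  moreover have "open ((+) (- k) ` W)" by (rule open_translation[OF h(3)])
  moreover have "x \<in> (+) (- k) ` W" using h(2) by (intro image_eqI[of _ _ "k + x"]) (simp_all add: x')
  ultimately have "(*v) D' = (*v) D"
    using derivative_unique_mod_integral[of _ x "\<lambda>y. F' (k + y)" _ F] D by blast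
  then show "D' = D" by (simp add: matrix_eq fun_eq_iff)
qed

definition C1_diffeo_pair :: "(real^2 \<Rightarrow> real^2) \<Rightarrow> (real^2 \<Rightarrow> real^2) \<Rightarrow> bool" where
  "C1_diffeo_pair F G \<longleftrightarrow> C1_on UNIV F \<and> C1_on UNIV G \<and> (\<forall>x. G (F x) = x) \<and> (\<forall>x. F (G x) = x)"

lemma C1_on_shift: assumes "C1_on UNIV (G :: real^2 \<Rightarrow> real^2)" shows "C1_on W (\<lambda>y. G (y - k))"
proof -
  obtain G' where G: "\<And>x. (G has_derivative blinfun_apply (G' x)) (at x)" "continuous_on UNIV G'"
    using assms by (auto simp: C1_on_def)
  have "((\<lambda>y. G (y - k)) has_derivative blinfun_apply (G' (x - k))) (at x)" for x
  proof -
    have "((\<lambda>y. y - k) has_derivative (\<lambda>v. v)) (at x)" by (auto intro!: derivative_eq_intros)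
    from has_derivative_compose[OF this G(1)] show ?thesis .
  qed
  moreover have "continuous_on W (\<lambda>y. G' (y - k))"
    by (intro continuous_on_compose2[OF G(2)] continuous_intros) auto
  ultimately show ?thesis unfolding C1_on_def by (intro exI[of _ "\<lambda>y. G' (y - k)"]) simp
qed

text \<open>
  On a ball that the lift maps into a ball of radius \<open>1/2\<close> the torus map is injective, because distinct points of the plane that
  project to the same point have distance at least \<open>1\<close>.
\<close>
lemma C1_local_diffeo_torus_map:
  assumes eq: "equivariant F" and FG: "C1_diffeo_pair F G"
  shows "C1_local_diffeo (torus_map F)"
  unfolding C1_local_diffeo_def
proof
  fix p
  have GF: "G (F x) = x" "F (G x) = x" for x using FG by (simp_all add: C1_diffeo_pair_def)
  have cont: "continuous_on UNIV H" if "C1_on UNIV H" for H :: "real^2 \<Rightarrow> real^2"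
    using that unfolding C1_on_def continuous_on_eq_continuous_at[OF open_UNIV] by (meson has_derivative_continuous UNIV_I)
  have cF: "continuous_on UNIV F" and cG: "continuous_on UNIV G" using FG cont by (simp_all add: C1_diffeo_pair_def)
  define x where "x = torus_rep p"
  have "open (F -` ball (F x) (1/2))" using cF by (intro open_vimage) auto
  moreover have "x \<in> F -` ball (F x) (1/2)" by simp
  ultimately obtain r where r: "r > 0" "ball x r \<subseteq> F -` ball (F x) (1/2)" by (meson open_contains_ball)
  define B where "B = ball x r"
  define U where "U = torus_proj ` B"
  have oB: "open B" by (simp add: B_def)
  have FB: "F ` B = G -` B" using GF by (auto simp: image_iff) (metis GF(2))
  have oFB: "open (F ` B)" unfolding FB using cG oB by (intro open_vimage)
  have fU: "torus_map F ` U = torus_proj ` F ` B" unfolding U_def by (auto simp: torus_map_proj[OF eq] image_iff)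
  have inj: "inj_on (torus_map F) U"
  proof (rule inj_onI)
    fix a b assume "a \<in> U" "b \<in> U" and e: "torus_map F a = torus_map F b"
    then obtain y z where yz: "y \<in> B" "z \<in> B" "a = torus_proj y" "b = torus_proj z" by (auto simp: U_def)
    have "integral_vector (F y - F z)" using e unfolding yz torus_map_proj[OF eq] torus_proj_eq_iff .
    moreover have "dist (F x) (F y) < 1/2" "dist (F x) (F z) < 1/2" using r(2) yz by (auto simp: B_def)
    then have "norm (F y - F z) < 1" using dist_triangle3[of "F y" "F z" "F x"] by (simp add: dist_norm)
    ultimately have "F y = F z" using small_integral_vector[of "F y - F z"] by simp
    then have "y = z" using GF(1) by metis
    then show "a = b" using yz by simp
  qed
  have C1f: "torus_C1_on U (torus_map F)"
    unfolding torus_C1_on_def local_lift_def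
    using FG eq by (auto intro!: exI[of _ UNIV] exI[of _ F] simp: torus_map_proj C1_diffeo_pair_def)
  have C1g: "torus_C1_on (torus_map F ` U) (inv_into U (torus_map F))"
    unfolding torus_C1_on_def
  proof (intro allI impI)
    fix y assume "torus_proj y \<in> torus_map F ` U"
    then obtain z where z: "z \<in> B" "integral_vector (y - F z)" unfolding fU by (auto simp: torus_proj_eq_iff)
    define k where "k = y - F z"
    define W where "W = (+) k ` F ` B"
    have "open W" unfolding W_def by (rule open_translation[OF oFB])
    moreover have "y \<in> W" unfolding W_def using z(1) by (auto simp: k_def image_iff intro!: bexI[of _ z])
    moreover have "torus_proj (G (a - k)) = inv_into U (torus_map F) (torus_proj a)" if aW: "a \<in> W" for a
    proof -
      obtain b where b: "b \<in> B" "a = k + F b" using aW unfolding W_def by blast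
      have "torus_proj a = torus_proj (F b)" using z(2) unfolding torus_proj_eq_iff b(2) k_def by simp
      also have "\<dots> = torus_map F (torus_proj b)" by (simp add: torus_map_proj[OF eq])
      finally have "inv_into U (torus_map F) (torus_proj a) = torus_proj b"
        using inj b(1) by (simp add: U_def inv_into_f_f)
      then show ?thesis by (simp add: b(2) GF)
    qed
    moreover have "C1_on W (\<lambda>a. G (a - k))" using FG by (intro C1_on_shift) (simp add: C1_diffeo_pair_def)
    ultimately show "\<exists>W Fa. y \<in> W \<and> local_lift (inv_into U (torus_map F)) W Fa \<and> C1_on W Fa"
      unfolding local_lift_def by (intro exI[of _ W] exI[of _ "\<lambda>a. G (a - k)"] conjI ballI)
  qed
  have "p \<in> U" unfolding U_def B_def using r(1) by (intro image_eqI[of _ _ x]) (auto simp: x_def)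
  moreover have "open U" unfolding U_def by (rule open_torus_proj_image[OF oB])
  moreover have "open (torus_map F ` U)" unfolding fU by (rule open_torus_proj_image[OF oFB])
  ultimately show "\<exists>U. open U \<and> p \<in> U \<and> open (torus_map F ` U) \<and> inj_on (torus_map F) U \<and>
       torus_C1_on U (torus_map F) \<and> torus_C1_on (torus_map F ` U) (inv_into U (torus_map F))"
    using inj C1f C1g by (intro exI[of _ U] conjI)
qed

section \<open>Preservation of Lebesgue measure\<close>

definition unit_cube :: "'a::euclidean_space set" where
  "unit_cube = {x. \<forall>b\<in>Basis. 0 \<le> x \<bullet> b \<and> x \<bullet> b < 1}"

definition lattice :: "'a::euclidean_space set" where
  "lattice = {k. \<forall>b\<in>Basis. k \<bullet> b \<in> \<int>}"

definition floor_vec :: "'a::euclidean_space \<Rightarrow> 'a" where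
  "floor_vec x = (\<Sum>b\<in>Basis. of_int \<lfloor>x \<bullet> b\<rfloor> *\<^sub>R b)"

lemma floor_vec_inner: "b \<in> Basis \<Longrightarrow> floor_vec x \<bullet> b = of_int \<lfloor>x \<bullet> b\<rfloor>"
  by (simp add: floor_vec_def)

lemma floor_vec_lattice: "floor_vec x \<in> lattice"
  by (simp add: lattice_def floor_vec_inner)

lemma minus_floor_vec_cube: "x - floor_vec x \<in> unit_cube"
  by (auto simp: unit_cube_def floor_vec_inner inner_diff_left) linarith+

lemma floor_vec_unique: assumes "k \<in> lattice" "x - k \<in> unit_cube" shows "k = floor_vec x"
proof (rule euclidean_eqI)
  fix b :: 'a assume b: "b \<in> Basis"
  from assms(1) b obtain n where n: "k \<bullet> b = of_int n" by (auto simp: lattice_def elim: Ints_cases)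
  have "0 \<le> x \<bullet> b - of_int n" "x \<bullet> b - of_int n < 1" using assms(2) b n by (auto simp: unit_cube_def inner_diff_left)
  then have "\<lfloor>x \<bullet> b\<rfloor> = n" by linarith
  then show "k \<bullet> b = floor_vec x \<bullet> b" using b n by (simp add: floor_vec_inner)
qed

lemma countable_lattice: "countable (lattice :: 'a::euclidean_space set)"
proof -
  let ?g = "\<lambda>f :: 'a \<Rightarrow> int. \<Sum>b\<in>Basis. of_int (f b) *\<^sub>R b"
  have "(lattice :: 'a set) \<subseteq> ?g ` (Basis \<rightarrow>\<^sub>E UNIV)"
  proof
    fix k :: 'a assume k: "k \<in> lattice"
    have "?g (\<lambda>b\<in>Basis. \<lfloor>k \<bullet> b\<rfloor>) = floor_vec k" unfolding floor_vec_def by (intro sum.cong) auto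
    also have "\<dots> = k" using floor_vec_unique[OF k, of k] by (simp add: unit_cube_def)
    finally have f: "?g (\<lambda>b\<in>Basis. \<lfloor>k \<bullet> b\<rfloor>) = k" .
    have "(\<lambda>b\<in>Basis. \<lfloor>k \<bullet> b\<rfloor>) \<in> Basis \<rightarrow>\<^sub>E UNIV" by simp
    from imageI[OF this, of ?g] show "k \<in> ?g ` (Basis \<rightarrow>\<^sub>E UNIV)" unfolding f .
  qed
  moreover have "countable (Basis \<rightarrow>\<^sub>E (UNIV :: int set))" by (intro countable_PiE) auto
  ultimately show ?thesis by (rule countable_subset[OF _ countable_image])
qed

lemma unit_cube_borel [measurable]: "unit_cube \<in> sets borel"
proof -
  have "unit_cube = (\<Inter>b\<in>Basis. {x :: 'a. 0 \<le> x \<bullet> b} \<inter> {x. x \<bullet> b < 1})" by (auto simp: unit_cube_def)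
  also have "\<dots> \<in> sets borel" by (intro sets.finite_INT) auto
  finally show ?thesis .
qed

definition periodic_set :: "'a::euclidean_space set \<Rightarrow> bool" where
  "periodic_set S \<longleftrightarrow> (\<forall>k\<in>lattice. \<forall>x. x + k \<in> S \<longleftrightarrow> x \<in> S)"

text \<open>
  Cut the translated cube into its pieces in the lattice translates of the cube and move each piece back.
\<close>
lemma emeasure_cube_translate:
  fixes S :: "'a::euclidean_space set"
  assumes S [measurable]: "S \<in> sets borel" and per: "periodic_set S"
  shows "emeasure lborel {x \<in> unit_cube. x + a \<in> S} = emeasure lborel {x \<in> unit_cube. x \<in> S}"
proof -
  define X where "X k = {x \<in> unit_cube. x + a \<in> S \<and> x + a - k \<in> unit_cube}" for k
  define Y where "Y k = {x \<in> unit_cube. x \<in> S \<and> x + k - a \<in> unit_cube}" for k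
  have X [measurable]: "X k \<in> sets borel" for k unfolding X_def by measurable
  have Y [measurable]: "Y k \<in> sets borel" for k unfolding Y_def by measurable
  have eq: "emeasure lborel (X k) = emeasure lborel (Y k)" if "k \<in> lattice" for k
  proof -
    have "(+) (a - k) -` Y k = X k"
    proof -
      have "(a - k) + x \<in> S \<longleftrightarrow> x + a \<in> S" for x
        using per that bspec[OF per[unfolded periodic_set_def] that] by (metis add.commute add_diff_eq diff_add_cancel)
      then show ?thesis by (auto simp: X_def Y_def algebra_simps)
    qed
    then have "emeasure lborel (X k) = emeasure (distr lborel borel ((+) (a - k))) (Y k)"
      by (subst emeasure_distr) auto
    then show ?thesis by (simp add: lborel_distr_plus)
  qed
  have "{x \<in> unit_cube. x + a \<in> S} = (\<Union>k\<in>lattice. X k)"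
    using floor_vec_lattice minus_floor_vec_cube by (fastforce simp: X_def)
  moreover have "disjoint_family_on X lattice"
    unfolding disjoint_family_on_def using floor_vec_unique by (auto simp: X_def)
  ultimately have 1: "emeasure lborel {x \<in> unit_cube. x + a \<in> S} = (\<integral>\<^sup>+k. emeasure lborel (X k) \<partial>count_space lattice)"
    using emeasure_UN_countable[of lattice X lborel] countable_lattice by simp
  have Yc: "x \<in> Y k \<longleftrightarrow> x \<in> unit_cube \<and> x \<in> S \<and> (x - a) - (- k) \<in> unit_cube" for x k by (auto simp: Y_def algebra_simps)
  have neg: "- k \<in> lattice \<longleftrightarrow> k \<in> lattice" for k :: 'a by (auto simp: lattice_def)
  have "{x \<in> unit_cube. x \<in> S} = (\<Union>k\<in>lattice. Y k)"
  proof (intro set_eqI iffI)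
    fix x assume "x \<in> {x \<in> unit_cube. x \<in> S}"
    then have "x \<in> Y (- floor_vec (x - a))" using minus_floor_vec_cube[of "x - a"] by (simp add: Yc)
    then show "x \<in> (\<Union>k\<in>lattice. Y k)" using floor_vec_lattice neg by blast
  qed (auto simp: Y_def)
  moreover have "disjoint_family_on Y lattice"
    unfolding disjoint_family_on_def
  proof (intro ballI impI)
    fix k l assume kl: "k \<in> lattice" "l \<in> lattice" "k \<noteq> (l :: 'a)"
    have False if "x \<in> Y k" "x \<in> Y l" for x
    proof -
      have "- k = floor_vec (x - a)" "- l = floor_vec (x - a)" using that kl by (intro floor_vec_unique; simp add: Yc neg)+
      then have "- k = - l" by (simp only:)
      then show False using kl(3) by simp
    qed
    then show "Y k \<inter> Y l = {}" by blast
  qed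
  ultimately have 2: "emeasure lborel {x \<in> unit_cube. x \<in> S} = (\<integral>\<^sup>+k. emeasure lborel (Y k) \<partial>count_space lattice)"
    using emeasure_UN_countable[of lattice Y lborel] countable_lattice by simp
  show ?thesis unfolding 1 2 by (intro nn_integral_cong) (simp add: eq)
qed

lemma emeasure_unit_cube: "emeasure lborel (unit_cube :: 'a::euclidean_space set) \<noteq> 0" "emeasure lborel (unit_cube :: 'a set) \<noteq> \<infinity>"
proof -
  have "box 0 One \<subseteq> (unit_cube :: 'a set)" by (auto simp: unit_cube_def mem_box less_imp_le)
  then have "emeasure lborel (box 0 One :: 'a set) \<le> emeasure lborel (unit_cube :: 'a set)" by (intro emeasure_mono) auto
  then show "emeasure lborel (unit_cube :: 'a set) \<noteq> 0" by (auto simp: emeasure_lborel_box_eq)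
  have "(unit_cube :: 'a set) \<subseteq> cbox 0 One" by (auto simp: unit_cube_def mem_box less_imp_le)
  then have "emeasure lborel (unit_cube :: 'a set) \<le> emeasure lborel (cbox 0 One :: 'a set)" by (intro emeasure_mono) auto
  also have "\<dots> < \<infinity>" by (simp add: emeasure_lborel_cbox_eq)
  finally show "emeasure lborel (unit_cube :: 'a set) \<noteq> \<infinity>" by simp
qed

text \<open>
  Invariance of the measure under a map is proved by averaging over a family of translations that the map carries into
  one another: both averages compute the same double integral, in the two possible orders. \<open>P\<close> describes the translated
  preimage and \<open>A\<close> the translated set.
\<close>
lemma Fubini_averaging:
  fixes P :: "('a::euclidean_space \<times> 'b::euclidean_space) set" and A :: "'a \<Rightarrow> 'b set"
  assumes P [measurable]: "Measurable.pred (borel \<Otimes>\<^sub>M borel) (\<lambda>z. z \<in> P)"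
    and 1: "\<And>x. x \<in> unit_cube \<Longrightarrow> emeasure lborel {y \<in> unit_cube. (x,y) \<in> P} = emeasure lborel {y \<in> unit_cube. y \<in> A x}"
    and 2: "\<And>y. y \<in> unit_cube \<Longrightarrow> emeasure lborel {x \<in> unit_cube. (x,y) \<in> P} = J"
    and 3: "\<And>y. y \<in> unit_cube \<Longrightarrow> emeasure lborel {x \<in> unit_cube. y \<in> A x} = J'"
    and A [measurable]: "Measurable.pred (borel \<Otimes>\<^sub>M borel) (\<lambda>(x,y). y \<in> A x)"
  shows "J = J'"
proof -
  have swap: "emeasure lborel (unit_cube :: 'b set) * K = (\<integral>\<^sup>+x. indicator unit_cube x * emeasure lborel {y \<in> unit_cube. (x,y) \<in> R} \<partial>lborel)"
    if R [measurable]: "Measurable.pred (borel \<Otimes>\<^sub>M borel) (\<lambda>z. z \<in> R)"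
      and K: "\<And>y. y \<in> unit_cube \<Longrightarrow> emeasure lborel {x \<in> unit_cube. (x,y) \<in> R} = K" for R :: "('a \<times> 'b) set" and K
  proof -
    have "Measurable.pred (borel \<Otimes>\<^sub>M borel) (\<lambda>z :: 'a \<times> 'b. fst z \<in> unit_cube \<and> snd z \<in> unit_cube \<and> z \<in> R)" by measurable
    then have m: "{z. fst z \<in> unit_cube \<and> snd z \<in> unit_cube \<and> z \<in> R} \<in> sets (lborel \<Otimes>\<^sub>M lborel)"
      by (simp add: pred_def space_pair_measure cong: sets_pair_measure_cong)
    define Z where "Z = {z :: 'a \<times> 'b. fst z \<in> unit_cube \<and> snd z \<in> unit_cube \<and> z \<in> R}"
    have Z: "Z \<in> sets (lborel \<Otimes>\<^sub>M lborel)" using m unfolding Z_def .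
    have "emeasure (lborel \<Otimes>\<^sub>M lborel) Z = (\<integral>\<^sup>+x. emeasure lborel (Pair x -` Z) \<partial>lborel)"
      by (rule lborel.emeasure_pair_measure_alt[OF Z])
    also have "\<dots> = (\<integral>\<^sup>+x. indicator unit_cube x * emeasure lborel {y \<in> unit_cube. (x,y) \<in> R} \<partial>lborel)"
      by (intro nn_integral_cong) (auto simp: Z_def indicator_def vimage_def intro!: arg_cong[of _ _ "emeasure lborel"])
    finally have l: "emeasure (lborel \<Otimes>\<^sub>M lborel) Z = \<dots>" .
    have "emeasure (lborel \<Otimes>\<^sub>M lborel) Z = (\<integral>\<^sup>+y. emeasure lborel ((\<lambda>x. (x, y)) -` Z) \<partial>lborel)"
      by (rule lborel_pair.emeasure_pair_measure_alt2[OF Z])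
    also have "\<dots> = (\<integral>\<^sup>+y. K * indicator (unit_cube :: 'b set) y \<partial>lborel)"
    proof (intro nn_integral_cong)
      fix y :: 'b
      show "emeasure lborel ((\<lambda>x. (x, y)) -` Z) = K * indicator unit_cube y"
      proof (cases "y \<in> unit_cube")
        case True
        then have "(\<lambda>x. (x, y)) -` Z = {x \<in> unit_cube. (x,y) \<in> R}" by (auto simp: Z_def)
        then show ?thesis using K[OF True] True by simp
      next
        case False
        then have "(\<lambda>x. (x, y)) -` Z = {}" by (auto simp: Z_def)
        then show ?thesis using False by simp
      qed
    qed
    also have "\<dots> = K * emeasure lborel (unit_cube :: 'b set)" by (simp add: nn_integral_cmult)
    finally show ?thesis using l by (simp add: mult.commute)
  qed
  have "emeasure lborel (unit_cube :: 'b set) * J = (\<integral>\<^sup>+x. indicator unit_cube x * emeasure lborel {y \<in> unit_cube. (x,y) \<in> P} \<partial>lborel)"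
    by (rule swap[OF P 2])
  also have "\<dots> = (\<integral>\<^sup>+x. indicator unit_cube x * emeasure lborel {y \<in> unit_cube. (x,y) \<in> {(x,y). y \<in> A x}} \<partial>(lborel :: 'a measure))"
    by (intro nn_integral_cong) (auto simp: indicator_def 1)
  also have "\<dots> = emeasure lborel (unit_cube :: 'b set) * J'"
    by (rule swap[symmetric]) (use A 3 in \<open>simp_all add: case_prod_unfold\<close>)
  finally show ?thesis using emeasure_unit_cube[where 'a = 'b] by (metis ennreal_mult_cancel_left infinity_ennreal_def)
qed

lemma lattice_iff_integral: "k \<in> lattice \<longleftrightarrow> integral_vector k"
  by (auto simp: lattice_def Basis_vec_def inner_axis)

lemma unit_cube_vec: "unit_cube = {x :: real^2. \<forall>i. 0 \<le> x $ i \<and> x $ i < 1}"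
  by (auto simp: unit_cube_def Basis_vec_def inner_axis)

text \<open>
  Preservation of Haar measure on the torus, expressed on the fundamental domain for lifts.
\<close>
definition preserves_lebesgue :: "(real^2 \<Rightarrow> real^2) \<Rightarrow> bool" where
  "preserves_lebesgue F \<longleftrightarrow> F \<in> borel_measurable borel \<and>
     (\<forall>S\<in>sets borel. periodic_set S \<longrightarrow>
        emeasure lborel {x \<in> unit_cube. F x \<in> S} = emeasure lborel {x \<in> unit_cube. x \<in> S})"

lemma periodic_vimage: assumes "equivariant F" "periodic_set S" shows "periodic_set (F -` S)"
  unfolding periodic_set_def
proof (intro ballI allI)
  fix k x :: "real^2" assume "k \<in> lattice"
  then have "F (x + k) - F x \<in> lattice" using assms(1) by (simp add: lattice_iff_integral equivariant_def)
  then have "F x + (F (x + k) - F x) \<in> S \<longleftrightarrow> F x \<in> S" using assms(2) unfolding periodic_set_def by blast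
  then show "x + k \<in> F -` S \<longleftrightarrow> x \<in> F -` S" by simp
qed

lemma preserves_lebesgue_compose:
  assumes F: "preserves_lebesgue F" "equivariant F" and G: "preserves_lebesgue G"
  shows "preserves_lebesgue (F \<circ> G)"
  unfolding preserves_lebesgue_def
proof (intro conjI ballI impI)
  have [measurable]: "F \<in> borel_measurable borel" "G \<in> borel_measurable borel" using F G by (simp_all add: preserves_lebesgue_def)
  show "F \<circ> G \<in> borel_measurable borel" by measurable
  fix S :: "(real^2) set" assume S [measurable]: "S \<in> sets borel" and p: "periodic_set S"
  have m: "F -` S \<in> sets borel" using measurable_sets[of F borel borel S] by simp
  have "emeasure lborel {x \<in> unit_cube. (F \<circ> G) x \<in> S} = emeasure lborel {x \<in> unit_cube. G x \<in> F -` S}" by simp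
  also have "\<dots> = emeasure lborel {x \<in> unit_cube. x \<in> F -` S}"
    using G m periodic_vimage[OF F(2) p] unfolding preserves_lebesgue_def by blast
  also have "\<dots> = emeasure lborel {x \<in> unit_cube. x \<in> S}"
    using F(1) S p unfolding preserves_lebesgue_def by simp
  finally show "emeasure lborel {x \<in> unit_cube. (F \<circ> G) x \<in> S} = emeasure lborel {x \<in> unit_cube. x \<in> S}" .
qed

text \<open>
  Averaging over all translations: a translation of the image by \<open>y\<close> is the image of the translation by \<open>N y\<close>.
\<close>
lemma preserves_lebesgue_linear:
  fixes M N :: "real^2^2"
  assumes eq: "equivariant ((*v) M)" and inv: "M ** N = mat 1"
  shows "preserves_lebesgue ((*v) M)"
  unfolding preserves_lebesgue_def
proof (intro conjI ballI impI)
  have cont: "continuous_on UNIV ((*v) M)" by (intro linear_continuous_on matrix_vector_mul_bounded_linear)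
  then show mM [measurable]: "(*v) M \<in> borel_measurable borel" by (rule borel_measurable_continuous_onI)
  fix S :: "(real^2) set" assume S [measurable]: "S \<in> sets borel" and p: "periodic_set S"
  have m: "(*v) M -` S \<in> sets borel" using measurable_sets[OF mM S] by simp
  show "emeasure lborel {x \<in> unit_cube. M *v x \<in> S} = emeasure lborel {x \<in> unit_cube. x \<in> S}"
  proof (rule Fubini_averaging[where P = "{(x,y). y + M *v x \<in> S}" and A = "\<lambda>x. {y. y + x \<in> S}"])
    show "Measurable.pred (borel \<Otimes>\<^sub>M borel) (\<lambda>z :: (real^2) \<times> (real^2). z \<in> {(x,y). y + M *v x \<in> S})"
      unfolding mem_Collect_eq case_prod_unfold by measurable
    show "Measurable.pred (borel \<Otimes>\<^sub>M borel) (\<lambda>(x :: real^2, y). y \<in> {y. y + x \<in> S})"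
      unfolding mem_Collect_eq case_prod_unfold by measurable
    fix x :: "real^2"
    show "emeasure lborel {y \<in> unit_cube. (x, y) \<in> {(x,y). y + M *v x \<in> S}} = emeasure lborel {y \<in> unit_cube. y \<in> {y. y + x \<in> S}}"
      using emeasure_cube_translate[OF S p, of "M *v x"] emeasure_cube_translate[OF S p, of x] by simp
  next
    fix y :: "real^2"
    have "M *v (x + N *v y) = y + M *v x" for x
      by (simp add: matrix_vector_right_distrib matrix_vector_mul_assoc inv add.commute)
    then show "emeasure lborel {x \<in> unit_cube. (x, y) \<in> {(x,y). y + M *v x \<in> S}} = emeasure lborel {x \<in> unit_cube. M *v x \<in> S}"
      using emeasure_cube_translate[OF m periodic_vimage[OF eq p], of "N *v y"] by simp
    show "emeasure lborel {x \<in> unit_cube. y \<in> {y. y + x \<in> S}} = emeasure lborel {x \<in> unit_cube. x \<in> S}"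
      using emeasure_cube_translate[OF S p, of y] by (simp add: add.commute)
  qed
qed

definition shear :: "real^2 \<Rightarrow> real^2 \<Rightarrow> (real \<Rightarrow> real) \<Rightarrow> real^2 \<Rightarrow> real^2" where
  "shear a b \<phi> x = x + \<phi> (b \<bullet> x) *\<^sub>R a"

lemma inner_integral: "integral_vector a \<Longrightarrow> integral_vector (b :: real^2) \<Longrightarrow> a \<bullet> b \<in> \<int>"
  by (simp add: inner_vec_def sum_2)

lemma integer_period: fixes \<phi> :: "real \<Rightarrow> real" assumes "\<And>u. \<phi> (u + 1) = \<phi> u" "n \<in> \<int>" shows "\<phi> (u + n) = \<phi> u"
proof -
  have nat: "\<phi> (u + real m) = \<phi> u" for m u
  proof (induction m arbitrary: u)
    case (Suc m)
    have "\<phi> (u + real (Suc m)) = \<phi> ((u + real m) + 1)" by (simp add: algebra_simps)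
    then show ?case using assms(1) Suc by simp
  qed simp
  obtain k where k: "n = of_int k" using assms(2) by (rule Ints_cases)
  show ?thesis
  proof (cases "k \<ge> 0")
    case True
    then have "n = real (nat k)" by (simp add: k)
    then show ?thesis using nat by simp
  next
    case False
    then have "u = (u + n) + real (nat (- k))" by (simp add: k)
    then show ?thesis using nat by metis
  qed
qed

lemma equivariant_shear:
  assumes "integral_vector a" "integral_vector b" and per: "\<And>u. \<phi> (u + 1) = \<phi> u"
  shows "equivariant (shear a b \<phi>)"
  unfolding equivariant_def
proof (intro allI impI)
  fix x y :: "real^2" and i assume k: "integral_vector (x - y)"
  have "b \<bullet> (x - y) \<in> \<int>" by (rule inner_integral[OF assms(2) k])
  from integer_period[of \<phi>, OF per this, of "b \<bullet> y"] have "\<phi> (b \<bullet> x) = \<phi> (b \<bullet> y)" by (simp add: inner_diff_right)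
  then have "shear a b \<phi> x - shear a b \<phi> y = x - y" by (simp add: shear_def)
  then show "(shear a b \<phi> x - shear a b \<phi> y) $ i \<in> \<int>" using k by simp
qed

text \<open>
  Averaging over translations along the shear direction, with which the shear commutes.
\<close>
lemma preserves_lebesgue_shear:
  assumes ab: "integral_vector a" "integral_vector b" "b \<bullet> a = 0" and per: "\<And>u. \<phi> (u + 1) = \<phi> u"
    and cont: "continuous_on UNIV \<phi>"
  shows "preserves_lebesgue (shear a b \<phi>)"
  unfolding preserves_lebesgue_def
proof (intro conjI ballI impI)
  note eq = equivariant_shear[OF ab(1,2), of \<phi>, OF per]
  have "continuous_on UNIV (shear a b \<phi>)" unfolding shear_def
    by (intro continuous_intros continuous_on_compose2[OF cont]) auto
  then show m [measurable]: "shear a b \<phi> \<in> borel_measurable borel" by (rule borel_measurable_continuous_onI)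
  fix S :: "(real^2) set" assume S [measurable]: "S \<in> sets borel" and p: "periodic_set S"
  have mS: "shear a b \<phi> -` S \<in> sets borel" using measurable_sets[OF m S] by simp
  show "emeasure lborel {x \<in> unit_cube. shear a b \<phi> x \<in> S} = emeasure lborel {x \<in> unit_cube. x \<in> S}"
  proof (rule Fubini_averaging[where P = "{(x,s::real). shear a b \<phi> x + s *\<^sub>R a \<in> S}" and A = "\<lambda>x. {s. x + s *\<^sub>R a \<in> S}"])
    show "Measurable.pred (borel \<Otimes>\<^sub>M borel) (\<lambda>z :: (real^2) \<times> real. z \<in> {(x,s::real). shear a b \<phi> x + s *\<^sub>R a \<in> S})"
      unfolding mem_Collect_eq case_prod_unfold by measurable
    show "Measurable.pred (borel \<Otimes>\<^sub>M borel) (\<lambda>(x :: real^2, s). s \<in> {s. x + s *\<^sub>R a \<in> S})"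
      unfolding mem_Collect_eq case_prod_unfold by measurable
    fix x :: "real^2"
    have c: "continuous_on UNIV (\<lambda>s. x + s *\<^sub>R a)" by (intro continuous_intros)
    have "(\<lambda>s. x + s *\<^sub>R a) -` S \<in> sets borel"
      using measurable_sets[OF borel_measurable_continuous_onI[OF c] S] by simp
    moreover have "periodic_set ((\<lambda>s. x + s *\<^sub>R a) -` S)"
      unfolding periodic_set_def
    proof (intro ballI allI)
      fix n s :: real assume "n \<in> lattice"
      then have "n *\<^sub>R a \<in> lattice" using ab(1) by (simp add: lattice_iff_integral) (simp add: lattice_def)
      then have "(x + s *\<^sub>R a) + n *\<^sub>R a \<in> S \<longleftrightarrow> x + s *\<^sub>R a \<in> S" using p unfolding periodic_set_def by blast
      then show "s + n \<in> (\<lambda>s. x + s *\<^sub>R a) -` S \<longleftrightarrow> s \<in> (\<lambda>s. x + s *\<^sub>R a) -` S" by (simp add: scaleR_add_left add.assoc)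
    qed
    ultimately have "emeasure lborel {s \<in> unit_cube. s + \<phi> (b \<bullet> x) \<in> (\<lambda>s. x + s *\<^sub>R a) -` S} = emeasure lborel {s \<in> unit_cube. s \<in> (\<lambda>s. x + s *\<^sub>R a) -` S}"
      by (rule emeasure_cube_translate)
    then show "emeasure lborel {s \<in> unit_cube. (x, s) \<in> {(x,s::real). shear a b \<phi> x + s *\<^sub>R a \<in> S}} = emeasure lborel {s \<in> unit_cube. s \<in> {s. x + s *\<^sub>R a \<in> S}}"
      by (simp add: shear_def scaleR_add_left algebra_simps)
  next
    fix s :: real
    have "shear a b \<phi> (x + s *\<^sub>R a) = shear a b \<phi> x + s *\<^sub>R a" for x
      using ab(3) by (simp add: shear_def inner_add_right)
    then show "emeasure lborel {x \<in> unit_cube. (x, s) \<in> {(x,s::real). shear a b \<phi> x + s *\<^sub>R a \<in> S}} = emeasure lborel {x \<in> unit_cube. shear a b \<phi> x \<in> S}"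
      using emeasure_cube_translate[OF mS periodic_vimage[OF eq p], of "s *\<^sub>R a"] by simp
    show "emeasure lborel {x \<in> unit_cube. s \<in> {s. x + s *\<^sub>R a \<in> S}} = emeasure lborel {x \<in> unit_cube. x \<in> S}"
      using emeasure_cube_translate[OF S p, of "s *\<^sub>R a"] by simp
  qed
qed

lemma torus_proj_measurable: "torus_proj \<in> borel_measurable borel"
proof (rule borel_measurable_continuous_onI)
  show "continuous_on UNIV torus_proj"
    unfolding continuous_on_open_vimage[OF open_UNIV] by (simp add: open_torus_def)
qed

lemma emeasure_torus_measure:
  assumes "A \<in> sets borel"
  shows "emeasure torus_measure A = emeasure lborel {x \<in> unit_cube. x \<in> torus_proj -` A}"
proof -
  have Q: "{x :: real^2. \<forall>i. 0 \<le> x $ i \<and> x $ i < 1} = unit_cube" by (simp add: unit_cube_vec)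
  have "torus_proj \<in> borel_measurable lborel" using torus_proj_measurable by simp
  then have "torus_proj \<in> borel_measurable (restrict_space lborel unit_cube)" by (rule measurable_restrict_space1)
  then have "emeasure torus_measure A = emeasure (restrict_space lborel unit_cube) (torus_proj -` A \<inter> space (restrict_space lborel unit_cube))"
    unfolding torus_measure_def Q using assms by (rule emeasure_distr)
  also have "torus_proj -` A \<inter> space (restrict_space lborel unit_cube) = {x \<in> unit_cube. x \<in> torus_proj -` A}"
    by (auto simp: space_restrict_space)
  also have "emeasure (restrict_space lborel unit_cube) \<dots> = emeasure lborel \<dots>"
    by (rule emeasure_restrict_space) auto
  finally show ?thesis .
qed

lemma torus_map_preserves_measure:
  assumes eq: "equivariant F" and pres: "preserves_lebesgue F" and cont: "continuous_on UNIV F"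
  shows "torus_map F \<in> measurable torus_measure torus_measure" "distr torus_measure torus_measure (torus_map F) = torus_measure"
proof -
  have sets: "sets torus_measure = sets borel" by (simp add: torus_measure_def)
  have "continuous_on UNIV (torus_map F)"
    unfolding continuous_on_open_vimage[OF open_UNIV]
  proof (intro allI impI)
    fix U :: "torus set" assume "open U"
    then have "open (torus_proj -` U)" by (simp add: open_torus_def)
    then have "open (F -` (torus_proj -` U))" using cont unfolding continuous_on_open_vimage[OF open_UNIV] by simp
    moreover have "torus_proj -` (torus_map F -` U \<inter> UNIV) = F -` (torus_proj -` U)"
      by (auto simp: torus_map_proj[OF eq])
    ultimately show "open (torus_map F -` U \<inter> UNIV)" unfolding open_torus_def by simp
  qed
  then have m: "torus_map F \<in> borel_measurable borel" by (rule borel_measurable_continuous_onI)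
  then show m': "torus_map F \<in> measurable torus_measure torus_measure"
    using measurable_cong_sets[OF sets sets] by blast
  show "distr torus_measure torus_measure (torus_map F) = torus_measure"
  proof (rule measure_eqI)
    fix A assume "A \<in> sets (distr torus_measure torus_measure (torus_map F))"
    then have A: "A \<in> sets torus_measure" "A \<in> sets borel" using sets by simp_all
    have sp: "space torus_measure = UNIV" by (simp add: torus_measure_def)
    have pA: "torus_map F -` A \<in> sets borel" using measurable_sets[OF m A(2)] by simp
    have SA: "torus_proj -` A \<in> sets borel" using measurable_sets[OF torus_proj_measurable A(2)] by simp
    have per: "periodic_set (torus_proj -` A)"
    proof -
      have "torus_proj (x + k) = torus_proj x" if "k \<in> lattice" for x k
        using that by (simp add: torus_proj_eq_iff lattice_iff_integral)
      then show ?thesis unfolding periodic_set_def by simp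
    qed
    have "emeasure (distr torus_measure torus_measure (torus_map F)) A = emeasure torus_measure (torus_map F -` A)"
      using emeasure_distr[OF m' A(1)] sp by simp
    also have "\<dots> = emeasure lborel {x \<in> unit_cube. F x \<in> torus_proj -` A}"
      unfolding emeasure_torus_measure[OF pA] by (simp add: torus_map_proj[OF eq])
    also have "\<dots> = emeasure torus_measure A"
      unfolding emeasure_torus_measure[OF A(2)] using pres SA per unfolding preserves_lebesgue_def by blast
    finally show "emeasure (distr torus_measure torus_measure (torus_map F)) A = emeasure torus_measure A" .
  qed simp
qed

section \<open>Positive exponents from a potential with drift\<close>

lemma matrix_inv_eqI:
  fixes A B :: "real^'n^'n" assumes "A ** B = mat 1" shows "matrix_inv A = B"
proof -
  have BA: "B ** A = mat 1" using assms by (simp add: matrix_left_right_inverse)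
  then have ex: "\<exists>A'. A ** A' = mat 1 \<and> A' ** A = mat 1" using assms by blast
  then have "A ** matrix_inv A = mat 1 \<and> matrix_inv A ** A = mat 1" unfolding matrix_inv_def by (rule someI_ex)
  then have "matrix_inv A = matrix_inv A ** (A ** B)" "matrix_inv A ** A = mat 1" using assms by simp_all
  then show ?thesis by (metis matrix_mul_assoc matrix_mul_lid)
qed

text \<open>
  A torus map given by a lift \<open>F\<close> whose derivative has a determinant of constant modulus and whose fibres are enumerated by lifts \<open>Y x i\<close>.
\<close>
locale lifted_covering =
  fixes F :: "real^2 \<Rightarrow> real^2" and A Ai :: "real^2 \<Rightarrow> real^2^2" and d :: nat
    and I :: "'i set" and Y :: "real^2 \<Rightarrow> 'i \<Rightarrow> real^2"
  assumes equivariant: "equivariant F"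
    and derivative: "\<And>x. (F has_derivative (\<lambda>v. A x *v v)) (at x)"
    and inverse: "\<And>x. A x ** Ai x = mat 1"
    and det: "\<And>x. \<bar>det (A x)\<bar> = real d"
    and finite_I: "finite I" and card_I: "card I = d" and d_pos: "d \<ge> 1"
    and fibre_inj: "\<And>x. inj_on (\<lambda>i. torus_proj (Y x i)) I"
    and fibre: "\<And>x. torus_map F -` {torus_proj x} = (\<lambda>i. torus_proj (Y x i)) ` I"
begin

abbreviation f where "f \<equiv> torus_map F"

lemma deriv_iterate: "\<exists>D. (F ^^ n has_derivative (\<lambda>v. D *v v)) (at x) \<and> torus_deriv (f ^^ n) (torus_proj x) = D"
proof (induction n arbitrary: x)
  case 0
  have "(F ^^ 0 has_derivative (\<lambda>v. mat 1 *v v)) (at x)" by (simp add: id_def)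
  then show ?case using torus_deriv_eq[OF equivariant_funpow[OF equivariant, of 0]] torus_map_funpow[OF equivariant] by metis
next
  case (Suc n)
  obtain D where D: "(F ^^ n has_derivative (\<lambda>v. D *v v)) (at (F x))" using Suc by blast
  have "((\<lambda>y. (F ^^ n) (F y)) has_derivative (\<lambda>v. D *v (A x *v v))) (at x)"
    by (rule has_derivative_compose[OF derivative D])
  then have "(F ^^ Suc n has_derivative (\<lambda>v. (D ** A x) *v v)) (at x)"
    by (simp add: funpow_Suc_right comp_def matrix_vector_mul_assoc del: funpow.simps)
  then show ?case using torus_deriv_eq[OF equivariant_funpow[OF equivariant, of "Suc n"]] torus_map_funpow[OF equivariant] by metis
qed

lemma torus_deriv_one: "torus_deriv f (torus_proj x) = A x"
  by (rule torus_deriv_eq[OF equivariant derivative])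

lemma torus_deriv_Suc: "torus_deriv (f ^^ Suc n) p = torus_deriv (f ^^ n) (f p) ** torus_deriv f p"
proof -
  obtain x where p: "p = torus_proj x" by (rule torus_exhaust)
  obtain D where D: "(F ^^ n has_derivative (\<lambda>v. D *v v)) (at (F x))" "torus_deriv (f ^^ n) (torus_proj (F x)) = D"
    using deriv_iterate by blast
  have "((\<lambda>y. (F ^^ n) (F y)) has_derivative (\<lambda>v. D *v (A x *v v))) (at x)"
    by (rule has_derivative_compose[OF derivative D(1)])
  then have "(F ^^ Suc n has_derivative (\<lambda>v. (D ** A x) *v v)) (at x)"
    by (simp add: funpow_Suc_right comp_def matrix_vector_mul_assoc del: funpow.simps)
  then have "torus_deriv (torus_map (F ^^ Suc n)) (torus_proj x) = D ** A x"
    by (rule torus_deriv_eq[OF equivariant_funpow[OF equivariant]])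
  then have "torus_deriv (f ^^ Suc n) p = D ** A x" unfolding torus_map_funpow[OF equivariant] p .
  then show ?thesis using D(2) torus_deriv_one torus_map_proj[OF equivariant] p by simp
qed

lemma torus_deriv_0: "torus_deriv (f ^^ 0) p = mat 1"
proof -
  obtain x where p: "p = torus_proj x" by (rule torus_exhaust)
  have "torus_deriv (torus_map (F ^^ 0)) (torus_proj x) = mat 1"
    by (rule torus_deriv_eq[OF equivariant_funpow[OF equivariant]]) (simp add: id_def)
  then show ?thesis unfolding torus_map_funpow[OF equivariant] p .
qed

lemma torus_deriv_inverse: "\<exists>B. torus_deriv (f ^^ n) p ** B = mat 1"
proof (induction n arbitrary: p)
  case 0 show ?case by (rule exI[of _ "mat 1"]) (simp only: torus_deriv_0 matrix_mul_lid)
next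
  case (Suc n)
  obtain x where p: "p = torus_proj x" by (rule torus_exhaust)
  obtain B where B: "torus_deriv (f ^^ n) (f p) ** B = mat 1" using Suc by blast
  have "torus_deriv (f ^^ Suc n) p ** (Ai x ** B) = torus_deriv (f ^^ n) (f p) ** (A x ** Ai x) ** B"
    unfolding torus_deriv_Suc by (simp add: p torus_deriv_one matrix_mul_assoc)
  also have "\<dots> = mat 1" using B by (simp add: inverse)
  finally show ?case by blast
qed

lemma matrix_inv_Suc:
  "matrix_inv (torus_deriv (f ^^ Suc n) p) = matrix_inv (torus_deriv f p) ** matrix_inv (torus_deriv (f ^^ n) (f p))"
proof -
  obtain x where p: "p = torus_proj x" by (rule torus_exhaust)
  obtain B where B: "torus_deriv (f ^^ n) (f p) ** B = mat 1" using torus_deriv_inverse by blast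
  have "torus_deriv (f ^^ Suc n) p ** (Ai x ** B) = torus_deriv (f ^^ n) (f p) ** (A x ** Ai x) ** B"
    unfolding torus_deriv_Suc by (simp add: p torus_deriv_one matrix_mul_assoc)
  also have "\<dots> = mat 1" using B by (simp add: inverse)
  finally have "matrix_inv (torus_deriv (f ^^ Suc n) p) = Ai x ** B" by (rule matrix_inv_eqI)
  moreover have "matrix_inv (torus_deriv f p) = Ai x" unfolding p torus_deriv_one by (rule matrix_inv_eqI[OF inverse])
  ultimately show ?thesis using matrix_inv_eqI[OF B] by simp
qed

lemma det_iterate: "\<bar>det (torus_deriv (f ^^ n) p)\<bar> = real d ^ n"
proof (induction n arbitrary: p)
  case 0 show ?case unfolding torus_deriv_0 by simp
next
  case (Suc n)
  obtain x where p: "p = torus_proj x" by (rule torus_exhaust)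
  have "\<bar>det (torus_deriv f p)\<bar> = real d" unfolding p torus_deriv_one by (rule det)
  then show ?case unfolding torus_deriv_Suc det_mul abs_mult Suc by simp
qed

lemma fibre_finite: "finite (f -` {p})" and fibre_card: "card (f -` {p}) = d"
proof -
  obtain x where p: "p = torus_proj x" by (rule torus_exhaust)
  show "finite (f -` {p})" "card (f -` {p}) = d"
    unfolding p fibre using finite_I card_image[OF fibre_inj] card_I by simp_all
qed

lemma fibre_Suc: "(f ^^ Suc n) -` {p} = (\<Union>q\<in>(f ^^ n) -` {p}. f -` {q})"
  by (auto simp: funpow_Suc_right simp del: funpow.simps)

lemma iterate_fibre: "finite ((f ^^ n) -` {p}) \<and> card ((f ^^ n) -` {p}) = d ^ n"
proof (induction n)
  case 0
  have "(f ^^ 0) -` {p} = {p}" by auto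
  then show ?case by simp
next
  case (Suc n)
  have "card (\<Union>q\<in>(f ^^ n) -` {p}. f -` {q}) = (\<Sum>q\<in>(f ^^ n) -` {p}. card (f -` {q}))"
    by (rule card_UN_disjoint) (use Suc fibre_finite in auto)
  then show ?case unfolding fibre_Suc using Suc fibre_finite fibre_card by simp
qed

text \<open>
  The inequality for one generation of preimages iterates by the chain rule to one for \<open>n\<close> generations, and the potential may be
  replaced by \<open>ln \<parallel>v\<parallel>\<close> at the cost of \<open>2 K\<close>, which is negligible against \<open>n c\<close>.
\<close>
theorem C_chi_positive:
  fixes \<Psi> :: "torus \<Rightarrow> real^2 \<Rightarrow> real"
  assumes c: "c > 0" and bound: "\<And>p v. v \<noteq> 0 \<Longrightarrow> \<bar>\<Psi> p v - ln (norm v)\<bar> \<le> K"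
    and drift: "\<And>x v. v \<noteq> 0 \<Longrightarrow> real d * (\<Psi> (torus_proj x) v + c) \<le> (\<Sum>i\<in>I. \<Psi> (torus_proj (Y x i)) (Ai (Y x i) *v v))"
  shows "C_chi f > 0"
proof -
  define w where "w n y v = matrix_inv (torus_deriv (f ^^ n) y) *v v" for n y and v :: "real^2"
  have w0: "w n y v \<noteq> 0" if "v \<noteq> 0" for n y v
  proof -
    obtain B where B: "torus_deriv (f ^^ n) y ** B = mat 1" using torus_deriv_inverse by blast
    then have "matrix_inv (torus_deriv (f ^^ n) y) = B" by (rule matrix_inv_eqI)
    then have "torus_deriv (f ^^ n) y *v w n y v = v" using B by (simp add: w_def matrix_vector_mul_assoc)
    then show ?thesis using that by (metis matrix_vector_mult_0_right)
  qed
  have step: "real d * (\<Psi> q v + c) \<le> (\<Sum>y\<in>f -` {q}. \<Psi> y (matrix_inv (torus_deriv f y) *v v))" if "v \<noteq> 0" for q v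
  proof -
    obtain x where q: "q = torus_proj x" by (rule torus_exhaust)
    have inv: "matrix_inv (torus_deriv f (torus_proj (Y x i))) = Ai (Y x i)" for i
      unfolding torus_deriv_one by (rule matrix_inv_eqI[OF inverse])
    have "(\<Sum>y\<in>f -` {q}. \<Psi> y (matrix_inv (torus_deriv f y) *v v)) = (\<Sum>i\<in>I. \<Psi> (torus_proj (Y x i)) (Ai (Y x i) *v v))"
      unfolding q fibre sum.reindex[OF fibre_inj] by (simp add: inv)
    then show ?thesis using drift[OF that, of x] unfolding q by simp
  qed
  have growth: "real d ^ n * (\<Psi> p v + n * c) \<le> (\<Sum>y\<in>(f ^^ n) -` {p}. \<Psi> y (w n y v))" if v: "v \<noteq> 0" for n p v
  proof (induction n)
    case 0
    have "(f ^^ 0) -` {p} = {p}" by auto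
    moreover have "w 0 y v = v" for y
      unfolding w_def torus_deriv_0 using matrix_inv_eqI[of "mat 1 :: real^2^2" "mat 1"] by simp
    ultimately show ?case by simp
  next
    case (Suc n)
    have "(\<Sum>y\<in>(f ^^ Suc n) -` {p}. \<Psi> y (w (Suc n) y v)) = (\<Sum>q\<in>(f ^^ n) -` {p}. \<Sum>y\<in>f -` {q}. \<Psi> y (w (Suc n) y v))"
      unfolding fibre_Suc by (rule sum.UNION_disjoint) (use iterate_fibre fibre_finite in auto)
    also have "\<dots> = (\<Sum>q\<in>(f ^^ n) -` {p}. \<Sum>y\<in>f -` {q}. \<Psi> y (matrix_inv (torus_deriv f y) *v w n q v))"
      by (intro sum.cong refl) (auto simp: w_def matrix_inv_Suc matrix_vector_mul_assoc simp del: funpow.simps)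
    also have "\<dots> \<ge> (\<Sum>q\<in>(f ^^ n) -` {p}. real d * (\<Psi> q (w n q v) + c))"
      by (intro sum_mono step w0 v)
    moreover have "(\<Sum>q\<in>(f ^^ n) -` {p}. real d * (\<Psi> q (w n q v) + c)) = real d * ((\<Sum>q\<in>(f ^^ n) -` {p}. \<Psi> q (w n q v)) + real d ^ n * c)"
      using iterate_fibre[of n p] by (simp add: sum.distrib distrib_left flip: sum_distrib_left)
    moreover have "real d * (real d ^ n * (\<Psi> p v + n * c)) \<le> real d * (\<Sum>q\<in>(f ^^ n) -` {p}. \<Psi> q (w n q v))"
      using Suc by (intro mult_left_mono) auto
    ultimately show ?case by (simp add: algebra_simps del: funpow.simps)
  qed
  have K0: "K \<ge> 0"
  proof -
    have "(axis 1 1 :: real^2) \<noteq> 0" by simp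
    from bound[OF this] show ?thesis by (meson abs_ge_zero order_trans)
  qed
  have I_bound: "n * c - 2 * K \<le> I_chi p u (f ^^ n)" if u: "norm u = 1" for n p u
  proof -
    have u0: "u \<noteq> 0" using u by auto
    have dp: "real d ^ n > 0" using d_pos by simp
    have "(\<Sum>y\<in>(f ^^ n) -` {p}. \<Psi> y (w n y u)) \<le> (\<Sum>y\<in>(f ^^ n) -` {p}. ln (norm (w n y u)) + K)"
    proof (rule sum_mono)
      fix y
      show "\<Psi> y (w n y u) \<le> ln (norm (w n y u)) + K" using bound[OF w0[OF u0], of y n y] by linarith
    qed
    also have "\<dots> = (\<Sum>y\<in>(f ^^ n) -` {p}. ln (norm (w n y u))) + real d ^ n * K"
      using iterate_fibre[of n p] by (simp add: sum.distrib)
    finally have "real d ^ n * (\<Psi> p u + n * c) \<le> (\<Sum>y\<in>(f ^^ n) -` {p}. ln (norm (w n y u))) + real d ^ n * K"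
      using growth[OF u0, of n p] by linarith
    moreover have "- K \<le> \<Psi> p u" using bound[OF u0, of p] u by simp
    then have "real d ^ n * (n * c - K) \<le> real d ^ n * (\<Psi> p u + n * c)" using dp by (intro mult_left_mono) auto
    ultimately have "real d ^ n * (n * c - 2 * K) \<le> (\<Sum>y\<in>(f ^^ n) -` {p}. ln (norm (w n y u)))"
      by (simp add: algebra_simps)
    moreover have "I_chi p u (f ^^ n) = (\<Sum>y\<in>(f ^^ n) -` {p}. ln (norm (w n y u))) / real d ^ n"
      unfolding I_chi_def det_iterate w_def by (simp add: sum_divide_distrib)
    ultimately show ?thesis using dp by (simp add: pos_le_divide_eq mult.commute)
  qed
  obtain n :: nat where n: "n \<ge> 1" "4 * K \<le> n * c"
  proof -
    obtain m :: nat where m: "4 * K / c \<le> m" using real_arch_simple by blast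
    have "4 * K \<le> m * c" using m c by (simp add: pos_divide_le_eq)
    also have "\<dots> \<le> real (max 1 m) * c" using c by (intro mult_right_mono) auto
    finally show ?thesis using that[of "max 1 m"] by simp
  qed
  have "ereal (c / 2) \<le> (INF (x, u)\<in>unit_tangent_bundle. ereal (I_chi x u (f ^^ n) / real n))"
  proof (rule INF_greatest, clarify)
    fix p u assume "(p, u) \<in> unit_tangent_bundle"
    then have "n * c - 2 * K \<le> I_chi p u (f ^^ n)" by (intro I_bound) (simp add: unit_tangent_bundle_def)
    then have "c / 2 * n \<le> I_chi p u (f ^^ n)" using n by (simp add: algebra_simps)
    then show "ereal (c / 2) \<le> ereal (I_chi p u (f ^^ n) / real n)" using n(1) by (simp add: pos_le_divide_eq)
  qed
  also have "\<dots> \<le> C_chi f" unfolding C_chi_def using n(1) by (intro SUP_upper) simp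
  finally show ?thesis using c by (metis ereal_less(2) half_gt_zero order_less_le_trans)
qed

end

section \<open>Analyticity of trigonometric expressions\<close>

definition multi_index :: "('a::euclidean_space \<Rightarrow> nat) set" where
  "multi_index = (Basis \<rightarrow>\<^sub>E UNIV)"

definition monomial :: "'a::euclidean_space \<Rightarrow> 'a \<Rightarrow> ('a \<Rightarrow> nat) \<Rightarrow> real" where
  "monomial p y \<alpha> = (\<Prod>b\<in>Basis. ((y - p) \<bullet> b) ^ \<alpha> b)"

text \<open>
  The power series about \<open>p\<close> whose coefficients are absolutely summable form a Banach algebra in which \<open>K\<close> bounds the norm.
  Entire functions operate on it, and since the radius \<open>1\<close> is the same for all of its elements, no domain has to be
  tracked through a composition.
\<close>
definition power_series_bounded :: "'a::euclidean_space \<Rightarrow> real \<Rightarrow> ('a \<Rightarrow> real) \<Rightarrow> bool" where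
  "power_series_bounded p K g \<longleftrightarrow> (\<exists>c. (\<lambda>\<alpha>. \<bar>c \<alpha>\<bar>) summable_on multi_index \<and> (\<Sum>\<^sub>\<infinity>\<alpha>\<in>multi_index. \<bar>c \<alpha>\<bar>) \<le> K \<and>
     (\<forall>y\<in>ball p 1. ((\<lambda>\<alpha>. monomial p y \<alpha> * c \<alpha>) has_sum g y) multi_index))"

lemma monomial_le_1: assumes "y \<in> ball p 1" shows "\<bar>monomial p y \<alpha>\<bar> \<le> 1"
proof -
  have "\<bar>(y - p) \<bullet> b\<bar> \<le> 1" if "b \<in> Basis" for b
    using Basis_le_norm[OF that, of "y - p"] assms by (simp add: dist_norm norm_minus_commute)
  then have "(\<Prod>b\<in>Basis. \<bar>((y - p) \<bullet> b) ^ \<alpha> b\<bar>) \<le> 1"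
    by (intro prod_le_1) (auto simp: power_abs power_le_one)
  then show ?thesis by (simp add: monomial_def abs_prod)
qed

text \<open>
  Collecting equal monomials in an absolutely convergent family.
\<close>
lemma power_series_boundedI:
  fixes a :: "'i \<Rightarrow> real" and m :: "'i \<Rightarrow> 'a::euclidean_space \<Rightarrow> nat"
  assumes m: "\<And>i. i \<in> I \<Longrightarrow> m i \<in> multi_index" and a: "(\<lambda>i. \<bar>a i\<bar>) summable_on I" and K: "(\<Sum>\<^sub>\<infinity>i\<in>I. \<bar>a i\<bar>) \<le> K"
    and g: "\<And>y. y \<in> ball p 1 \<Longrightarrow> ((\<lambda>i. monomial p y (m i) * a i) has_sum g y) I"
  shows "power_series_bounded p K g"
proof -
  define J where "J \<alpha> = {i\<in>I. m i = \<alpha>}" for \<alpha>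
  have bij: "bij_betw (\<lambda>i. (m i, i)) I (Sigma multi_index J)"
    by (rule bij_betwI[of _ _ _ snd]) (use m in \<open>auto simp: J_def\<close>)
  have abs: "(\<lambda>z. \<bar>a (snd z)\<bar>) summable_on Sigma multi_index J"
    using summable_on_reindex_bij_betw[OF bij, of "\<lambda>z. \<bar>a (snd z)\<bar>"] a by simp
  note sig = Infinite_Sum.abs_summable_on_Sigma_iff[of "\<lambda>z. a (snd z)" multi_index J, simplified, THEN iffD1, OF abs]
  have inner: "(\<lambda>i. norm (a i)) summable_on J \<alpha>" if "\<alpha> \<in> multi_index" for \<alpha> using sig that by simp
  define c where "c \<alpha> = infsum a (J \<alpha>)" for \<alpha>
  have cb: "\<bar>c \<alpha>\<bar> \<le> (\<Sum>\<^sub>\<infinity>i\<in>J \<alpha>. \<bar>a i\<bar>)" if "\<alpha> \<in> multi_index" for \<alpha>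
    using norm_infsum_bound[OF inner[OF that]] by (simp add: c_def)
  have outer: "(\<lambda>\<alpha>. \<Sum>\<^sub>\<infinity>i\<in>J \<alpha>. \<bar>a i\<bar>) summable_on multi_index"
  proof -
    have "(\<lambda>\<alpha>. \<bar>\<Sum>\<^sub>\<infinity>i\<in>J \<alpha>. \<bar>a i\<bar>\<bar>) summable_on multi_index" using sig by simp
    moreover have "\<bar>\<Sum>\<^sub>\<infinity>i\<in>J \<alpha>. \<bar>a i\<bar>\<bar> = (\<Sum>\<^sub>\<infinity>i\<in>J \<alpha>. \<bar>a i\<bar>)" for \<alpha> by (intro abs_of_nonneg infsum_nonneg) simp
    ultimately show ?thesis by simp
  qed
  have c_sum: "(\<lambda>\<alpha>. \<bar>c \<alpha>\<bar>) summable_on multi_index"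
    by (rule summable_on_comparison_test[OF outer]) (use cb in auto)
  have "(\<Sum>\<^sub>\<infinity>\<alpha>\<in>multi_index. \<bar>c \<alpha>\<bar>) \<le> (\<Sum>\<^sub>\<infinity>\<alpha>\<in>multi_index. \<Sum>\<^sub>\<infinity>i\<in>J \<alpha>. \<bar>a i\<bar>)"
    by (rule infsum_mono[OF c_sum outer cb])
  also have "\<dots> = (\<Sum>\<^sub>\<infinity>z\<in>Sigma multi_index J. \<bar>a (snd z)\<bar>)"
    using infsum_Sigma_banach[OF abs] by simp
  also have "\<dots> = (\<Sum>\<^sub>\<infinity>i\<in>I. \<bar>a i\<bar>)"
    using infsum_reindex_bij_betw[OF bij, of "\<lambda>z. \<bar>a (snd z)\<bar>"] by simp
  finally have cK: "(\<Sum>\<^sub>\<infinity>\<alpha>\<in>multi_index. \<bar>c \<alpha>\<bar>) \<le> K" using K by linarith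
  have "((\<lambda>\<alpha>. monomial p y \<alpha> * c \<alpha>) has_sum g y) multi_index" if y: "y \<in> ball p 1" for y
  proof (rule has_sum_SigmaD)
    show "((\<lambda>z. monomial p y (fst z) * a (snd z)) has_sum g y) (Sigma multi_index J)"
      using has_sum_reindex_bij_betw[OF bij, of "\<lambda>z. monomial p y (fst z) * a (snd z)" "g y"] g[OF y] by simp
    fix \<alpha> :: "'a \<Rightarrow> nat" assume "\<alpha> \<in> multi_index"
    then have "(a has_sum c \<alpha>) (J \<alpha>)" unfolding c_def using Infinite_Sum.abs_summable_summable[OF inner] by (intro has_sum_infsum)
    then show "((\<lambda>i. monomial p y (fst (\<alpha>, i)) * a (snd (\<alpha>, i))) has_sum monomial p y \<alpha> * c \<alpha>) (J \<alpha>)"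
      by (simp add: has_sum_cmult_right)
  qed
  then show ?thesis unfolding power_series_bounded_def using c_sum cK by blast
qed

lemma power_series_bounded_const: "power_series_bounded p \<bar>k\<bar> (\<lambda>_. k)"
proof (rule power_series_boundedI[where I = "{()}" and a = "\<lambda>_. k" and m = "\<lambda>_. \<lambda>b\<in>Basis. 0"])
  fix y :: 'a
  show "((\<lambda>i. monomial p y (\<lambda>b\<in>Basis. 0) * k) has_sum k) {()}"
    by (rule has_sum_finiteI) (simp_all add: monomial_def)
qed (auto simp: multi_index_def)

lemma power_series_bounded_coordinate:
  assumes b: "b \<in> Basis" shows "power_series_bounded p 1 (\<lambda>y. (y - p) \<bullet> b)"
proof (rule power_series_boundedI[where I = "{()}" and a = "\<lambda>_. 1" and m = "\<lambda>_. \<lambda>b'\<in>Basis. if b' = b then 1 else 0"])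
  fix y :: 'a
  have "monomial p y (\<lambda>b'\<in>Basis. if b' = b then 1 else 0) = (\<Prod>b'\<in>Basis. if b' = b then (y - p) \<bullet> b else 1)"
    unfolding monomial_def by (intro prod.cong) auto
  also have "\<dots> = (y - p) \<bullet> b" using b by simp
  finally show "((\<lambda>i. monomial p y (\<lambda>b'\<in>Basis. if b' = b then 1 else 0) * 1) has_sum (y - p) \<bullet> b) {()}"
    by (intro has_sum_finiteI) simp_all
qed (auto simp: multi_index_def)

lemma power_series_bounded_add:
  assumes "power_series_bounded p K f" "power_series_bounded p L g"
  shows "power_series_bounded p (K + L) (\<lambda>y. f y + g y)"
proof -
  obtain c where c: "(\<lambda>\<alpha>. \<bar>c \<alpha>\<bar>) summable_on multi_index" "(\<Sum>\<^sub>\<infinity>\<alpha>\<in>multi_index. \<bar>c \<alpha>\<bar>) \<le> K"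
     "\<And>y. y\<in>ball p 1 \<Longrightarrow> ((\<lambda>\<alpha>. monomial p y \<alpha> * c \<alpha>) has_sum f y) multi_index"
    using assms(1) unfolding power_series_bounded_def by blast
  obtain d where d: "(\<lambda>\<alpha>. \<bar>d \<alpha>\<bar>) summable_on multi_index" "(\<Sum>\<^sub>\<infinity>\<alpha>\<in>multi_index. \<bar>d \<alpha>\<bar>) \<le> L"
     "\<And>y. y\<in>ball p 1 \<Longrightarrow> ((\<lambda>\<alpha>. monomial p y \<alpha> * d \<alpha>) has_sum g y) multi_index"
    using assms(2) unfolding power_series_bounded_def by blast
  have s: "(\<lambda>\<alpha>. \<bar>c \<alpha>\<bar> + \<bar>d \<alpha>\<bar>) summable_on multi_index" by (rule summable_on_add[OF c(1) d(1)])
  have s': "(\<lambda>\<alpha>. \<bar>c \<alpha> + d \<alpha>\<bar>) summable_on multi_index"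
    by (rule summable_on_comparison_test[OF s]) auto
  have "(\<Sum>\<^sub>\<infinity>\<alpha>\<in>multi_index. \<bar>c \<alpha> + d \<alpha>\<bar>) \<le> (\<Sum>\<^sub>\<infinity>\<alpha>\<in>multi_index. \<bar>c \<alpha>\<bar> + \<bar>d \<alpha>\<bar>)"
    by (rule infsum_mono[OF s' s]) simp
  also have "\<dots> = (\<Sum>\<^sub>\<infinity>\<alpha>\<in>multi_index. \<bar>c \<alpha>\<bar>) + (\<Sum>\<^sub>\<infinity>\<alpha>\<in>multi_index. \<bar>d \<alpha>\<bar>)"
    by (rule infsum_add[OF c(1) d(1)])
  finally have "(\<Sum>\<^sub>\<infinity>\<alpha>\<in>multi_index. \<bar>c \<alpha> + d \<alpha>\<bar>) \<le> K + L" using c(2) d(2) by linarith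
  moreover have "((\<lambda>\<alpha>. monomial p y \<alpha> * (c \<alpha> + d \<alpha>)) has_sum f y + g y) multi_index" if "y \<in> ball p 1" for y
    using has_sum_add[OF c(3)[OF that] d(3)[OF that]] by (simp add: distrib_left)
  ultimately show ?thesis unfolding power_series_bounded_def using s' by (intro exI[of _ "\<lambda>\<alpha>. c \<alpha> + d \<alpha>"]) blast
qed

lemma has_sum_times:
  fixes f g :: "_ \<Rightarrow> real"
  assumes f: "(f has_sum a) A" "(\<lambda>x. \<bar>f x\<bar>) summable_on A" and g: "(g has_sum b) B" "(\<lambda>x. \<bar>g x\<bar>) summable_on B"
  shows "((\<lambda>(x,y). f x * g y) has_sum (a * b)) (A \<times> B)" "(\<lambda>(x,y). \<bar>f x * g y\<bar>) summable_on (A \<times> B)"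
    "(\<Sum>\<^sub>\<infinity>(x,y)\<in>A \<times> B. \<bar>f x * g y\<bar>) = (\<Sum>\<^sub>\<infinity>x\<in>A. \<bar>f x\<bar>) * (\<Sum>\<^sub>\<infinity>y\<in>B. \<bar>g y\<bar>)"
proof -
  have "(\<lambda>z. \<bar>f (fst z) * g (snd z)\<bar>) summable_on Sigma A (\<lambda>_. B)"
  proof (rule summable_on_SigmaI)
    fix x show "((\<lambda>y. \<bar>f (fst (x, y)) * g (snd (x, y))\<bar>) has_sum \<bar>f x\<bar> * (\<Sum>\<^sub>\<infinity>y\<in>B. \<bar>g y\<bar>)) B"
      using has_sum_cmult_right[OF has_sum_infsum[OF g(2)], of "\<bar>f x\<bar>"] by (simp add: abs_mult)
    show "(\<lambda>x. \<bar>f x\<bar> * (\<Sum>\<^sub>\<infinity>y\<in>B. \<bar>g y\<bar>)) summable_on A" by (rule summable_on_cmult_left[OF f(2)])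
  qed simp
  then show abs: "(\<lambda>(x,y). \<bar>f x * g y\<bar>) summable_on (A \<times> B)" by (simp add: case_prod_unfold)
  have "(\<lambda>z. norm (case z of (x,y) \<Rightarrow> f x * g y)) summable_on A \<times> B" using abs by (simp add: case_prod_unfold)
  then have sm: "(\<lambda>(x,y). f x * g y) summable_on A \<times> B" by (rule Infinite_Sum.abs_summable_summable)
  show "((\<lambda>(x,y). f x * g y) has_sum (a * b)) (A \<times> B)"
  proof (rule has_sum_SigmaI[OF _ _ sm])
    fix x show "((\<lambda>y. case (x, y) of (x, y) \<Rightarrow> f x * g y) has_sum f x * b) B"
      using has_sum_cmult_right[OF g(1), of "f x"] by simp
    show "((\<lambda>x. f x * b) has_sum a * b) A" by (rule has_sum_cmult_left[OF f(1)])
  qed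
  have "((\<lambda>(x,y). \<bar>f x * g y\<bar>) has_sum ((\<Sum>\<^sub>\<infinity>x\<in>A. \<bar>f x\<bar>) * (\<Sum>\<^sub>\<infinity>y\<in>B. \<bar>g y\<bar>))) (A \<times> B)"
  proof (rule has_sum_SigmaI[OF _ _ abs])
    fix x show "((\<lambda>y. case (x, y) of (x, y) \<Rightarrow> \<bar>f x * g y\<bar>) has_sum \<bar>f x\<bar> * (\<Sum>\<^sub>\<infinity>y\<in>B. \<bar>g y\<bar>)) B"
      using has_sum_cmult_right[OF has_sum_infsum[OF g(2)], of "\<bar>f x\<bar>"] by (simp add: abs_mult)
    show "((\<lambda>x. \<bar>f x\<bar> * (\<Sum>\<^sub>\<infinity>y\<in>B. \<bar>g y\<bar>)) has_sum (\<Sum>\<^sub>\<infinity>x\<in>A. \<bar>f x\<bar>) * (\<Sum>\<^sub>\<infinity>y\<in>B. \<bar>g y\<bar>)) A"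
      by (rule has_sum_cmult_left[OF has_sum_infsum[OF f(2)]])
  qed
  then show "(\<Sum>\<^sub>\<infinity>(x,y)\<in>A \<times> B. \<bar>f x * g y\<bar>) = (\<Sum>\<^sub>\<infinity>x\<in>A. \<bar>f x\<bar>) * (\<Sum>\<^sub>\<infinity>y\<in>B. \<bar>g y\<bar>)" by (rule infsumI)
qed

lemma summable_monomial:
  assumes "y \<in> ball p 1" "(\<lambda>\<alpha>. \<bar>c \<alpha>\<bar>) summable_on J" shows "(\<lambda>\<alpha>. \<bar>monomial p y \<alpha> * c \<alpha>\<bar>) summable_on J"
proof (rule summable_on_comparison_test[OF assms(2)])
  show "\<bar>monomial p y \<alpha> * c \<alpha>\<bar> \<le> \<bar>c \<alpha>\<bar>" for \<alpha>
    unfolding abs_mult using mult_right_mono[OF monomial_le_1[OF assms(1)], of "\<bar>c \<alpha>\<bar>"] by simp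
qed simp

lemma power_series_bounded_mult:
  assumes "power_series_bounded p K f" "power_series_bounded p L g"
  shows "power_series_bounded p (K * L) (\<lambda>y. f y * g y)"
proof -
  obtain c where c: "(\<lambda>\<alpha>. \<bar>c \<alpha>\<bar>) summable_on multi_index" "(\<Sum>\<^sub>\<infinity>\<alpha>\<in>multi_index. \<bar>c \<alpha>\<bar>) \<le> K"
     "\<And>y. y\<in>ball p 1 \<Longrightarrow> ((\<lambda>\<alpha>. monomial p y \<alpha> * c \<alpha>) has_sum f y) multi_index"
    using assms(1) unfolding power_series_bounded_def by blast
  obtain d where d: "(\<lambda>\<alpha>. \<bar>d \<alpha>\<bar>) summable_on multi_index" "(\<Sum>\<^sub>\<infinity>\<alpha>\<in>multi_index. \<bar>d \<alpha>\<bar>) \<le> L"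
     "\<And>y. y\<in>ball p 1 \<Longrightarrow> ((\<lambda>\<alpha>. monomial p y \<alpha> * d \<alpha>) has_sum g y) multi_index"
    using assms(2) unfolding power_series_bounded_def by blast
  have cs: "(c has_sum infsum c multi_index) multi_index" "(d has_sum infsum d multi_index) multi_index"
    by (rule has_sum_infsum[OF Infinite_Sum.abs_summable_summable]; use c(1) d(1) in simp)+
  show ?thesis
  proof (rule power_series_boundedI[where I = "multi_index \<times> multi_index" and a = "\<lambda>(\<alpha>,\<beta>). c \<alpha> * d \<beta>" and m = "\<lambda>(\<alpha>,\<beta>). \<lambda>b\<in>Basis. \<alpha> b + \<beta> b"])
    show "(case i of (\<alpha>, \<beta>) \<Rightarrow> \<lambda>b\<in>Basis. \<alpha> b + \<beta> b) \<in> multi_index" for i :: "('a \<Rightarrow> nat) \<times> ('a \<Rightarrow> nat)"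
      by (auto simp: multi_index_def split: prod.splits)
    show "(\<lambda>i. \<bar>case i of (\<alpha>, \<beta>) \<Rightarrow> c \<alpha> * d \<beta>\<bar>) summable_on multi_index \<times> multi_index"
      using has_sum_times(2)[OF cs(1) c(1) cs(2) d(1)] by (simp add: case_prod_unfold)
    have "(\<Sum>\<^sub>\<infinity>\<alpha>\<in>multi_index. \<bar>c \<alpha>\<bar>) * (\<Sum>\<^sub>\<infinity>\<alpha>\<in>multi_index. \<bar>d \<alpha>\<bar>) \<le> K * L"
    proof (rule mult_mono[OF c(2) d(2)])
      show "0 \<le> K" using c(2) infsum_nonneg[of multi_index "\<lambda>\<alpha>. \<bar>c \<alpha>\<bar>"] by simp
    qed (simp add: infsum_nonneg)
    then show "(\<Sum>\<^sub>\<infinity>i\<in>multi_index \<times> multi_index. \<bar>case i of (\<alpha>, \<beta>) \<Rightarrow> c \<alpha> * d \<beta>\<bar>) \<le> K * L"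
      using has_sum_times(3)[OF cs(1) c(1) cs(2) d(1)] by (simp add: case_prod_unfold)
    fix y assume y: "y \<in> ball p 1"
    have m: "monomial p y (\<lambda>b\<in>Basis. \<alpha> b + \<beta> b) = monomial p y \<alpha> * monomial p y \<beta>" for \<alpha> \<beta>
      unfolding monomial_def prod.distrib[symmetric] by (intro prod.cong) (auto simp: power_add)
    have "((\<lambda>(\<alpha>,\<beta>). (monomial p y \<alpha> * c \<alpha>) * (monomial p y \<beta> * d \<beta>)) has_sum f y * g y) (multi_index \<times> multi_index)"
      by (intro has_sum_times(1) c(3)[OF y] d(3)[OF y] summable_monomial[OF y] c(1) d(1))
    then show "((\<lambda>i. monomial p y (case i of (\<alpha>, \<beta>) \<Rightarrow> \<lambda>b\<in>Basis. \<alpha> b + \<beta> b) * (case i of (\<alpha>, \<beta>) \<Rightarrow> c \<alpha> * d \<beta>)) has_sum f y * g y) (multi_index \<times> multi_index)"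
      by (simp add: case_prod_unfold m mult_ac)
  qed
qed

lemma power_series_bounded_power: "power_series_bounded p K g \<Longrightarrow> power_series_bounded p (K ^ n) (\<lambda>y. g y ^ n)"
  by (induction n) (use power_series_bounded_const[of p 1] power_series_bounded_mult in auto)

text \<open>
  Substitution into an entire series, by expanding all powers and rearranging the resulting double series.
\<close>
lemma power_series_bounded_entire:
  assumes g: "power_series_bounded p K g" and h: "\<And>x. (\<lambda>n. e n * x ^ n) sums h x" and e: "summable (\<lambda>n. \<bar>e n\<bar> * K ^ n)"
  shows "\<exists>L. power_series_bounded p L (\<lambda>y. h (g y) :: real)"
proof -
  have "\<forall>n. \<exists>c. (\<lambda>\<alpha>. \<bar>c \<alpha>\<bar>) summable_on multi_index \<and> (\<Sum>\<^sub>\<infinity>\<alpha>\<in>multi_index. \<bar>c \<alpha>\<bar>) \<le> K ^ n \<and>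
     (\<forall>y\<in>ball p 1. ((\<lambda>\<alpha>. monomial p y \<alpha> * c \<alpha>) has_sum g y ^ n) multi_index)"
    using power_series_bounded_power[OF g] unfolding power_series_bounded_def by blast
  then obtain c where c: "\<And>n. (\<lambda>\<alpha>. \<bar>c n \<alpha>\<bar>) summable_on multi_index" "\<And>n. (\<Sum>\<^sub>\<infinity>\<alpha>\<in>multi_index. \<bar>c n \<alpha>\<bar>) \<le> K ^ n"
     "\<And>n y. y\<in>ball p 1 \<Longrightarrow> ((\<lambda>\<alpha>. monomial p y \<alpha> * c n \<alpha>) has_sum g y ^ n) multi_index"
    by metis
  have K0: "K ^ n \<ge> 0" for n using c(2)[of n] infsum_nonneg[of multi_index "\<lambda>\<alpha>. \<bar>c n \<alpha>\<bar>"] by simp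
  have eK: "(\<lambda>n. \<bar>e n\<bar> * K ^ n) summable_on UNIV"
    using e K0 by (intro norm_summable_imp_summable_on) (simp add: abs_mult)
  have outer: "(\<lambda>n. \<bar>e n\<bar> * (\<Sum>\<^sub>\<infinity>\<alpha>\<in>multi_index. \<bar>c n \<alpha>\<bar>)) summable_on UNIV"
    by (rule summable_on_comparison_test[OF eK]) (use c(2) in \<open>auto intro!: mult_left_mono mult_nonneg_nonneg infsum_nonneg\<close>)
  have abs: "(\<lambda>z. \<bar>e (fst z) * c (fst z) (snd z)\<bar>) summable_on Sigma UNIV (\<lambda>_. multi_index)"
  proof (rule summable_on_SigmaI[OF _ outer])
    fix n show "((\<lambda>\<alpha>. \<bar>e (fst (n, \<alpha>)) * c (fst (n, \<alpha>)) (snd (n, \<alpha>))\<bar>) has_sum \<bar>e n\<bar> * (\<Sum>\<^sub>\<infinity>\<alpha>\<in>multi_index. \<bar>c n \<alpha>\<bar>)) multi_index"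
      using has_sum_cmult_right[OF has_sum_infsum[OF c(1)[of n]], of "\<bar>e n\<bar>"] by (simp add: abs_mult)
  qed simp
  have "power_series_bounded p (\<Sum>\<^sub>\<infinity>z\<in>Sigma UNIV (\<lambda>_. multi_index). \<bar>e (fst z) * c (fst z) (snd z)\<bar>) (\<lambda>y. h (g y))"
  proof (rule power_series_boundedI[where m = snd, OF _ abs order_refl])
    fix y assume y: "y \<in> ball p 1"
    have sm: "(\<lambda>z. monomial p y (snd z) * (e (fst z) * c (fst z) (snd z))) summable_on Sigma UNIV (\<lambda>_. multi_index)"
    proof (rule Infinite_Sum.abs_summable_summable, rule summable_on_comparison_test[OF abs])
      show "norm (monomial p y (snd z) * (e (fst z) * c (fst z) (snd z))) \<le> \<bar>e (fst z) * c (fst z) (snd z)\<bar>" for z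
        unfolding real_norm_def abs_mult[of "monomial p y (snd z)"]
        using mult_right_mono[OF monomial_le_1[OF y], of "\<bar>e (fst z) * c (fst z) (snd z)\<bar>"] by simp
    qed simp
    have gK: "\<bar>g y ^ n\<bar> \<le> K ^ n" for n
    proof -
      have "\<bar>g y ^ n\<bar> \<le> (\<Sum>\<^sub>\<infinity>\<alpha>\<in>multi_index. \<bar>c n \<alpha>\<bar>)"
        using norm_infsum_le[OF c(3)[OF y] has_sum_infsum[OF c(1)[of n]]] monomial_le_1[OF y]
        by (auto simp: abs_mult mult_left_le_one_le)
      then show ?thesis using c(2)[of n] by linarith
    qed
    have "summable (\<lambda>n. norm (e n * g y ^ n))"
      by (rule summable_comparison_test[OF _ e]) (use gK in \<open>auto simp: abs_mult intro!: mult_left_mono\<close>)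
    then have hs: "((\<lambda>n. e n * g y ^ n) has_sum h (g y)) UNIV" using h by (rule norm_summable_imp_has_sum)
    show "((\<lambda>z. monomial p y (snd z) * (e (fst z) * c (fst z) (snd z))) has_sum h (g y)) (Sigma UNIV (\<lambda>_. multi_index))"
    proof (rule has_sum_SigmaI[OF _ hs sm])
      fix n show "((\<lambda>\<alpha>. monomial p y (snd (n, \<alpha>)) * (e (fst (n, \<alpha>)) * c (fst (n, \<alpha>)) (snd (n, \<alpha>)))) has_sum e n * g y ^ n) multi_index"
        using has_sum_cmult_right[OF c(3)[OF y, of n], of "e n"] by (simp add: mult_ac)
    qed
  qed auto
  then show ?thesis by blast
qed

definition analytic_at :: "'a::euclidean_space \<Rightarrow> ('a \<Rightarrow> real) \<Rightarrow> bool" where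
  "analytic_at p g \<longleftrightarrow> (\<exists>K. power_series_bounded p K g)"

named_theorems analytic_at_intros

lemma analytic_at_const [analytic_at_intros]: "analytic_at p (\<lambda>_. k)"
  unfolding analytic_at_def using power_series_bounded_const by blast

lemma analytic_at_add [analytic_at_intros]: "analytic_at p f \<Longrightarrow> analytic_at p g \<Longrightarrow> analytic_at p (\<lambda>y. f y + g y)"
  unfolding analytic_at_def using power_series_bounded_add by blast

lemma analytic_at_mult [analytic_at_intros]: "analytic_at p f \<Longrightarrow> analytic_at p g \<Longrightarrow> analytic_at p (\<lambda>y. f y * g y)"
  unfolding analytic_at_def using power_series_bounded_mult by blast

lemma analytic_at_sum: "finite A \<Longrightarrow> (\<And>i. i \<in> A \<Longrightarrow> analytic_at p (f i)) \<Longrightarrow> analytic_at p (\<lambda>y. \<Sum>i\<in>A. f i y)"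
  by (induction A rule: finite_induct) (auto intro: analytic_at_intros)

lemma analytic_at_inner [analytic_at_intros]: "analytic_at p (\<lambda>y. y \<bullet> u)"
proof -
  have co: "analytic_at p (\<lambda>y. y \<bullet> b)" if "b \<in> Basis" for b
  proof -
    have "analytic_at p (\<lambda>y. (y - p) \<bullet> b + p \<bullet> b)"
      using power_series_bounded_coordinate[OF that] by (intro analytic_at_intros) (auto simp: analytic_at_def)
    then show ?thesis by (simp add: inner_diff_left)
  qed
  have "analytic_at p (\<lambda>y. \<Sum>b\<in>Basis. (y \<bullet> b) * (u \<bullet> b))"
    by (intro analytic_at_sum analytic_at_mult analytic_at_const co) auto
  then show ?thesis by (simp add: euclidean_inner[symmetric])
qed

lemma analytic_at_sin [analytic_at_intros]: "analytic_at p g \<Longrightarrow> analytic_at p (\<lambda>y. sin (g y))"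
proof -
  assume "analytic_at p g"
  then obtain K where K: "power_series_bounded p K g" by (auto simp: analytic_at_def)
  have "summable (\<lambda>n. norm (sin_coeff n *\<^sub>R \<bar>K\<bar> ^ n))" by (rule summable_norm_sin)
  then have e: "summable (\<lambda>n. \<bar>sin_coeff n\<bar> * K ^ n)" by (rule summable_comparison_test'[of _ 0]) (simp add: abs_mult power_abs)
  have "(\<lambda>n. sin_coeff n * x ^ n) sums sin x" for x :: real using sin_converges[of x] by simp
  from power_series_bounded_entire[OF K this e] show ?thesis by (simp add: analytic_at_def)
qed

lemma analytic_at_cos [analytic_at_intros]: "analytic_at p g \<Longrightarrow> analytic_at p (\<lambda>y. cos (g y))"
proof -
  assume "analytic_at p g"
  then have "analytic_at p (\<lambda>y. sin (pi/2 + (-1) * g y))" by (intro analytic_at_intros)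
  then show ?thesis by (simp add: cos_sin_eq)
qed

definition analytic_vec_at :: "'a::euclidean_space \<Rightarrow> ('a \<Rightarrow> 'b::real_normed_vector) \<Rightarrow> bool" where
  "analytic_vec_at p F \<longleftrightarrow> (\<exists>c. \<forall>y\<in>ball p 1. ((\<lambda>\<alpha>. monomial p y \<alpha> *\<^sub>R c \<alpha>) has_sum F y) multi_index)"

lemma analytic_vec_at_scaleR: assumes "analytic_at p g" shows "analytic_vec_at p (\<lambda>y. g y *\<^sub>R v)"
proof -
  obtain c where c: "\<And>y. y\<in>ball p 1 \<Longrightarrow> ((\<lambda>\<alpha>. monomial p y \<alpha> * c \<alpha>) has_sum g y) multi_index"
    using assms unfolding analytic_at_def power_series_bounded_def by blast
  have "((\<lambda>\<alpha>. monomial p y \<alpha> *\<^sub>R (c \<alpha> *\<^sub>R v)) has_sum g y *\<^sub>R v) multi_index" if "y \<in> ball p 1" for y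
    using has_sum_bounded_linear[OF bounded_linear_scaleR_left c[OF that], of v] by (simp add: o_def)
  then show ?thesis unfolding analytic_vec_at_def by (intro exI[of _ "\<lambda>\<alpha>. c \<alpha> *\<^sub>R v"] ballI)
qed

lemma analytic_vec_at_add: assumes "analytic_vec_at p F" "analytic_vec_at p G" shows "analytic_vec_at p (\<lambda>y. F y + G y)"
proof -
  obtain c d where c: "\<And>y. y\<in>ball p 1 \<Longrightarrow> ((\<lambda>\<alpha>. monomial p y \<alpha> *\<^sub>R c \<alpha>) has_sum F y) multi_index"
    and d: "\<And>y. y\<in>ball p 1 \<Longrightarrow> ((\<lambda>\<alpha>. monomial p y \<alpha> *\<^sub>R d \<alpha>) has_sum G y) multi_index"
    using assms unfolding analytic_vec_at_def by blast
  have "((\<lambda>\<alpha>. monomial p y \<alpha> *\<^sub>R (c \<alpha> + d \<alpha>)) has_sum F y + G y) multi_index" if "y \<in> ball p 1" for y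
    using has_sum_add[OF c[OF that] d[OF that]] by (simp add: scaleR_add_right)
  then show ?thesis unfolding analytic_vec_at_def by (intro exI[of _ "\<lambda>\<alpha>. c \<alpha> + d \<alpha>"] ballI)
qed

lemma real_analytic_onI: "(\<And>p. p \<in> W \<Longrightarrow> analytic_vec_at p F) \<Longrightarrow> real_analytic_on W F"
  unfolding real_analytic_on_def analytic_vec_at_def monomial_def multi_index_def
  by (intro ballI exI[of _ 1]) auto

section \<open>Sheared linear maps\<close>

text \<open>
  Global continuous differentiability, with the continuity of the derivative tested on each vector; in finite dimensions this
  is continuity in the operator norm.
\<close>
definition cont_diff :: "('a::euclidean_space \<Rightarrow> 'b::real_normed_vector) \<Rightarrow> bool" where
  "cont_diff F \<longleftrightarrow> (\<exists>F'. (\<forall>x. (F has_derivative F' x) (at x)) \<and> (\<forall>v. continuous_on UNIV (\<lambda>x. F' x v)))"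

lemma cont_diff_C1_on: assumes "cont_diff F" shows "C1_on W F"
proof -
  obtain F' where F: "\<And>x. (F has_derivative F' x) (at x)" "\<And>v. continuous_on UNIV (\<lambda>x. F' x v)"
    using assms unfolding cont_diff_def by blast
  have b: "blinfun_apply (Blinfun (F' x)) = F' x" for x
    by (rule bounded_linear_Blinfun_apply[OF has_derivative_bounded_linear[OF F(1)]])
  have "continuous_on W (\<lambda>x. Blinfun (F' x))"
    by (rule continuous_on_blinfun_componentwise) (simp add: b continuous_on_subset[OF F(2)])
  then show ?thesis unfolding C1_on_def using F(1) by (intro exI[of _ "\<lambda>x. Blinfun (F' x)"]) (simp add: b)
qed

lemma cont_diff_continuous: "cont_diff F \<Longrightarrow> continuous_on UNIV F"
  unfolding cont_diff_def continuous_on_eq_continuous_at[OF open_UNIV] by (meson has_derivative_continuous UNIV_I)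

lemma cont_diff_linear: "bounded_linear F \<Longrightarrow> cont_diff F"
  unfolding cont_diff_def by (intro exI[of _ "\<lambda>_. F"]) (auto intro: bounded_linear_imp_has_derivative)

lemma cont_diff_const: "cont_diff (\<lambda>_. c)"
  unfolding cont_diff_def by (intro exI[of _ "\<lambda>_ _. 0"]) auto

lemma cont_diff_real:
  assumes "\<And>x. (\<phi> has_real_derivative \<phi>' x) (at x)" "continuous_on UNIV \<phi>'" shows "cont_diff \<phi>"
  unfolding cont_diff_def
proof (intro exI[of _ "\<lambda>x v. \<phi>' x * v"] conjI allI)
  show "(\<phi> has_derivative (\<lambda>v. \<phi>' x * v)) (at x)" for x using assms(1)[of x] by (simp add: has_field_derivative_def)
  show "continuous_on UNIV (\<lambda>x. \<phi>' x * v)" for v by (intro continuous_intros assms(2))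
qed

lemma cont_diff_add: assumes "cont_diff F" "cont_diff G" shows "cont_diff (\<lambda>x. F x + G x)"
proof -
  obtain F' where F: "\<And>x. (F has_derivative F' x) (at x)" "\<And>v. continuous_on UNIV (\<lambda>x. F' x v)"
    using assms unfolding cont_diff_def by blast
  obtain G' where G: "\<And>x. (G has_derivative G' x) (at x)" "\<And>v. continuous_on UNIV (\<lambda>x. G' x v)"
    using assms unfolding cont_diff_def by blast
  show ?thesis unfolding cont_diff_def
    by (intro exI[of _ "\<lambda>x v. F' x v + G' x v"] conjI allI has_derivative_add F G continuous_on_add)
qed

lemma cont_diff_scaleR:
  assumes "cont_diff f" "cont_diff G" shows "cont_diff (\<lambda>x. f x *\<^sub>R G x)"
proof -
  obtain F' where F: "\<And>x. (f has_derivative F' x) (at x)" "\<And>v. continuous_on UNIV (\<lambda>x. F' x v)"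
    using assms unfolding cont_diff_def by blast
  obtain G' where G: "\<And>x. (G has_derivative G' x) (at x)" "\<And>v. continuous_on UNIV (\<lambda>x. G' x v)"
    using assms unfolding cont_diff_def by blast
  show ?thesis unfolding cont_diff_def
    by (intro exI[of _ "\<lambda>x v. f x *\<^sub>R G' x v + F' x v *\<^sub>R G x"] conjI allI has_derivative_scaleR F G
       continuous_on_add continuous_on_scaleR cont_diff_continuous assms)
qed

lemma cont_diff_compose: assumes "cont_diff F" "cont_diff G" shows "cont_diff (\<lambda>x. F (G x))"
proof -
  obtain F' where F: "\<And>x. (F has_derivative F' x) (at x)" "\<And>v. continuous_on UNIV (\<lambda>x. F' x v)"
    using assms unfolding cont_diff_def by blast
  obtain G' where G: "\<And>x. (G has_derivative G' x) (at x)" "\<And>v. continuous_on UNIV (\<lambda>x. G' x v)"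
    using assms unfolding cont_diff_def by blast
  show ?thesis unfolding cont_diff_def
  proof (intro exI[of _ "\<lambda>x v. F' (G x) (G' x v)"] conjI allI)
    show "((\<lambda>x. F (G x)) has_derivative (\<lambda>v. F' (G x) (G' x v))) (at x)" for x
      by (rule has_derivative_compose[OF G(1) F(1)])
    fix v
    have lin: "F' y w = (\<Sum>b\<in>Basis. (w \<bullet> b) *\<^sub>R F' y b)" for y w
    proof -
      interpret bounded_linear "F' y" by (rule has_derivative_bounded_linear[OF F(1)])
      have "F' y w = F' y (\<Sum>b\<in>Basis. (w \<bullet> b) *\<^sub>R b)" by (simp add: euclidean_representation)
      then show ?thesis by (simp add: sum scaleR)
    qed
    have "continuous_on UNIV (\<lambda>x. \<Sum>b\<in>Basis. (G' x v \<bullet> b) *\<^sub>R F' (G x) b)"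
      by (intro continuous_intros G(2) continuous_on_compose2[OF F(2)] cont_diff_continuous[OF assms(2)]) auto
    moreover have "(\<lambda>x. F' (G x) (G' x v)) = (\<lambda>x. \<Sum>b\<in>Basis. (G' x v \<bullet> b) *\<^sub>R F' (G x) b)" by (rule ext) (rule lin)
    ultimately show "continuous_on UNIV (\<lambda>x. F' (G x) (G' x v))" by (simp only:)
  qed
qed

definition shear_matrix :: "real^2 \<Rightarrow> real^2 \<Rightarrow> real \<Rightarrow> real^2^2" where
  "shear_matrix a b s = (\<chi> i j. (if i = j then 1 else 0) + s * a $ i * b $ j)"

lemma shear_matrix_apply: "shear_matrix a b s *v v = v + (s * (b \<bullet> v)) *\<^sub>R a"
  by (simp add: shear_matrix_def vec_eq_iff matrix_vector_mult_def forall_2 sum_2 inner_vec_def algebra_simps)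

lemma shear_matrix_inverse: "b \<bullet> a = 0 \<Longrightarrow> shear_matrix a b s ** shear_matrix a b (- s) = mat 1"
  by (simp add: matrix_eq matrix_vector_mul_assoc[symmetric] shear_matrix_apply inner_add_right inner_diff_right)

lemma det_shear_matrix: "b \<bullet> a = 0 \<Longrightarrow> det (shear_matrix a b s) = 1"
proof -
  assume "b \<bullet> a = 0"
  then have h: "b$1 * a$1 + b$2 * a$2 = 0" by (simp add: inner_vec_def sum_2)
  have "det (shear_matrix a b s) = 1 + s * (b$1 * a$1 + b$2 * a$2)"
    by (simp add: det_2 shear_matrix_def algebra_simps)
  then show ?thesis using h by simp
qed

lemma shear_has_derivative:
  assumes "(\<phi> has_real_derivative \<phi>') (at (b \<bullet> x))"
  shows "(shear a b \<phi> has_derivative (\<lambda>v. shear_matrix a b \<phi>' *v v)) (at x)"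
proof -
  have "((\<lambda>x. b \<bullet> x) has_derivative (\<lambda>v. b \<bullet> v)) (at x)" by (auto intro!: derivative_eq_intros)
  from has_derivative_compose[OF this, of \<phi> "\<lambda>v. \<phi>' * v"] assms
  have "((\<lambda>x. \<phi> (b \<bullet> x)) has_derivative (\<lambda>v. \<phi>' * (b \<bullet> v))) (at x)" by (simp add: has_field_derivative_def)
  then show ?thesis unfolding shear_def shear_matrix_apply by (auto intro!: derivative_eq_intros)
qed

lemma cont_diff_shear: "cont_diff \<phi> \<Longrightarrow> cont_diff (shear a b \<phi>)"
  unfolding shear_def
  by (rule cont_diff_add[OF cont_diff_linear[OF bounded_linear_ident]
        cont_diff_scaleR[OF cont_diff_compose[OF _ cont_diff_linear[OF bounded_linear_inner_right]] cont_diff_const]])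

lemma shear_inverse: "b \<bullet> a = 0 \<Longrightarrow> shear a b (\<lambda>u. - \<phi> u) (shear a b \<phi> x) = x"
  by (simp add: shear_def inner_add_right)

lemma real_matrix_integral: "integral_vector k \<Longrightarrow> integral_vector (real_matrix E *v k)"
  using real_matrix_mult_Ints_diff[of k 0 E] by (simp add: matrix_vector_mult_0_right)

lemma equivariant_linear: "equivariant ((*v) (real_matrix E))"
  unfolding equivariant_def using real_matrix_integral by (metis matrix_vector_mult_diff_distrib)

text \<open>
  The pairs \<open>(e', e)\<close> and \<open>(l, m)\<close> are dual bases of the integer lattice; \<open>l\<close> and \<open>m\<close> are the coordinates used throughout.
\<close>
locale lattice_frame =
  fixes E :: "int^2^2" and Ei :: "real^2^2" and e e' l m :: "real^2"
  assumes integral: "integral_vector e" "integral_vector e'" "integral_vector l" "integral_vector m"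
    and frame: "l \<bullet> e = 0" "l \<bullet> e' = 1" "m \<bullet> e = 1" "m \<bullet> e' = 0"
    and decomposition: "\<And>v. v = (l \<bullet> v) *\<^sub>R e' + (m \<bullet> v) *\<^sub>R e"
    and Ei: "real_matrix E ** Ei = mat 1"
begin

abbreviation "M \<equiv> real_matrix E"

lemma Ei_M: "Ei ** M = mat 1" using Ei by (simp add: matrix_left_right_inverse)

lemma M_Ei_apply: "M *v (Ei *v x) = x" "Ei *v (M *v x) = x"
  by (simp_all add: matrix_vector_mul_assoc Ei Ei_M)

text \<open>
  The matrix of \<open>E\<^sup>-\<^sup>1\<close> in these coordinates.
\<close>
definition "\<alpha> = l \<bullet> (Ei *v e')"
definition "\<beta> = l \<bullet> (Ei *v e)"
definition "\<gamma> = m \<bullet> (Ei *v e')"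
definition "\<delta> = m \<bullet> (Ei *v e)"

lemma Ei_coordinates: "l \<bullet> (Ei *v v) = \<alpha> * (l \<bullet> v) + \<beta> * (m \<bullet> v)" "m \<bullet> (Ei *v v) = \<gamma> * (l \<bullet> v) + \<delta> * (m \<bullet> v)"
proof -
  have "Ei *v v = (l \<bullet> v) *\<^sub>R (Ei *v e') + (m \<bullet> v) *\<^sub>R (Ei *v e)"
    by (subst decomposition[of v]) (simp add: matrix_vector_right_distrib scaleR_matrix_vector_assoc matrix_vector_mult_scaleR)
  then show "l \<bullet> (Ei *v v) = \<alpha> * (l \<bullet> v) + \<beta> * (m \<bullet> v)" "m \<bullet> (Ei *v v) = \<gamma> * (l \<bullet> v) + \<delta> * (m \<bullet> v)"
    by (simp_all add: \<alpha>_def \<beta>_def \<gamma>_def \<delta>_def inner_add_right)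
qed

lemma det_coordinates: "\<alpha> * \<delta> - \<beta> * \<gamma> \<noteq> 0"
proof
  assume d: "\<alpha> * \<delta> - \<beta> * \<gamma> = 0"
  define v where "v = \<delta> *\<^sub>R e' - \<gamma> *\<^sub>R e"
  have v: "l \<bullet> v = \<delta>" "m \<bullet> v = - \<gamma>" by (simp_all add: v_def inner_diff_right frame)
  have "Ei *v v = 0" using decomposition[of "Ei *v v"] d unfolding Ei_coordinates v by (simp add: algebra_simps)
  then have "v = 0" using M_Ei_apply(1)[of v] by simp
  then have "\<delta> = 0" "\<gamma> = 0" using v by simp_all
  then have "m \<bullet> (Ei *v (M *v e)) = 0" unfolding Ei_coordinates by simp
  then show False by (simp add: M_Ei_apply frame)
qed

end

text \<open>
  The analyticity assumptions are stated as closure under composition because that is what the homotopy needs: it substitutes the first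
  profile into the second.
\<close>
locale twisted_shear = lattice_frame E Ei e e' l m
  for E :: "int^2^2" and Ei :: "real^2^2" and e e' l m :: "real^2" +
  fixes \<phi> \<phi>' \<rho> \<rho>' :: "real \<Rightarrow> real"
  assumes \<phi>: "\<And>u. \<phi> (u + 1) = \<phi> u" "\<And>u. (\<phi> has_real_derivative \<phi>' u) (at u)" "continuous_on UNIV \<phi>'"
      "\<And>p (g :: (real^2) \<times> real \<Rightarrow> real). analytic_at p g \<Longrightarrow> analytic_at p (\<lambda>y. \<phi> (g y))"
    and \<rho>: "\<And>u. \<rho> (u + 1) = \<rho> u" "\<And>u. (\<rho> has_real_derivative \<rho>' u) (at u)" "continuous_on UNIV \<rho>'" "\<And>u. \<rho>' (u + 1) = \<rho>' u"
      "\<And>p (g :: (real^2) \<times> real \<Rightarrow> real). analytic_at p g \<Longrightarrow> analytic_at p (\<lambda>y. \<rho> (g y))"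
begin

text \<open>
  The transversal shear follows \<open>E\<close>, with the opposite sign, so that it enters the inverse branches before \<open>E\<^sup>-\<^sup>1\<close> and with a positive sign.
\<close>
definition "F = shear e' m (\<lambda>u. - \<rho> u) \<circ> ((*v) M \<circ> shear e l \<phi>)"
definition "G = shear e l (\<lambda>u. - \<phi> u) \<circ> ((*v) Ei \<circ> shear e' m \<rho>)"

lemma G_F: "G (F x) = x" and F_G: "F (G x) = x"
  using shear_inverse[of m e' "\<lambda>u. - \<rho> u"] shear_inverse[of l e \<phi>] shear_inverse[of m e' \<rho>] shear_inverse[of l e "\<lambda>u. - \<phi> u"]
  by (simp_all add: F_def G_def frame M_Ei_apply)

lemma cont_diff_phi: "cont_diff \<phi>" "cont_diff (\<lambda>u. - \<phi> u)" "cont_diff \<rho>" "cont_diff (\<lambda>u. - \<rho> u)"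
proof -
  show 1: "cont_diff \<phi>" by (rule cont_diff_real[OF \<phi>(2,3)])
  show 2: "cont_diff \<rho>" by (rule cont_diff_real[OF \<rho>(2,3)])
  show "cont_diff (\<lambda>u. - \<phi> u)" "cont_diff (\<lambda>u. - \<rho> u)"
    by (rule cont_diff_compose[OF cont_diff_linear[OF bounded_linear_minus[OF bounded_linear_ident]]], fact)+
qed

lemma cont_diff_matrix: "cont_diff ((*v) (A :: real^2^2))"
  by (intro cont_diff_linear matrix_vector_mul_bounded_linear)

lemma cont_diff_F: "cont_diff F" and cont_diff_G: "cont_diff G"
  unfolding F_def G_def comp_def
  by (intro cont_diff_compose[OF cont_diff_shear] cont_diff_compose[OF cont_diff_matrix] cont_diff_shear cont_diff_phi)+

lemma equivariant_F: "equivariant F"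
  unfolding F_def
  by (intro equivariant_compose equivariant_linear equivariant_shear integral) (simp_all add: \<phi>(1) \<rho>(1))

lemma F_End1: "torus_map F \<in> End1"
proof -
  have "preserves_lebesgue F" unfolding F_def
    by (intro preserves_lebesgue_compose preserves_lebesgue_shear preserves_lebesgue_linear[OF equivariant_linear Ei]
        equivariant_linear equivariant_shear integral frame cont_diff_continuous cont_diff_phi)
       (simp_all add: \<phi>(1) \<rho>(1) frame)
  then have "torus_map F \<in> measurable torus_measure torus_measure" "distr torus_measure torus_measure (torus_map F) = torus_measure"
    by (rule torus_map_preserves_measure[OF equivariant_F _ cont_diff_continuous[OF cont_diff_F]])+
  moreover have "C1_local_diffeo (torus_map F)"
    by (rule C1_local_diffeo_torus_map[OF equivariant_F, of G])
       (simp add: C1_diffeo_pair_def G_F F_G cont_diff_C1_on cont_diff_F cont_diff_G)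
  ultimately show ?thesis by (simp add: End1_def)
qed

definition "A x = shear_matrix e' m (- \<rho>' (m \<bullet> (M *v shear e l \<phi> x))) ** (M ** shear_matrix e l (\<phi>' (l \<bullet> x)))"
definition "Ai x = shear_matrix e l (- \<phi>' (l \<bullet> x)) ** (Ei ** shear_matrix e' m (\<rho>' (m \<bullet> (F x))))"

lemma F_derivative: "(F has_derivative (\<lambda>v. A x *v v)) (at x)"
proof -
  have 1: "(shear e l \<phi> has_derivative (\<lambda>v. shear_matrix e l (\<phi>' (l \<bullet> x)) *v v)) (at x)"
    by (rule shear_has_derivative[OF \<phi>(2)])
  have 2: "((*v) M has_derivative (\<lambda>v. M *v v)) (at y)" for y
    by (intro bounded_linear_imp_has_derivative matrix_vector_mul_bounded_linear)
  have 3: "(shear e' m (\<lambda>u. - \<rho> u) has_derivative (\<lambda>v. shear_matrix e' m (- \<rho>' (m \<bullet> y)) *v v)) (at y)" for y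
    by (rule shear_has_derivative) (intro DERIV_minus \<rho>(2))
  from has_derivative_compose[OF has_derivative_compose[OF 1 2] 3]
  show ?thesis unfolding F_def A_def comp_def by (simp add: matrix_vector_mul_assoc matrix_mul_assoc)
qed

lemma m_F: "m \<bullet> F x = m \<bullet> (M *v shear e l \<phi> x)"
  by (simp add: F_def shear_def[of e'] inner_add_right inner_diff_right frame)

lemma A_Ai: "A x ** Ai x = mat 1"
proof -
  let ?R = "shear_matrix e' m (- \<rho>' (m \<bullet> F x))" and ?R' = "shear_matrix e' m (\<rho>' (m \<bullet> F x))"
  let ?S = "shear_matrix e l (\<phi>' (l \<bullet> x))" and ?S' = "shear_matrix e l (- \<phi>' (l \<bullet> x))"
  have "A x ** Ai x = ?R ** (M ** (?S ** ?S') ** Ei) ** ?R'"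
    unfolding A_def Ai_def m_F by (simp add: matrix_mul_assoc)
  also have "\<dots> = ?R ** ?R'" using shear_matrix_inverse[of l e "\<phi>' (l \<bullet> x)"] frame Ei by simp
  also have "\<dots> = mat 1" using shear_matrix_inverse[of m e' "- \<rho>' (m \<bullet> F x)"] frame by simp
  finally show ?thesis .
qed

lemma det_A: "det (A x) = det M"
  unfolding A_def det_mul using det_shear_matrix frame by simp

lemma Ai_coordinates:
  fixes v y defines "s \<equiv> \<rho>' (m \<bullet> F y)"
  defines "X \<equiv> \<alpha> * (l \<bullet> v) + (\<beta> + \<alpha> * s) * (m \<bullet> v)"
  shows "l \<bullet> (Ai y *v v) = X" "m \<bullet> (Ai y *v v) = \<gamma> * (l \<bullet> v) + (\<delta> + \<gamma> * s) * (m \<bullet> v) - \<phi>' (l \<bullet> y) * X"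
proof -
  have X: "l \<bullet> (Ei *v (v + (s * (m \<bullet> v)) *\<^sub>R e')) = X"
    unfolding Ei_coordinates by (simp add: inner_add_right frame X_def algebra_simps)
  have Y: "m \<bullet> (Ei *v (v + (s * (m \<bullet> v)) *\<^sub>R e')) = \<gamma> * (l \<bullet> v) + (\<delta> + \<gamma> * s) * (m \<bullet> v)"
    unfolding Ei_coordinates by (simp add: inner_add_right frame algebra_simps)
  have "Ai y *v v = Ei *v (v + (s * (m \<bullet> v)) *\<^sub>R e') - (\<phi>' (l \<bullet> y) * X) *\<^sub>R e"
    unfolding Ai_def matrix_vector_mul_assoc[symmetric] shear_matrix_apply s_def[symmetric] X by simp
  then show "l \<bullet> (Ai y *v v) = X" "m \<bullet> (Ai y *v v) = \<gamma> * (l \<bullet> v) + (\<delta> + \<gamma> * s) * (m \<bullet> v) - \<phi>' (l \<bullet> y) * X"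
    by (simp_all add: inner_diff_right frame X Y)
qed

text \<open>
  The displacement of the lift from the linear map is periodic, so the segments between the two lifts descend to the torus.
\<close>
definition "displacement y = \<phi> (l \<bullet> y) *\<^sub>R (M *v e) + (- \<rho> (m \<bullet> (M *v y) + \<phi> (l \<bullet> y) * (m \<bullet> (M *v e)))) *\<^sub>R e'"

lemma F_displacement: "F y = M *v y + displacement y"
  by (simp add: F_def displacement_def shear_def matrix_vector_right_distrib matrix_vector_mult_scaleR inner_add_right)

lemma displacement_periodic: assumes "integral_vector (x - y)" shows "displacement x = displacement y"
proof -
  have "l \<bullet> (x - y) \<in> \<int>" by (rule inner_integral[OF integral(3) assms])
  from integer_period[of \<phi>, OF \<phi>(1) this, of "l \<bullet> y"] have 1: "\<phi> (l \<bullet> x) = \<phi> (l \<bullet> y)" by (simp add: inner_diff_right)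
  have "m \<bullet> (M *v (x - y)) \<in> \<int>" by (rule inner_integral[OF integral(4) real_matrix_integral[OF assms]])
  from integer_period[of \<rho>, OF \<rho>(1) this, of "m \<bullet> (M *v y) + \<phi> (l \<bullet> y) * (m \<bullet> (M *v e))"]
  show ?thesis unfolding displacement_def 1 by (simp add: inner_diff_right matrix_vector_mult_diff_distrib algebra_simps)
qed

lemma homotopy_lift:
  assumes R: "R UNIV (\<lambda>z. M *v fst z + h (snd z) *\<^sub>R displacement (fst z))" and h: "h 0 = a" "h 1 = b"
    and f: "\<And>y. torus_proj (M *v y + a *\<^sub>R displacement y) = f (torus_proj y)" "\<And>y. torus_proj (M *v y + b *\<^sub>R displacement y) = g (torus_proj y)"
  shows "homotopic_of_class R f g"
proof -
  define H where "H z = torus_proj (M *v torus_rep (fst z) + h (snd z) *\<^sub>R displacement (torus_rep (fst z)))" for z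
  have H: "torus_proj (M *v y + h s *\<^sub>R displacement y) = H (torus_proj y, s)" for y s
  proof -
    have i: "integral_vector (y - torus_rep (torus_proj y))" using torus_proj_eq_iff[of y "torus_rep (torus_proj y)"] by simp
    have "M *v y + h s *\<^sub>R displacement y - (M *v torus_rep (torus_proj y) + h s *\<^sub>R displacement (torus_rep (torus_proj y))) = M *v (y - torus_rep (torus_proj y))"
      unfolding displacement_periodic[OF i] by (simp add: matrix_vector_mult_diff_distrib)
    then have "torus_proj (M *v y + h s *\<^sub>R displacement y) = torus_proj (M *v torus_rep (torus_proj y) + h s *\<^sub>R displacement (torus_rep (torus_proj y)))"
      unfolding torus_proj_eq_iff using real_matrix_integral[OF i, of E] by (metis vector_minus_component)
    then show ?thesis by (simp only: H_def fst_conv snd_conv)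
  qed
  show ?thesis unfolding homotopic_of_class_def
  proof (intro exI[of _ H] conjI allI ballI)
    fix p
    obtain y where p: "p = torus_proj y" by (rule torus_exhaust)
    show "H (p, 0) = f p" unfolding p H[symmetric] h by (rule f)
    show "H (p, 1) = g p" unfolding p H[symmetric] h by (rule f)
  next
    fix x and t :: real
    show "\<exists>W F. open W \<and> (x, t) \<in> W \<and> R W F \<and> (\<forall>(y, s)\<in>W. s \<in> {0..1} \<longrightarrow> torus_proj (F (y, s)) = H (torus_proj y, s))"
      by (intro exI[of _ UNIV] exI[of _ "\<lambda>z. M *v fst z + h (snd z) *\<^sub>R displacement (fst z)"]) (simp add: R H)
  qed
qed

lemma F_C1_homotopic: "C1_homotopic (torus_linear E) (torus_map F)"
  unfolding C1_homotopic_def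
proof (rule homotopy_lift[where h = "\<lambda>s. s" and a = 0 and b = 1])
  have eq: "F y + (-1) *\<^sub>R (M *v y) = displacement y" for y by (simp add: F_displacement)
  have d: "cont_diff displacement"
    using cont_diff_add[OF cont_diff_F cont_diff_scaleR[OF cont_diff_const[of "-1"] cont_diff_matrix[of M]]] unfolding eq .
  show "C1_on UNIV (\<lambda>z. M *v fst z + snd z *\<^sub>R displacement (fst z))"
    by (rule cont_diff_C1_on)
       (rule cont_diff_add[OF cont_diff_compose[OF cont_diff_matrix cont_diff_linear[OF bounded_linear_fst]]
         cont_diff_scaleR[OF cont_diff_linear[OF bounded_linear_snd] cont_diff_compose[OF d cont_diff_linear[OF bounded_linear_fst]]]])
  show "torus_proj (M *v y + 0 *\<^sub>R displacement y) = torus_linear E (torus_proj y)" for y by (simp add: torus_linear_proj)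
  show "torus_proj (M *v y + 1 *\<^sub>R displacement y) = torus_map F (torus_proj y)" for y
    by (simp add: torus_map_proj[OF equivariant_F] F_displacement)
qed simp_all

lemma F_analytically_homotopic: "analytically_homotopic (torus_map F) (torus_linear E)"
  unfolding analytically_homotopic_def
proof (rule homotopy_lift[where h = "\<lambda>s. 1 + (-1) * s" and a = 1 and b = 0])
  have inner_fst: "analytic_at p (\<lambda>z :: (real^2) \<times> real. u \<bullet> fst z)" for p u
    using analytic_at_inner[of p "(u, 0)"] by (simp add: inner_prod_def inner_commute)
  have snd: "analytic_at p (\<lambda>z :: (real^2) \<times> real. snd z)" for p
    using analytic_at_inner[of p "(0, 1)"] by (simp add: inner_prod_def)
  have M2: "M *v y = (axis 1 1 \<bullet> y) *\<^sub>R column 1 M + (axis 2 1 \<bullet> y) *\<^sub>R column 2 M" for y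
    by (simp add: matrix_mult_sum sum_2 inner_axis' scalar_mult_eq_scaleR)
  have mM: "m \<bullet> (M *v y) = (m v* M) \<bullet> y" for y by (simp add: dot_lmul_matrix)
  show "real_analytic_on UNIV (\<lambda>z. M *v fst z + (1 + (-1) * snd z) *\<^sub>R displacement (fst z))"
  proof (rule real_analytic_onI)
    fix p
    have eq: "((axis 1 1 \<bullet> fst z) *\<^sub>R column 1 M + (axis 2 1 \<bullet> fst z) *\<^sub>R column 2 M) +
       (((1 + (-1) * snd z) * \<phi> (l \<bullet> fst z)) *\<^sub>R (M *v e) + ((1 + (-1) * snd z) * ((-1) * \<rho> ((m v* M) \<bullet> fst z + \<phi> (l \<bullet> fst z) * (m \<bullet> (M *v e))))) *\<^sub>R e')
       = M *v fst z + (1 + (-1) * snd z) *\<^sub>R displacement (fst z)" for z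
      unfolding M2[symmetric] mM[symmetric] displacement_def by (simp add: scaleR_add_right scaleR_diff_right)
    show "analytic_vec_at p (\<lambda>z. M *v fst z + (1 + (-1) * snd z) *\<^sub>R displacement (fst z))"
      unfolding eq[symmetric]
      by (intro analytic_vec_at_add analytic_vec_at_scaleR analytic_at_mult analytic_at_add analytic_at_const inner_fst snd \<phi>(4) \<rho>(5))
  qed
  show "torus_proj (M *v y + 1 *\<^sub>R displacement y) = torus_map F (torus_proj y)" for y
    by (simp add: torus_map_proj[OF equivariant_F] F_displacement)
  show "torus_proj (M *v y + 0 *\<^sub>R displacement y) = torus_linear E (torus_proj y)" for y by (simp add: torus_linear_proj)
qed simp_all

end

section \<open>Fibres of sheared linear maps\<close>

text \<open>
  The adjugate matrix is integral.
\<close>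
lemma real_matrix_inverse_det:
  fixes Ei :: "real^2^2" assumes "real_matrix E ** Ei = mat 1" "integral_vector v"
  shows "integral_vector (of_int (det E) *\<^sub>R (Ei *v v))"
proof -
  let ?M = "real_matrix E" and ?w = "Ei *v v"
  have "?M *v ?w = v" by (simp add: matrix_vector_mul_assoc assms(1))
  then have 1: "?M $ 1 $ 1 * ?w $ 1 + ?M $ 1 $ 2 * ?w $ 2 = v $ 1" and 2: "?M $ 2 $ 1 * ?w $ 1 + ?M $ 2 $ 2 * ?w $ 2 = v $ 2"
    by (simp_all add: vec_eq_iff matrix_vector_mult_def forall_2 sum_2)
  have d: "of_int (det E) = ?M $ 1 $ 1 * ?M $ 2 $ 2 - ?M $ 1 $ 2 * ?M $ 2 $ 1" by (simp add: det_2 real_matrix_def)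
  have "of_int (det E) * ?w $ 1 = ?M $ 2 $ 2 * v $ 1 - ?M $ 1 $ 2 * v $ 2"
    unfolding d 1[symmetric] 2[symmetric] by (simp add: algebra_simps)
  moreover have "of_int (det E) * ?w $ 2 = ?M $ 1 $ 1 * v $ 2 - ?M $ 2 $ 1 * v $ 1"
    unfolding d 1[symmetric] 2[symmetric] by (simp add: algebra_simps)
  ultimately show ?thesis using assms(2) by (simp add: forall_2 real_matrix_def)
qed

lemma det_real_matrix: "det (real_matrix E) = of_int (det E)"
  by (simp add: det_2 real_matrix_def)

lemma fraction_Ints_eq: fixes i j n :: nat assumes "i < n" "j < n" "(real i - real j) / real n \<in> \<int>" shows "i = j"
proof -
  obtain z :: int where z: "(real i - real j) / real n = of_int z" using assms(3) by (elim Ints_cases)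
  then have "real i - real j = of_int z * real n" using assms by (simp add: field_simps)
  then have "real_of_int (int i - int j) = of_int (z * int n)" by simp
  then have "int i - int j = z * int n" by (simp only: of_int_eq_iff)
  then have "(int i - int j) mod int n = 0" by simp
  then have "int i mod int n = int j mod int n" by (simp add: mod_eq_dvd_iff dvd_eq_mod_eq_0)
  then show ?thesis using assms by simp
qed

text \<open>
  A basis \<open>g1, g2\<close> of the lattice adapted to \<open>E\<close>: translating by \<open>g1\<close> moves the preimages to the next line, translating by \<open>g2\<close> moves
  them along the line by \<open>e/q\<close>.
\<close>
locale fibre_frame = lattice_frame E Ei e e' l m
  for E :: "int^2^2" and Ei :: "real^2^2" and e e' l m :: "real^2" +
  fixes g1 g2 :: "real^2" and n q :: nat
  assumes pos: "n \<ge> 1" "q \<ge> 1" and g: "integral_vector g1" "integral_vector g2"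
    and basis: "\<And>k. integral_vector k \<Longrightarrow> \<exists>a b :: int. k = of_int a *\<^sub>R g1 + of_int b *\<^sub>R g2"
    and g1: "l \<bullet> (Ei *v g1) = 1 / real n" and g2: "Ei *v g2 = (1 / real q) *\<^sub>R e"
    and det_E: "\<bar>det E\<bar> = int (n * q)"
begin

definition "\<sigma> = m \<bullet> (Ei *v g1)"

lemma Ei_g: "Ei *v (a *\<^sub>R g1 + b *\<^sub>R g2) = a *\<^sub>R (Ei *v g1) + (b / real q) *\<^sub>R e"
  by (simp add: matrix_vector_right_distrib matrix_vector_mult_scaleR g2)

text \<open>
  In the basis \<open>g1, g2\<close> the image of the lattice under \<open>E\<close> is spanned by a triangular system, which makes the
  \<open>n q\<close> vectors \<open>i g1 + j g2\<close> representatives of the cosets.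
\<close>
lemma M_frame: "\<exists>N :: int. M *v e = real q *\<^sub>R g2 \<and> M *v e' = real n *\<^sub>R g1 - of_int N *\<^sub>R g2"
proof -
  let ?w = "real n *\<^sub>R (Ei *v g1)"
  have "m \<bullet> (of_int (det E) *\<^sub>R (Ei *v g1)) \<in> \<int>"
    by (rule inner_integral[OF integral(4) real_matrix_inverse_det[OF Ei g(1)]])
  then have "of_int (det E) * (m \<bullet> (Ei *v g1)) \<in> \<int>" by simp
  moreover have "of_int (det E) = real (n * q) \<or> of_int (det E) = - real (n * q)" using det_E by linarith
  ultimately have "real (n * q) * (m \<bullet> (Ei *v g1)) \<in> \<int>" by auto
  then obtain N :: int where "real (n * q) * (m \<bullet> (Ei *v g1)) = of_int N" by (elim Ints_cases)
  then have mw: "m \<bullet> ?w = of_int N / real q" using pos by (simp add: field_simps)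
  have lw: "l \<bullet> ?w = 1" using g1 pos by simp
  have w: "?w = e' + (of_int N / real q) *\<^sub>R e" using decomposition[of ?w] unfolding mw lw by simp
  have e: "e = real q *\<^sub>R (Ei *v g2)" using pos by (simp add: g2)
  have "M *v e = real q *\<^sub>R g2" by (subst e) (simp add: matrix_vector_mult_scaleR M_Ei_apply)
  moreover have "M *v e' = M *v (?w - (of_int N / real q) *\<^sub>R e)" using w by simp
  then have "M *v e' = real n *\<^sub>R g1 - (of_int N / real q) *\<^sub>R (M *v e)"
    by (simp add: matrix_vector_mult_diff_distrib matrix_vector_mult_scaleR M_Ei_apply)
  ultimately show ?thesis using pos by (intro exI[of _ N]) simp
qed

end

locale twisted_fibre = twisted_shear E Ei e e' l m \<phi> \<phi>' \<rho> \<rho>' + fibre_frame E Ei e e' l m g1 g2 n q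
  for E :: "int^2^2" and Ei :: "real^2^2" and e e' l m :: "real^2" and \<phi> \<phi>' \<rho> \<rho>' :: "real \<Rightarrow> real"
    and g1 g2 :: "real^2" and n q :: nat
begin

definition "Y x ij = G (x + (real (fst ij) *\<^sub>R g1 + real (snd ij) *\<^sub>R g2))"

lemma F_diff: assumes "integral_vector (x - y)" shows "F x - F y = M *v (x - y)"
  unfolding F_displacement displacement_periodic[OF assms] by (simp add: matrix_vector_mult_diff_distrib)

lemma Y_inj: "inj_on (\<lambda>ij. torus_proj (Y x ij)) ({..<n} \<times> {..<q})"
proof (rule inj_onI, clarsimp)
  fix i j i' j' assume ij: "i < n" "j < q" "i' < n" "j' < q" and eq: "torus_proj (Y x (i, j)) = torus_proj (Y x (i', j'))"
  define \<kappa> where "\<kappa> = Y x (i, j) - Y x (i', j')"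
  have \<kappa>: "integral_vector \<kappa>" using eq unfolding torus_proj_eq_iff \<kappa>_def .
  have "M *v \<kappa> = F (Y x (i, j)) - F (Y x (i', j'))" using F_diff \<kappa> unfolding \<kappa>_def by simp
  also have "\<dots> = (real i - real i') *\<^sub>R g1 + (real j - real j') *\<^sub>R g2"
    by (simp add: Y_def F_G algebra_simps)
  finally have "\<kappa> = Ei *v ((real i - real i') *\<^sub>R g1 + (real j - real j') *\<^sub>R g2)"
    using M_Ei_apply(2)[of \<kappa>] by simp
  then have k: "\<kappa> = (real i - real i') *\<^sub>R (Ei *v g1) + ((real j - real j') / real q) *\<^sub>R e" unfolding Ei_g .
  have "l \<bullet> \<kappa> = (real i - real i') / real n" unfolding k by (simp add: inner_add_right g1 frame)
  then have i: "i = i'" using inner_integral[OF integral(3) \<kappa>] fraction_Ints_eq ij by auto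
  have "m \<bullet> \<kappa> = (real j - real j') / real q" unfolding k i by (simp add: inner_add_right frame)
  then have "j = j'" using inner_integral[OF integral(4) \<kappa>] fraction_Ints_eq ij by auto
  with i show "i = i' \<and> j = j'" by simp
qed

lemma Y_fibre: "torus_map F -` {torus_proj x} = (\<lambda>ij. torus_proj (Y x ij)) ` ({..<n} \<times> {..<q})"
proof (intro equalityI subsetI)
  fix p assume "p \<in> (\<lambda>ij. torus_proj (Y x ij)) ` ({..<n} \<times> {..<q})"
  then obtain ij where p: "p = torus_proj (Y x ij)" by blast
  have "torus_map F p = torus_proj (x + (real (fst ij) *\<^sub>R g1 + real (snd ij) *\<^sub>R g2))"
    unfolding p torus_map_proj[OF equivariant_F] by (simp add: Y_def F_G)
  also have "\<dots> = torus_proj x" unfolding torus_proj_eq_iff using g by simp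
  finally show "p \<in> torus_map F -` {torus_proj x}" by simp
next
  fix p assume "p \<in> torus_map F -` {torus_proj x}"
  moreover obtain y where p: "p = torus_proj y" by (rule torus_exhaust)
  ultimately have "torus_proj (F y) = torus_proj x" by (simp add: torus_map_proj[OF equivariant_F])
  then have "integral_vector (F y - x)" unfolding torus_proj_eq_iff .
  then obtain a b :: int where "F y - x = of_int a *\<^sub>R g1 + of_int b *\<^sub>R g2" using basis by blast
  then have ab: "F y = x + (of_int a *\<^sub>R g1 + of_int b *\<^sub>R g2)" by (simp add: algebra_simps)
  obtain N :: int where N: "M *v e = real q *\<^sub>R g2" "M *v e' = real n *\<^sub>R g1 - of_int N *\<^sub>R g2" using M_frame by blast
  define i where "i = nat (a mod int n)"
  define A where "A = a div int n"
  define b' where "b' = b + A * N"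
  define j where "j = nat (b' mod int q)"
  define c where "c = b' div int q"
  have "a = int n * A + int i" using pos by (simp add: i_def A_def)
  then have ai: "real_of_int a = real n * of_int A + real i" by (metis of_int_add of_int_mult of_int_of_nat_eq)
  have "b + A * N = int q * c + int j" unfolding b'_def[symmetric] using pos by (simp add: j_def c_def)
  then have "real_of_int (b + A * N) = of_int (int q * c + int j)" by (rule arg_cong)
  then have bj: "real_of_int b = real q * of_int c + real j - of_int A * of_int N" by simp
  (* Division with remainder in the triangular system: \<open>M \<kappa>\<close> removes the multiple of n from a and then that of q from what is left of b. *)
  define \<kappa> where "\<kappa> = of_int A *\<^sub>R e' + of_int c *\<^sub>R e"
  have "integral_vector (y - (y - \<kappa>))" using integral by (simp add: \<kappa>_def)
  then have "F y - F (y - \<kappa>) = M *v \<kappa>" using F_diff[of y "y - \<kappa>"] by simp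
  then have "F (y - \<kappa>) = F y - M *v \<kappa>" by (simp add: algebra_simps)
  also have "M *v \<kappa> = (real n * of_int A) *\<^sub>R g1 + (real q * of_int c - of_int A * of_int N) *\<^sub>R g2"
    unfolding \<kappa>_def by (simp add: matrix_vector_right_distrib matrix_vector_mult_scaleR N algebra_simps)
  also have "F y - \<dots> = x + (real i *\<^sub>R g1 + real j *\<^sub>R g2)" unfolding ab ai bj by (simp add: algebra_simps)
  finally have "y - \<kappa> = Y x (i, j)" unfolding Y_def using G_F[of "y - \<kappa>"] by simp
  moreover have "torus_proj (y - \<kappa>) = p" unfolding p torus_proj_eq_iff using integral by (simp add: \<kappa>_def)
  moreover have "(i, j) \<in> {..<n} \<times> {..<q}" using pos by (simp add: i_def j_def nat_less_iff)
  ultimately show "p \<in> (\<lambda>ij. torus_proj (Y x ij)) ` ({..<n} \<times> {..<q})" by (metis image_eqI)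
qed

sublocale covering: lifted_covering F A Ai "n * q" "{..<n} \<times> {..<q}" Y
proof
  show "\<bar>det (A x)\<bar> = real (n * q)" for x
    unfolding det_A det_real_matrix using det_E by (metis of_int_abs of_int_of_nat_eq)
  show "card ({..<n} \<times> {..<q}) = n * q" by (simp add: card_cartesian_product)
  show "1 \<le> n * q" using pos by simp
qed (use equivariant_F F_derivative A_Ai Y_inj Y_fibre in auto)

text \<open>
  Coordinates of the preimage of \<open>x\<close> under \<open>E\<close> composed with the transversal shear. The first one is the \<open>u\<close> of the drift
  inequalities.
\<close>
definition "fibre_phase x = \<alpha> * (l \<bullet> x + \<rho> (m \<bullet> x)) + \<beta> * (m \<bullet> x)"
definition "fibre_height x = \<gamma> * (l \<bullet> x + \<rho> (m \<bullet> x)) + \<delta> * (m \<bullet> x)"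

lemma periodic_coordinates:
  assumes "integral_vector (x - y)"
  shows "\<rho> (m \<bullet> x) = \<rho> (m \<bullet> y)" "\<rho>' (m \<bullet> x) = \<rho>' (m \<bullet> y)"
proof -
  have "m \<bullet> (x - y) \<in> \<int>" by (rule inner_integral[OF integral(4) assms])
  from integer_period[of \<rho>, OF \<rho>(1) this, of "m \<bullet> y"] integer_period[of \<rho>', OF \<rho>(4) this, of "m \<bullet> y"]
  show "\<rho> (m \<bullet> x) = \<rho> (m \<bullet> y)" "\<rho>' (m \<bullet> x) = \<rho>' (m \<bullet> y)" by (simp_all add: inner_diff_right)
qed

lemma Y_coordinates:
  fixes i j :: nat and x :: "real^2"
  defines "y \<equiv> Y x (i, j)"
  shows "l \<bullet> y = fibre_phase x + real i / real n"
    "m \<bullet> y = fibre_height x + real i * \<sigma> + real j / real q - \<phi> (fibre_phase x + real i / real n)"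
    "\<rho>' (m \<bullet> F y) = \<rho>' (m \<bullet> x)"
proof -
  let ?k = "real i *\<^sub>R g1 + real j *\<^sub>R g2"
  have Fy: "F y = x + ?k" by (simp add: y_def Y_def F_G)
  have k: "integral_vector (x + ?k - x)" using g by simp
  show "\<rho>' (m \<bullet> F y) = \<rho>' (m \<bullet> x)" unfolding Fy by (rule periodic_coordinates[OF k])
  define z where "z = Ei *v (x + \<rho> (m \<bullet> x) *\<^sub>R e') + (real i *\<^sub>R (Ei *v g1) + (real j / real q) *\<^sub>R e)"
  have "shear e' m \<rho> (x + ?k) = (x + \<rho> (m \<bullet> x) *\<^sub>R e') + ?k"
    unfolding shear_def periodic_coordinates[OF k] by simp
  then have y: "y = z - \<phi> (l \<bullet> z) *\<^sub>R e"
    unfolding y_def Y_def G_def z_def matrix_vector_right_distrib[of Ei _ ?k, unfolded Ei_g, symmetric] by (simp add: shear_def[of e])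
  have lz: "l \<bullet> z = fibre_phase x + real i / real n"
    unfolding z_def inner_add_right[of l] Ei_coordinates by (simp add: inner_add_right frame g1 fibre_phase_def algebra_simps)
  have mz: "m \<bullet> z = fibre_height x + real i * \<sigma> + real j / real q"
    unfolding z_def inner_add_right[of m] Ei_coordinates by (simp add: inner_add_right frame \<sigma>_def fibre_height_def algebra_simps)
  show "l \<bullet> y = fibre_phase x + real i / real n" unfolding y by (simp add: inner_diff_right frame lz)
  show "m \<bullet> y = fibre_height x + real i * \<sigma> + real j / real q - \<phi> (fibre_phase x + real i / real n)"
    unfolding y by (simp add: inner_diff_right frame lz mz)
qed

lemma fibre_phase_shift: assumes "integral_vector (x - y)"
  shows "\<exists>a :: int. fibre_phase x = fibre_phase y + of_int a / real n"
proof -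
  obtain a b :: int where ab: "x - y = of_int a *\<^sub>R g1 + of_int b *\<^sub>R g2" using basis[OF assms] by blast
  have "l \<bullet> (Ei *v (x - y)) = of_int a / real n" unfolding ab Ei_g by (simp add: inner_add_right frame g1)
  then have "\<alpha> * (l \<bullet> x - l \<bullet> y) + \<beta> * (m \<bullet> x - m \<bullet> y) = of_int a / real n"
    unfolding Ei_coordinates by (simp add: inner_diff_right)
  then have "fibre_phase x = fibre_phase y + of_int a / real n"
    unfolding fibre_phase_def periodic_coordinates(1)[OF assms] by (simp add: algebra_simps)
  then show ?thesis ..
qed

lemma vnorm_comparison: "\<exists>C\<ge>1. \<forall>v. vnorm (l \<bullet> v) (m \<bullet> v) \<le> C * norm v \<and> norm v \<le> C * vnorm (l \<bullet> v) (m \<bullet> v)"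
proof -
  define C where "C = 1 + norm l + norm m + norm e' + norm e"
  have "vnorm (l \<bullet> v) (m \<bullet> v) \<le> C * norm v" for v
  proof -
    have "\<bar>l \<bullet> v\<bar> \<le> norm l * norm v" "\<bar>m \<bullet> v\<bar> \<le> norm m * norm v" by (rule Cauchy_Schwarz_ineq2)+
    moreover have "norm l * norm v \<le> C * norm v" "norm m * norm v \<le> C * norm v"
      by (rule mult_right_mono; simp add: C_def)+
    ultimately show ?thesis unfolding vnorm_def by linarith
  qed
  moreover have "norm v \<le> C * vnorm (l \<bullet> v) (m \<bullet> v)" for v
  proof -
    let ?N = "vnorm (l \<bullet> v) (m \<bullet> v)"
    have "norm v \<le> \<bar>l \<bullet> v\<bar> * norm e' + \<bar>m \<bullet> v\<bar> * norm e"
      by (subst decomposition[of v]) (rule order_trans[OF norm_triangle_ineq], simp)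
    also have "\<dots> \<le> ?N * norm e' + ?N * norm e"
      by (intro add_mono mult_right_mono) (simp_all add: vnorm_def)
    also have "\<dots> \<le> C * ?N"
    proof -
      have "0 \<le> ?N" by (simp add: vnorm_def)
      then have "0 \<le> ?N * (1 + norm l + norm m)" by simp
      then show ?thesis by (simp add: C_def algebra_simps)
    qed
    finally show ?thesis .
  qed
  ultimately show ?thesis by (intro exI[of _ C]) (simp add: C_def)
qed

lemma fibre_potential_bound:
  assumes t: "t \<ge> 1" and \<phi>: "\<bar>f\<bar> \<le> B" "\<bar>h\<bar> \<le> B" and pq: "\<bar>p\<bar> + \<bar>r\<bar> \<le> C" "C \<ge> 1" and vw: "(v, w) \<noteq> (0, 0)"
  shows "\<bar>fibre_potential t f h p r v w - ln (vnorm v w)\<bar> \<le> 3 * B * (ln t + ln C)"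
proof -
  let ?N = "vnorm v w" and ?b = "badness t (p * v + r * w) (vnorm v w)"
  have N: "?N > 0" by (rule vnorm_pos[OF vw])
  have "\<bar>p * v + r * w\<bar> \<le> \<bar>p\<bar> * \<bar>v\<bar> + \<bar>r\<bar> * \<bar>w\<bar>" using abs_triangle_ineq[of "p * v" "r * w"] by (simp add: abs_mult)
  also have "\<dots> \<le> \<bar>p\<bar> * ?N + \<bar>r\<bar> * ?N" by (intro add_mono mult_left_mono) (simp_all add: vnorm_def)
  also have "\<dots> \<le> C * ?N" using mult_right_mono[OF pq(1), of ?N] N by (simp add: algebra_simps)
  finally have "- ln C \<le> ?b" by (rule badness_ge[OF t N pq(2)])
  moreover have "?b \<le> ln t" using t by (intro badness_le) simp
  moreover have lt: "ln t \<ge> 0" "ln C \<ge> 0" using t pq by simp_all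
  ultimately have b: "\<bar>?b\<bar> \<le> ln t + ln C" by linarith
  have "\<bar>f * ln t\<bar> \<le> B * (ln t + ln C)" unfolding abs_mult using lt \<phi> by (intro mult_mono) auto
  moreover have "\<bar>(h - f) * ?b\<bar> \<le> (2 * B) * (ln t + ln C)" unfolding abs_mult using b \<phi> by (intro mult_mono) auto
  ultimately show ?thesis unfolding fibre_potential_def by linarith
qed

text \<open>
  The hypothesis is the drift inequality with all points and vectors in the coordinates \<open>l\<close> and \<open>m\<close>, the form in which it was
  derived.
\<close>
theorem positive_exponents:
  fixes t B C :: real and \<phi>S \<phi>W :: "real^2 \<Rightarrow> real"
  assumes t: "t \<ge> 1" and bounded: "\<And>x. \<bar>\<phi>S x\<bar> \<le> B" "\<And>x. \<bar>\<phi>W x\<bar> \<le> B" "\<And>y. \<bar>\<rho>' y\<bar> \<le> C"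
    and periodic: "\<And>x y. integral_vector (x - y) \<Longrightarrow> \<phi>S x = \<phi>S y" "\<And>x y. integral_vector (x - y) \<Longrightarrow> \<phi>W x = \<phi>W y"
    and drift: "\<And>x v w s X V. (v, w) \<noteq> (0, 0) \<Longrightarrow> s = \<rho>' (m \<bullet> x) \<Longrightarrow> X = \<alpha> * v + (\<beta> + \<alpha> * s) * w \<Longrightarrow>
      V = (\<lambda>i. \<gamma> * v + (\<delta> + \<gamma> * s) * w - \<phi>' (fibre_phase x + real i / real n) * X) \<Longrightarrow>
      real n * real q * (fibre_potential t (\<phi>S x) (\<phi>W x) \<alpha> (\<beta> + \<alpha> * s) v w + 1) \<le>
      (\<Sum>i<n. \<Sum>j<q. fibre_potential t (\<phi>S (Y x (i, j))) (\<phi>W (Y x (i, j))) \<alpha> (\<beta> + \<alpha> * \<rho>' (m \<bullet> Y x (i, j))) X (V i))"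
  shows "torus_map F \<in> homotopy_class (torus_linear E) \<inter> U_set \<and> analytically_homotopic (torus_map F) (torus_linear E)"
proof -
  define \<Psi> where "\<Psi> x v = fibre_potential t (\<phi>S x) (\<phi>W x) \<alpha> (\<beta> + \<alpha> * \<rho>' (m \<bullet> x)) (l \<bullet> v) (m \<bullet> v)" for x v
  have \<Psi>_rep: "\<Psi> (torus_rep (torus_proj x)) v = \<Psi> x v" for x v
  proof -
    have i: "integral_vector (torus_rep (torus_proj x) - x)"
      using torus_proj_eq_iff[of "torus_rep (torus_proj x)" x] by simp
    show ?thesis unfolding \<Psi>_def periodic(1)[OF i] periodic(2)[OF i] periodic_coordinates(2)[OF i] ..
  qed
  have nz: "(l \<bullet> v, m \<bullet> v) \<noteq> (0, 0)" if "v \<noteq> 0" for v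
    using decomposition[of v] that by auto
  obtain D where D: "D \<ge> 1" "\<And>v. vnorm (l \<bullet> v) (m \<bullet> v) \<le> D * norm v" "\<And>v. norm v \<le> D * vnorm (l \<bullet> v) (m \<bullet> v)"
    using vnorm_comparison by blast
  define H where "H = 1 + \<bar>\<alpha>\<bar> + \<bar>\<beta>\<bar> + \<bar>\<alpha>\<bar> * C"
  have H: "\<bar>\<alpha>\<bar> + \<bar>\<beta> + \<alpha> * \<rho>' y\<bar> \<le> H" for y
  proof -
    have "\<bar>\<alpha> * \<rho>' y\<bar> \<le> \<bar>\<alpha>\<bar> * C" unfolding abs_mult using bounded(3) by (intro mult_left_mono) auto
    then show ?thesis unfolding H_def by linarith
  qed
  have H1: "H \<ge> 1" using bounded(3)[of 0] by (simp add: H_def)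
  have "C_chi (torus_map F) > 0"
  proof (rule covering.C_chi_positive[where \<Psi> = "\<lambda>p. \<Psi> (torus_rep p)" and c = 1])
    fix p :: torus and v :: "real^2" assume v: "v \<noteq> 0"
    let ?N = "vnorm (l \<bullet> v) (m \<bullet> v)"
    have N: "?N > 0" by (rule vnorm_pos[OF nz[OF v]])
    have "ln ?N \<le> ln (D * norm v)" "ln (norm v) \<le> ln (D * ?N)" using D(2,3)[of v] N v by (intro ln_mono; simp)+
    then have "\<bar>ln ?N - ln (norm v)\<bar> \<le> ln D" using N v D(1) by (simp add: ln_mult)
    moreover have "\<bar>\<Psi> (torus_rep p) v - ln ?N\<bar> \<le> 3 * B * (ln t + ln H)"
      unfolding \<Psi>_def by (rule fibre_potential_bound[OF t bounded(1,2) H H1 nz[OF v]])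
    ultimately show "\<bar>\<Psi> (torus_rep p) v - ln (norm v)\<bar> \<le> 3 * B * (ln t + ln H) + ln D" by linarith
  next
    fix x and v :: "real^2" assume v: "v \<noteq> 0"
    define s where "s = \<rho>' (m \<bullet> x)"
    define X where "X = \<alpha> * (l \<bullet> v) + (\<beta> + \<alpha> * s) * (m \<bullet> v)"
    define V where "V = (\<lambda>i :: nat. \<gamma> * (l \<bullet> v) + (\<delta> + \<gamma> * s) * (m \<bullet> v) - \<phi>' (fibre_phase x + real i / real n) * X)"
    have child: "\<Psi> (Y x (i, j)) (Ai (Y x (i, j)) *v v) =
      fibre_potential t (\<phi>S (Y x (i, j))) (\<phi>W (Y x (i, j))) \<alpha> (\<beta> + \<alpha> * \<rho>' (m \<bullet> Y x (i, j))) X (V i)" for i j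
      unfolding \<Psi>_def Ai_coordinates Y_coordinates(3) Y_coordinates(1)[of x i j] by (simp add: X_def V_def s_def)
    show "real (n * q) * (\<Psi> (torus_rep (torus_proj x)) v + 1) \<le>
      (\<Sum>ij\<in>{..<n} \<times> {..<q}. \<Psi> (torus_rep (torus_proj (Y x ij))) (Ai (Y x ij) *v v))"
      using drift[OF nz[OF v] s_def X_def V_def]
      unfolding sum.cartesian_product' \<Psi>_rep child by (simp add: \<Psi>_def s_def)
  qed simp
  then have "torus_map F \<in> U_set" unfolding U_set_def using F_End1 by simp
  then show ?thesis using F_C1_homotopic F_analytically_homotopic by (simp add: homotopy_class_def)
qed

end

section \<open>Lattice frames adapted to an integer matrix\<close>

abbreviation "integer_vec i j \<equiv> (vector [real_of_int i, real_of_int j] :: real^2)"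

lemma integral_integer_vec: "integral_vector (integer_vec i j)"
  by (simp add: forall_2)

text \<open>
  The vector \<open>E (1, k)\<close>.
\<close>
definition column_image :: "int^2^2 \<Rightarrow> int \<Rightarrow> int \<times> int" where
  "column_image E k = (E$1$1 + k * E$1$2, E$2$1 + k * E$2$2)"

definition column_gcd :: "int^2^2 \<Rightarrow> int \<Rightarrow> int" where
  "column_gcd E k = gcd (fst (column_image E k)) (snd (column_image E k))"

text \<open>
  The determinant of \<open>E (1, k)\<close> and \<open>(1, k)\<close>; it vanishes exactly if \<open>(1, k)\<close> is an eigenvector.
\<close>
definition eigen_form :: "int^2^2 \<Rightarrow> int \<Rightarrow> int" where
  "eigen_form E k = k * fst (column_image E k) - snd (column_image E k)"

lemma column_det: "det E = fst (column_image E k) * E$2$2 - snd (column_image E k) * E$1$2"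
  by (simp add: column_image_def det_2 algebra_simps)

lemma column_gcd_pos: "det E \<noteq> 0 \<Longrightarrow> column_gcd E k > 0"
  using column_det[of E k] by (auto simp: column_gcd_def gcd_pos_int)

lemma column_gcd_dvd: "column_gcd E k dvd det E"
  unfolding column_det[of E k] column_gcd_def by (intro dvd_diff dvd_mult2) auto

text \<open>
  The vectors \<open>(1, k)\<close> and \<open>(1, k + 1)\<close> form a basis of the lattice, so the determinant of their images is \<open>det E\<close>.
\<close>
lemma adjacent_column_gcd: "column_gcd E k * column_gcd E (k + 1) dvd det E"
proof -
  have "det E = fst (column_image E k) * snd (column_image E (k + 1)) - snd (column_image E k) * fst (column_image E (k + 1))"
    by (simp add: column_image_def det_2 algebra_simps)
  then show ?thesis unfolding column_gcd_def by (auto intro!: dvd_diff mult_dvd_mono)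
qed

text \<open>
  The form is a quadratic polynomial in \<open>k\<close>, and its coefficients all vanish only for a homothety.
\<close>
lemma eigen_form_roots:
  assumes "\<not> homothety (real_matrix E)" "k1 \<noteq> k2" "k1 \<noteq> k3" "k2 \<noteq> k3"
  shows "eigen_form E k1 \<noteq> 0 \<or> eigen_form E k2 \<noteq> 0 \<or> eigen_form E k3 \<noteq> 0"
proof (rule ccontr)
  assume "\<not> ?thesis"
  then have z: "eigen_form E k1 = 0" "eigen_form E k2 = 0" "eigen_form E k3 = 0" by auto
  have d: "eigen_form E h - eigen_form E k = (h - k) * (E$1$2 * (h + k) + (E$1$1 - E$2$2))" for h k
    by (simp add: eigen_form_def column_image_def algebra_simps)
  have 12: "E$1$2 * (k1 + k2) + (E$1$1 - E$2$2) = 0" using d[of k1 k2] z assms by simp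
  have 13: "E$1$2 * (k1 + k3) + (E$1$1 - E$2$2) = 0" using d[of k1 k3] z assms by simp
  have "E$1$2 * (k2 - k3) = (E$1$2 * (k1 + k2) + (E$1$1 - E$2$2)) - (E$1$2 * (k1 + k3) + (E$1$1 - E$2$2))"
    by (simp add: algebra_simps)
  then have b: "E$1$2 = 0" using 12 13 assms by simp
  then have a: "E$1$1 = E$2$2" using 12 by simp
  then have "E$2$1 = 0" using z(1) b by (simp add: eigen_form_def column_image_def algebra_simps)
  then have "real_matrix E = of_int (E$1$1) *\<^sub>R mat 1"
    using a b by (simp add: real_matrix_def vec_eq_iff forall_2 mat_def)
  then show False using assms(1) unfolding homothety_def by blast
qed

text \<open>
  If \<open>\<bar>det E\<bar>\<close> divided by the content is at most \<open>2\<close> for both vectors, the product of the two contents is at least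
  \<open>(det E)\<^sup>2 / 4\<close>; it divides \<open>det E\<close>, so \<open>\<bar>det E\<bar> \<le> 4\<close>.
\<close>
lemma small_column_gcds:
  assumes d: "\<bar>det E\<bar> > 2" and k: "\<bar>det E\<bar> < 3 * column_gcd E k" "\<bar>det E\<bar> < 3 * column_gcd E (k + 1)"
  shows "\<bar>det E\<bar> = 4 \<and> (\<forall>i j. even (E$i$j))"
proof -
  let ?d = "\<bar>det E\<bar>" and ?q = "column_gcd E k" and ?q' = "column_gcd E (k + 1)"
  have q: "?q > 0" "?q' > 0" using d by (auto intro: column_gcd_pos)
  have half: "?d \<le> 2 * h" if "h > 0" "h dvd det E" "?d < 3 * h" for h
  proof -
    from that obtain c where c: "?d = h * c" by (metis dvd_def dvd_abs_iff)
    then have "h * c < h * 3" using that by (simp add: mult.commute)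
    then have "c \<le> 2" using that by (simp add: mult_less_cancel_left_pos)
    then show ?thesis unfolding c using that by simp
  qed
  have h: "?d \<le> 2 * ?q" "?d \<le> 2 * ?q'" using half q k column_gcd_dvd by blast+
  have le: "?q * ?q' \<le> ?d" using adjacent_column_gcd[of E k] d by (intro zdvd_imp_le) auto
  have "?d * ?d \<le> (2 * ?q) * (2 * ?q')" using h q by (intro mult_mono) auto
  then have "?d * ?d \<le> ?d * 4" using le by linarith
  then have "?d \<le> 4" using d by (intro mult_left_le_imp_le[of ?d ?d 4]) auto
  moreover have "?d \<noteq> 3"
  proof
    assume "?d = 3"
    then have "2 \<le> ?q" "2 \<le> ?q'" using h by auto
    then have "2 * 2 \<le> ?q * ?q'" by (intro mult_mono) auto
    then show False using le \<open>?d = 3\<close> by simp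
  qed
  ultimately have d4: "?d = 4" using d by linarith
  have "2 \<le> ?q" "2 \<le> ?q'" using h d4 by auto
  moreover have "?q \<le> 2"
  proof (rule ccontr)
    assume "\<not> ?thesis"
    then have "3 * 2 \<le> ?q * ?q'" using \<open>2 \<le> ?q'\<close> by (intro mult_mono) auto
    then show False using le d4 by simp
  qed
  moreover have "?q' \<le> 2"
  proof (rule ccontr)
    assume "\<not> ?thesis"
    then have "2 * 3 \<le> ?q * ?q'" using \<open>2 \<le> ?q\<close> by (intro mult_mono) auto
    then show False using le d4 by simp
  qed
  ultimately have "?q = 2" "?q' = 2" by auto
  then have e: "2 dvd E$1$1 + k * E$1$2" "2 dvd E$2$1 + k * E$2$2" "2 dvd E$1$1 + (k + 1) * E$1$2" "2 dvd E$2$1 + (k + 1) * E$2$2"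
    unfolding column_gcd_def column_image_def fst_conv snd_conv by (metis gcd_dvd1 gcd_dvd2)+
  then have "even (E$1$2)" "even (E$2$2)" by auto
  then have "even (E$1$1)" "even (E$2$1)" using e by auto
  with d4 \<open>even (E$1$2)\<close> \<open>even (E$2$2)\<close> show ?thesis by (simp add: forall_2)
qed

text \<open>
  For \<open>e = (1, k)\<close> take \<open>g2\<close> to be the primitive vector in the direction of \<open>E e\<close> and complete it to a basis by
  a Bezout relation. The parameter \<open>j\<close> is the freedom of adding a multiple of \<open>e\<close> to \<open>e'\<close>.
\<close>
lemma fibre_frame_exists:
  fixes E :: "int^2^2" and k j :: int
  assumes d: "det E \<noteq> 0"
  obtains Ei e e' l m g1 g2 n q where "fibre_frame E Ei e e' l m g1 g2 n q"
    "int q = column_gcd E k" "int n * int q = \<bar>det E\<bar>"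
    "of_int (det E) * (l \<bullet> (Ei *v e')) = of_int (fst (column_image E k) + j * eigen_form E k)"
    "of_int (det E) * (l \<bullet> (Ei *v e)) = of_int (eigen_form E k)"
proof -
  define w1 w2 where "w1 = fst (column_image E k)" and "w2 = snd (column_image E k)"
  define Q where "Q = column_gcd E k"
  have Q: "Q > 0" unfolding Q_def by (rule column_gcd_pos[OF d])
  obtain N where N: "\<bar>det E\<bar> = Q * N" using column_gcd_dvd[of E k] unfolding Q_def by (metis dvd_def dvd_abs_iff)
  then have N0: "N > 0" using d Q by (metis zero_less_abs_iff zero_less_mult_pos)
  obtain p1 where p1: "w1 = Q * p1" unfolding Q_def column_gcd_def w1_def by (metis dvd_def gcd_dvd1)
  obtain p2 where p2: "w2 = Q * p2" unfolding Q_def column_gcd_def w2_def by (metis dvd_def gcd_dvd2)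
  obtain x0 y0 where "x0 * w1 + y0 * w2 = Q" using bezout_int[of w1 w2] unfolding Q_def column_gcd_def w1_def w2_def by blast
  then have "Q * (x0 * p1 + y0 * p2) = Q * 1" unfolding p1 p2 by (simp add: algebra_simps)
  then have bez: "x0 * p1 + y0 * p2 = 1" using Q by (simp only: mult_cancel_left) simp
  define s where "s = sgn (det E)"
  have s: "s * s = 1" "s * det E = \<bar>det E\<bar>" using d by (auto simp: s_def sgn_if)
  define e e' l m where "e = integer_vec 1 k" and "e' = integer_vec j (1 + j * k)"
    and "l = integer_vec (- k) 1" and "m = integer_vec (1 + j * k) (- j)"
  define g1 g2 where "g1 = integer_vec (- s * y0) (s * x0)" and "g2 = integer_vec p1 p2"
  define n q where "n = nat N" and "q = nat Q"
  note vdefs = e_def e'_def l_def m_def g1_def g2_def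
  have rd: "det (real_matrix E) = of_int (det E)" by (rule det_real_matrix)
  have "invertible (real_matrix E)" using d rd by (simp add: invertible_det_nz)
  then obtain Ei where Ei: "real_matrix E ** Ei = mat 1" unfolding invertible_def by blast
  have lf: "lattice_frame E Ei e e' l m"
  proof
    show "v = (l \<bullet> v) *\<^sub>R e' + (m \<bullet> v) *\<^sub>R e" for v
      by (simp add: vec_eq_iff forall_2 vdefs inner_vec_def sum_2 algebra_simps)
    show "real_matrix E ** Ei = mat 1" by (rule Ei)
  qed (simp_all add: vdefs inner_vec_def sum_2 forall_2 algebra_simps)
  interpret lattice_frame E Ei e e' l m by (rule lf)
  have Me: "M *v e = integer_vec w1 w2"
    by (simp add: vec_eq_iff forall_2 e_def matrix_vector_mult_def sum_2 real_matrix_def w1_def w2_def column_image_def algebra_simps)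
  have lEi: "of_int (det E) * (l \<bullet> (Ei *v v)) = of_int w1 * v$2 - of_int w2 * v$1" for v
  proof -
    define z where "z = Ei *v v"
    have v: "v = M *v z" by (simp add: z_def M_Ei_apply)
    show ?thesis unfolding z_def[symmetric] unfolding v
      by (simp add: det_2 matrix_vector_mult_def sum_2 real_matrix_def inner_vec_def l_def w1_def w2_def column_image_def algebra_simps)
  qed
  have dn: "\<bar>det E\<bar> = int (n * q)" using N N0 Q by (simp add: n_def q_def mult.commute)
  have nq: "n \<ge> 1" "q \<ge> 1" using N0 Q by (simp_all add: n_def q_def)
  have qQ: "real q = of_int Q" using Q by (simp add: q_def)
  have "fibre_frame E Ei e e' l m g1 g2 n q"
  proof
    show "1 \<le> n" "1 \<le> q" by (rule nq)+
    show "integral_vector g1" "integral_vector g2" unfolding g1_def g2_def by (rule integral_integer_vec)+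
    show "\<bar>det E\<bar> = int (n * q)" by (rule dn)
    have "real q *\<^sub>R g2 = M *v e" unfolding Me by (simp add: vec_eq_iff forall_2 g2_def p1 p2 qQ)
    then have "Ei *v (real q *\<^sub>R g2) = Ei *v (M *v e)" by simp
    then have "real q *\<^sub>R (Ei *v g2) = e" by (simp add: M_Ei_apply matrix_vector_mult_scaleR)
    then show "Ei *v g2 = (1 / real q) *\<^sub>R e" using nq by (metis (no_types) divideR_right inverse_eq_divide less_numeral_extra(3) not_one_le_zero of_nat_0_eq_iff)
    have "of_int (det E) * (l \<bullet> (Ei *v g1)) = of_int (s * Q * (x0 * p1 + y0 * p2))"
      unfolding lEi by (simp add: g1_def p1 p2 algebra_simps)
    then have "of_int s * (of_int (det E) * (l \<bullet> (Ei *v g1))) = of_int (s * s) * of_int Q" unfolding bez by simp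
    then have "of_int (s * det E) * (l \<bullet> (Ei *v g1)) = real q" unfolding s(1) qQ by simp
    then have "real n * real q * (l \<bullet> (Ei *v g1)) = real q" unfolding s(2) dn by simp
    then show "l \<bullet> (Ei *v g1) = 1 / real n" using nq by (simp add: field_simps)
    fix v :: "real^2" assume v: "integral_vector v"
    then obtain v1 v2 :: int where v12: "v$1 = of_int v1" "v$2 = of_int v2" by (metis Ints_cases)
    define a b where "a = s * (p1 * v2 - p2 * v1)" and "b = x0 * v1 + y0 * v2"
    have "a * (- s * y0) + b * p1 = (s * s) * (y0 * p2 - y0 * p1 * 0) * v1 - (s * s) * (y0 * p1) * v2 + (x0 * p1) * v1 + (y0 * p1) * v2"
      by (simp add: a_def b_def algebra_simps)
    also have "\<dots> = (x0 * p1 + y0 * p2) * v1" unfolding s by (simp add: algebra_simps)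
    finally have 1: "a * (- s * y0) + b * p1 = v1" unfolding bez by simp
    have "a * (s * x0) + b * p2 = (s * s) * (x0 * p1) * v2 - (s * s) * (x0 * p2) * v1 + (x0 * p2) * v1 + (y0 * p2) * v2"
      by (simp add: a_def b_def algebra_simps)
    also have "\<dots> = (x0 * p1 + y0 * p2) * v2" unfolding s by (simp add: algebra_simps)
    finally have 2: "a * (s * x0) + b * p2 = v2" unfolding bez by simp
    have "v = of_int a *\<^sub>R g1 + of_int b *\<^sub>R g2"
      unfolding vec_eq_iff forall_2 v12 1[symmetric] 2[symmetric] by (simp add: g1_def g2_def)
    then show "\<exists>a b :: int. v = of_int a *\<^sub>R g1 + of_int b *\<^sub>R g2" by blast
  qed
  moreover have "int q = column_gcd E k" using Q by (simp add: q_def Q_def)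
  moreover have "int n * int q = \<bar>det E\<bar>" using dn by simp
  moreover have "of_int (det E) * (l \<bullet> (Ei *v e')) = of_int (fst (column_image E k) + j * eigen_form E k)"
    unfolding lEi by (simp add: e'_def eigen_form_def w1_def[symmetric] w2_def[symmetric] algebra_simps)
  moreover have "of_int (det E) * (l \<bullet> (Ei *v e)) = of_int (eigen_form E k)"
    unfolding lEi by (simp add: e_def eigen_form_def w1_def[symmetric] w2_def[symmetric] algebra_simps)
  ultimately show ?thesis using that by blast
qed

text \<open>
  Each of the pairs \<open>{0,1}\<close>, \<open>{2,3}\<close>, \<open>{4,5}\<close> contains a \<open>k\<close> with at least three lines in a fibre, unless \<open>E\<close> is twice a unimodular
  matrix, and at most two of them are eigendirections. In the exceptional case \<open>2 E\<^sup>-\<^sup>1\<close> is integral and unimodular, so that its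
  entries \<open>A\<close>, \<open>B\<close> are not both even, and adding \<open>e\<close> to \<open>e'\<close> replaces \<open>A\<close> by \<open>A + B\<close>.
\<close>
theorem frame_dichotomy:
  fixes E :: "int^2^2"
  assumes nh: "\<not> homothety (real_matrix E)" and d: "\<bar>det E\<bar> > 2"
  obtains
    (fine) Ei e e' l m g1 g2 n q where "fibre_frame E Ei e e' l m g1 g2 n q" "n \<ge> 3" "l \<bullet> (Ei *v e) \<noteq> 0"
  | (coarse) Ei e e' l m g1 g2 and A B :: int where "fibre_frame E Ei e e' l m g1 g2 2 2" "odd A" "B \<noteq> 0"
      "l \<bullet> (Ei *v e') = of_int A / 2" "l \<bullet> (Ei *v e) = of_int B / 2"
proof (cases "\<bar>det E\<bar> = 4 \<and> (\<forall>i j. even (E$i$j))")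
  case False
  have d0: "det E \<noteq> 0" using d by auto
  have "\<exists>k\<in>{h, h + 1}. 3 * column_gcd E k \<le> \<bar>det E\<bar>" for h
    using small_column_gcds[OF d, of h] False by fastforce
  from this[of 0] this[of 2] this[of 4] obtain k1 k2 k3 where
    k: "k1 \<in> {0, 1}" "3 * column_gcd E k1 \<le> \<bar>det E\<bar>" "k2 \<in> {2, 3}" "3 * column_gcd E k2 \<le> \<bar>det E\<bar>"
       "k3 \<in> {4, 5}" "3 * column_gcd E k3 \<le> \<bar>det E\<bar>" by auto
  then have "k1 \<noteq> k2" "k1 \<noteq> k3" "k2 \<noteq> k3" by auto
  from eigen_form_roots[OF nh this] k obtain k where k: "3 * column_gcd E k \<le> \<bar>det E\<bar>" "eigen_form E k \<noteq> 0" by blast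
  obtain Ei e e' l m g1 g2 n q where F: "fibre_frame E Ei e e' l m g1 g2 n q" "int q = column_gcd E k"
    "int n * int q = \<bar>det E\<bar>" "of_int (det E) * (l \<bullet> (Ei *v e)) = of_int (eigen_form E k)"
    using fibre_frame_exists[OF d0, of k 0] by metis
  have "3 * int q \<le> int n * int q" using k F by simp
  moreover have "int q > 0" using F(2) column_gcd_pos[OF d0] by simp
  ultimately have "n \<ge> 3" by (simp add: mult_le_cancel_right)
  moreover have "l \<bullet> (Ei *v e) \<noteq> 0" using F(4) k(2) by auto
  ultimately show ?thesis using fine F(1) by blast
next
  case True
  have d0: "det E \<noteq> 0" using d by auto
  obtain k where k: "eigen_form E k \<noteq> 0" using eigen_form_roots[OF nh, of 0 1 2] by auto
  let ?w1 = "fst (column_image E k)" and ?w2 = "snd (column_image E k)"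
  have even: "even (fst (column_image E h))" "even (snd (column_image E h))" for h using True by (simp_all add: column_image_def)
  have q2: "2 \<le> column_gcd E h" for h
  proof -
    have "2 dvd column_gcd E h" unfolding column_gcd_def using even by simp
    then show ?thesis using column_gcd_pos[OF d0, of h] by (intro zdvd_imp_le)
  qed
  have Q: "column_gcd E k = 2"
  proof (rule ccontr)
    assume "column_gcd E k \<noteq> 2"
    then have "3 * 2 \<le> column_gcd E k * column_gcd E (k + 1)" using q2[of k] q2[of "k + 1"] by (intro mult_mono) auto
    moreover have "column_gcd E k * column_gcd E (k + 1) \<le> \<bar>det E\<bar>" using adjacent_column_gcd[of E k] d by (intro zdvd_imp_le) auto
    ultimately show False using True by simp
  qed
  obtain w1 w2 where w: "?w1 = 2 * w1" "?w2 = 2 * w2" using even[of k] by (elim evenE) blast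
  have ef: "eigen_form E k = 2 * (k * w1 - w2)" by (simp add: eigen_form_def w algebra_simps)
  have nb: "odd w1 \<or> odd (k * w1 - w2)"
  proof (rule ccontr)
    assume "\<not> ?thesis"
    then have "even w1" "even w2" by auto
    then have "4 dvd ?w1" "4 dvd ?w2" unfolding w by (auto elim!: evenE)
    then have "4 dvd column_gcd E k" unfolding column_gcd_def by simp
    then show False unfolding Q by simp
  qed
  define j where "j = (if odd w1 then 0 else 1 :: int)"
  define s where "s = sgn (det E)"
  have s: "det E = 4 * s" "s = 1 \<or> s = -1" using True d0 by (auto simp: s_def sgn_if abs_if split: if_splits)
  define A B where "A = s * (w1 + j * (k * w1 - w2))" and "B = s * (k * w1 - w2)"
  obtain Ei e e' l m g1 g2 n q where F: "fibre_frame E Ei e e' l m g1 g2 n q" "int q = column_gcd E k"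
    "int n * int q = \<bar>det E\<bar>" "of_int (det E) * (l \<bullet> (Ei *v e')) = of_int (?w1 + j * eigen_form E k)"
    "of_int (det E) * (l \<bullet> (Ei *v e)) = of_int (eigen_form E k)"
    using fibre_frame_exists[OF d0, of k j] by metis
  have "q = 2" using F(2) Q by simp
  moreover then have "n = 2" using F(3) True by simp
  ultimately have F1: "fibre_frame E Ei e e' l m g1 g2 2 2" using F(1) by simp
  have "odd A" using nb s(2) by (auto simp: A_def j_def)
  moreover have "B \<noteq> 0" using k s(2) by (auto simp: B_def ef)
  moreover {
  have half: "x = of_int (s * y) / 2" if "of_int (det E) * x = of_int (2 * y)" for x :: real and y
    using that s by auto
  have "l \<bullet> (Ei *v e') = of_int A / 2" "l \<bullet> (Ei *v e) = of_int B / 2"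
    unfolding A_def B_def
    by (rule half, unfold F(4) w ef, simp add: algebra_simps) (rule half, unfold F(5) ef, rule refl)
  }
  ultimately show ?thesis using coarse[OF F1] by blast
qed

section \<open>The homotopic maps with positive exponents\<close>

text \<open>
  The periodic primitive of \<open>t * profile a\<close>.
\<close>
definition fibre_profile :: "real \<Rightarrow> real \<Rightarrow> real \<Rightarrow> real" where
  "fibre_profile t a u = t * (sin (2*pi*u) / (2*pi) + a * (sin (4*pi*u) / (4*pi)))"

lemma fibre_profile_derivative: "(fibre_profile t a has_real_derivative t * profile a u) (at u)"
  unfolding fibre_profile_def[abs_def] profile_def
  by (auto intro!: derivative_eq_intros simp: field_simps)

lemma sin_period: "sin (2*pi*(u + 1)) = sin (2*pi*u)" "sin (4*pi*(u + 1)) = sin (4*pi*u)" "cos (2*pi*(u + 1)) = cos (2*pi*u)"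
proof -
  have "2*pi*(u + 1) = 2*pi*u + 2*pi" "4*pi*(u + 1) = (4*pi*u + 2*pi) + 2*pi" by (simp_all add: algebra_simps)
  then show "sin (2*pi*(u + 1)) = sin (2*pi*u)" "sin (4*pi*(u + 1)) = sin (4*pi*u)" "cos (2*pi*(u + 1)) = cos (2*pi*u)"
    by (simp_all only: sin_periodic cos_periodic)
qed

lemma (in half_twist) weights_cong:
  assumes "phase u y - phase u' y' \<in> \<int>"
  shows "good_weight u y = good_weight u' y'" "bad_weight u y = bad_weight u' y'"
proof -
  have "circ (phase u y - 1/2 + c) = circ (phase u' y' - 1/2 + c)" for c
    using assms by (intro circ_cong_Ints) simp
  from this[of "- (2 * s)"] this[of "2 * s"] this[of 0]
  show "good_weight u y = good_weight u' y'" "bad_weight u y = bad_weight u' y'"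
    by (simp_all add: good_weight_def bad_weight_def flat_def resonant_def)
qed

text \<open>
  The weight descends to the torus because the phase of a point is defined modulo \<open>1/3\<close>.
\<close>
lemma resonance_weight_shift: "resonance_weight \<eta> t (\<theta> + of_int a / 3) = resonance_weight \<eta> t \<theta>"
proof -
  have "(\<exists>h::int. circ (2 * (\<theta> + of_int a / 3) + h/3) \<le> c) \<longleftrightarrow> (\<exists>h::int. circ (2*\<theta> + h/3) \<le> c)" for c
  proof safe
    fix h :: int assume "circ (2 * (\<theta> + of_int a / 3) + h/3) \<le> c"
    then show "\<exists>h::int. circ (2*\<theta> + h/3) \<le> c" by (intro exI[of _ "2 * a + h"]) (simp add: field_simps)
  next
    fix h :: int assume "circ (2*\<theta> + h/3) \<le> c"
    then show "\<exists>h::int. circ (2 * (\<theta> + of_int a / 3) + h/3) \<le> c"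
      by (intro exI[of _ "h - 2 * a"]) (simp add: field_simps)
  qed
  then show ?thesis unfolding resonance_weight_def by simp
qed

context fibre_frame
begin

lemma twisted_fibre_profiles:
  "twisted_fibre E Ei e e' l m (fibre_profile t a) (\<lambda>u. t * profile a u)
     (\<lambda>y. r * cos (2*pi*y)) (\<lambda>y. - 2 * pi * r * sin (2*pi*y)) g1 g2 n q"
proof unfold_locales
  show "continuous_on UNIV (\<lambda>u. t * profile a u)" unfolding profile_def by (intro continuous_intros)
  show "((\<lambda>y. r * cos (2*pi*y)) has_real_derivative - 2 * pi * r * sin (2*pi*u)) (at u)" for u
    by (auto intro!: derivative_eq_intros)
  fix p and g :: "(real^2) \<times> real \<Rightarrow> real" assume g: "analytic_at p g"
  have "analytic_at p (\<lambda>y. t * (1 / (2*pi) * sin (2*pi * g y) + a / (4*pi) * sin (4*pi * g y)))"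
    by (intro analytic_at_intros g)
  then show "analytic_at p (\<lambda>y. fibre_profile t a (g y))" by (simp add: fibre_profile_def)
  show "analytic_at p (\<lambda>y. r * cos (2*pi * g y))" by (intro analytic_at_intros g)
qed (intro fibre_profile_derivative continuous_intros | simp add: fibre_profile_def sin_period)+

definition "wanted_map f \<longleftrightarrow> f \<in> homotopy_class (torus_linear E) \<inter> U_set \<and> analytically_homotopic f (torus_linear E)"

lemma wanted_map_four_or_more: assumes n: "n \<ge> 4" and \<beta>: "\<beta> \<noteq> 0" shows "\<exists>f. wanted_map f"
proof -
  (* The zero \<open>1/4 - s\<close> of the profile has to satisfy \<open>2 z \<notin> (1/n) \<int>\<close>. *)
  define s where "s = 1 / (16 * real n)"
  have s: "0 < s" "s \<le> 1/64" using n by (simp_all add: s_def field_simps)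
  define a where "a = sin (2*pi* s) / cos (4*pi* s)"
  have a: "0 \<le> a" "a < 1/4" "profile a (1/4 - s) = 0" using profile_zero[OF s] unfolding a_def by simp_all
  have nz: "of_int h / n + 2 * (1/4 - s) \<notin> \<int>" for h :: int
  proof
    assume "of_int h / n + 2 * (1/4 - s) \<in> \<int>"
    then obtain z :: int where "of_int h / n + 2 * (1/4 - s) = of_int z" by (elim Ints_cases)
    then have "8 * of_int h + 4 * real n - 1 = 8 * of_int z * real n" using n by (simp add: s_def field_simps)
    then have "real_of_int (8 * h + 4 * int n - 1) = of_int (8 * z * int n)" by simp
    then have "8 * h + 4 * int n - 1 = 8 * z * int n" by (simp only: of_int_eq_iff)
    then have "even (8 * h + 4 * int n - 1)" by simp
    then show False by simp
  qed
  obtain t where t: "t \<ge> 1"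
    "\<And>t' u v w. \<lbrakk>t' \<ge> t; (v,w) \<noteq> (0,0)\<rbrakk> \<Longrightarrow>
       real n * (fibre_potential t' 0 (-2) \<alpha> \<beta> v w + 1) \<le>
       (\<Sum>i<n. fibre_potential t' 0 (-2) \<alpha> \<beta> (\<alpha>* v + \<beta>*w) (\<gamma>* v + \<delta>*w - t' * profile a (u + i/n) * (\<alpha>* v + \<beta>*w)))"
    using drift_four_or_more[OF \<beta> det_coordinates n a nz] by blast
  interpret T: twisted_fibre E Ei e e' l m "fibre_profile t a" "\<lambda>u. t * profile a u"
     "\<lambda>y. 0 * cos (2*pi*y)" "\<lambda>y. - 2 * pi * 0 * sin (2*pi*y)" g1 g2 n q by (rule twisted_fibre_profiles)
  have "torus_map T.F \<in> homotopy_class (torus_linear E) \<inter> U_set \<and> analytically_homotopic (torus_map T.F) (torus_linear E)"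
  proof (rule T.positive_exponents[OF t(1), where B = 2 and C = 0 and \<phi>S = "\<lambda>_. 0" and \<phi>W = "\<lambda>_. -2"])
    fix x :: "real^2" and v w s' X :: real and V :: "nat \<Rightarrow> real"
    assume vw: "(v, w) \<noteq> (0, 0)" and s': "s' = - 2 * pi * 0 * sin (2 * pi * (m \<bullet> x))" and X: "X = \<alpha> * v + (\<beta> + \<alpha> * s') * w"
      and V: "V = (\<lambda>i. \<gamma> * v + (\<delta> + \<gamma> * s') * w - t * profile a (T.fibre_phase x + real i / real n) * X)"
    have s0: "s' = 0" using s' by simp
    have "real q * (real n * (fibre_potential t 0 (-2) \<alpha> \<beta> v w + 1)) \<le> real q * (\<Sum>i<n. fibre_potential t 0 (-2) \<alpha> \<beta> X (V i))"
      using t(2)[OF order_refl vw, of "T.fibre_phase x"] unfolding X V s0 by (intro mult_left_mono) simp_all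
    then show "real n * real q * (fibre_potential t 0 (- 2) \<alpha> (\<beta> + \<alpha> * s') v w + 1) \<le>
      (\<Sum>i<n. \<Sum>j<q. fibre_potential t 0 (- 2) \<alpha> (\<beta> + \<alpha> * (- 2 * pi * 0 * sin (2 * pi * (m \<bullet> T.Y x (i, j))))) X (V i))"
      by (simp add: s0 sum_distrib_left mult_ac)
  qed simp_all
  then show ?thesis unfolding wanted_map_def by blast
qed

text \<open>
  The phases of two preimages in the same position on different lines differ by multiples of \<open>\<alpha>/3 + \<beta> \<sigma>\<close> apart from the shear, and this is a
  coordinate of \<open>E\<^sup>-\<^sup>2 g1\<close>; hence the denominator \<open>(det E)\<^sup>2\<close>.
\<close>
lemma wanted_map_three: assumes n: "n = 3" and \<beta>: "\<beta> \<noteq> 0" shows "\<exists>f. wanted_map f"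
proof -
  define D where "D = n * q * (n * q)"
  have D0: "real D > 0" using pos by (simp add: D_def)
  have det2: "real D = of_int (det E) * of_int (det E)"
  proof -
    have "\<bar>det E\<bar> * \<bar>det E\<bar> = int D" unfolding det_E D_def by simp
    then have "int D = det E * det E" by simp
    then show ?thesis by (metis of_int_mult of_int_of_nat_eq)
  qed
  have D: "real D * (\<alpha>/3 + \<beta>*\<sigma>) \<in> \<int>"
  proof -
    let ?d = "of_int (det E) :: real"
    have "l \<bullet> (?d *\<^sub>R (Ei *v (?d *\<^sub>R (Ei *v g1)))) \<in> \<int>"
      by (intro inner_integral integral real_matrix_inverse_det[OF Ei] g)
    moreover have "\<alpha>/3 + \<beta>*\<sigma> = l \<bullet> (Ei *v (Ei *v g1))"
      unfolding Ei_coordinates(1)[of "Ei *v g1"] by (simp add: g1 \<sigma>_def n)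
    ultimately show ?thesis unfolding det2 by (simp add: matrix_vector_mult_scaleR mult_ac)
  qed
  obtain t0 \<eta> :: real where t0: "t0 \<ge> 1" and drift:
    "\<And>t u s v w. \<lbrakk>t \<ge> t0; 6 * real D * t * \<beta> * sqrt 3 / (2*pi) - 1/2 \<in> \<int>; (v,w) \<noteq> (0,0)\<rbrakk> \<Longrightarrow>
       3 * real q * (fibre_potential t 0 (resonance_weight \<eta> t u) \<alpha> \<beta> v w + 1) \<le>
       (\<Sum>i<3. \<Sum>l<q. fibre_potential t 0
           (resonance_weight \<eta> t (\<alpha> * (u + real i/3) + \<beta> * (s + real i*\<sigma> + real l/q - t * (sin (2*pi*(u + real i/3)) / (2*pi))))) \<alpha> \<beta> (\<alpha>* v + \<beta>*w)
          (\<gamma>* v + \<delta>*w - t * profile 0 (u + real i/3) * (\<alpha>* v + \<beta>*w)))"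
    using drift_three[OF \<beta> det_coordinates D] by blast
  (* Amplitudes of the form \<open>(N + 1/2) \<kappa>\<close> are tuned in the sense of the drift inequality. *)
  define \<kappa> where "\<kappa> = 2*pi / (6 * real D * \<bar>\<beta>\<bar> * sqrt 3)"
  have \<kappa>: "\<kappa> > 0" using D0 \<beta> by (simp add: \<kappa>_def)
  obtain N :: nat where N: "t0 / \<kappa> < real N" using reals_Archimedean2 by blast
  define t where "t = (real N + 1/2) * \<kappa>"
  have "t0 < real N * \<kappa>" using N \<kappa> by (simp add: pos_divide_less_eq)
  then have tt: "t \<ge> t0" unfolding t_def using \<kappa> by (simp add: algebra_simps)
  have "6 * real D * t * \<bar>\<beta>\<bar> * sqrt 3 / (2*pi) = real N + 1/2"
    unfolding t_def \<kappa>_def using D0 \<beta> by (simp add: field_simps)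
  then have "6 * real D * t * \<beta> * sqrt 3 / (2*pi) = real N + 1/2 \<or> 6 * real D * t * \<beta> * sqrt 3 / (2*pi) = - (real N + 1/2)"
    by (cases "\<beta> < 0") simp_all
  then have tuned: "6 * real D * t * \<beta> * sqrt 3 / (2*pi) - 1/2 \<in> \<int>"
  proof
    assume "6 * real D * t * \<beta> * sqrt 3 / (2*pi) = - (real N + 1/2)"
    then have "6 * real D * t * \<beta> * sqrt 3 / (2*pi) - 1/2 = of_int (- int N - 1)" by simp
    then show ?thesis by (metis Ints_of_int)
  qed simp
  interpret T: twisted_fibre E Ei e e' l m "fibre_profile t 0" "\<lambda>u. t * profile 0 u"
     "\<lambda>y. 0 * cos (2*pi*y)" "\<lambda>y. - 2 * pi * 0 * sin (2*pi*y)" g1 g2 n q by (rule twisted_fibre_profiles)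
  have "torus_map T.F \<in> homotopy_class (torus_linear E) \<inter> U_set \<and> analytically_homotopic (torus_map T.F) (torus_linear E)"
  proof (rule T.positive_exponents[where t = t and B = 2 and C = 0 and \<phi>S = "\<lambda>_. 0" and \<phi>W = "\<lambda>x. resonance_weight \<eta> t (T.fibre_phase x)"])
    show "1 \<le> t" using tt t0 by simp
    show "\<bar>resonance_weight \<eta> t (T.fibre_phase x)\<bar> \<le> 2" for x
      using resonance_weight_bounds[of \<eta> t "T.fibre_phase x"] by simp
    show "resonance_weight \<eta> t (T.fibre_phase x) = resonance_weight \<eta> t (T.fibre_phase y)" if "integral_vector (x - y)" for x y
      using T.fibre_phase_shift[OF that] unfolding n by (auto simp: resonance_weight_shift)
    fix x :: "real^2" and v w s' X :: real and V :: "nat \<Rightarrow> real"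
    assume vw: "(v, w) \<noteq> (0, 0)" and s': "s' = - 2 * pi * 0 * sin (2 * pi * (m \<bullet> x))" and X: "X = \<alpha> * v + (\<beta> + \<alpha> * s') * w"
      and V: "V = (\<lambda>i. \<gamma> * v + (\<delta> + \<gamma> * s') * w - t * profile 0 (T.fibre_phase x + real i / real n) * X)"
    have s0: "s' = 0" using s' by simp
    have phase: "T.fibre_phase (T.Y x (i, j)) = \<alpha> * (T.fibre_phase x + real i/3) + \<beta> * (T.fibre_height x + real i*\<sigma> + real j/q
        - t * (sin (2*pi*(T.fibre_phase x + real i/3)) / (2*pi)))" for i j
      unfolding T.fibre_phase_def[of "T.Y x (i, j)"] T.Y_coordinates by (simp add: fibre_profile_def n)
    show "real n * real q * (fibre_potential t 0 (resonance_weight \<eta> t (T.fibre_phase x)) \<alpha> (\<beta> + \<alpha> * s') v w + 1) \<le>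
      (\<Sum>i<n. \<Sum>j<q. fibre_potential t 0 (resonance_weight \<eta> t (T.fibre_phase (T.Y x (i, j)))) \<alpha>
         (\<beta> + \<alpha> * (- 2 * pi * 0 * sin (2 * pi * (m \<bullet> T.Y x (i, j))))) X (V i))"
      using drift[OF tt tuned vw, of "T.fibre_phase x" "T.fibre_height x"]
      unfolding phase X V s0 n by (simp only: mult_zero_left mult_zero_right add_0_right of_nat_numeral)
  qed simp_all
  then show ?thesis unfolding wanted_map_def by blast
qed

lemma wanted_map_two:
  fixes A B :: int
  assumes n: "n = 2" "q = 2" and odd: "odd A" and B: "B \<noteq> 0" and \<alpha>\<beta>: "\<alpha> = of_int A / 2" "\<beta> = of_int B / 2"
  shows "\<exists>f. wanted_map f"
proof -
  interpret H: half_twist A B using odd B by unfold_locales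
  have "of_int A / 2 * \<delta> - of_int B / 2 * \<gamma> \<noteq> 0" using det_coordinates unfolding \<alpha>\<beta> .
  from H.drift_half[OF this] obtain t where t: "t \<ge> 1" and drift:
    "\<And>t' u x1 x2 v w (y :: nat \<Rightarrow> real). \<lbrakk>t' \<ge> t; (v,w) \<noteq> (0,0); 2 * u = H.phase x1 x2\<rbrakk> \<Longrightarrow>
       4 * (fibre_potential t' (H.good_weight x1 x2) (H.bad_weight x1 x2) (A/2) (B/2 + A/2 * H.twist_slope x2) v w + 1) \<le>
       (\<Sum>i<2. \<Sum>j<2. fibre_potential t' (H.good_weight (u + real i/2) (y i + real j/2)) (H.bad_weight (u + real i/2) (y i + real j/2))
          (A/2) (B/2 + A/2 * H.twist_slope (y i + real j/2)) (A/2 * v + (B/2 + A/2 * H.twist_slope x2) * w)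
          (\<gamma> * v + (\<delta> + \<gamma> * H.twist_slope x2) * w - t' * profile H.amp (u + real i/2) * (A/2 * v + (B/2 + A/2 * H.twist_slope x2) * w)))"
    by blast
  interpret T: twisted_fibre E Ei e e' l m "fibre_profile t H.amp" "\<lambda>u. t * profile H.amp u"
     "\<lambda>y. H.r * cos (2*pi*y)" H.twist_slope g1 g2 n q
    unfolding H.twist_slope_def[abs_def] by (rule twisted_fibre_profiles)
  have phase: "H.phase (l \<bullet> x) (m \<bullet> x) = 2 * T.fibre_phase x" for x
    unfolding H.phase_def T.fibre_phase_def \<alpha>\<beta> by (simp add: algebra_simps)
  have shift: "H.phase (l \<bullet> x) (m \<bullet> x) - H.phase (l \<bullet> y) (m \<bullet> y) \<in> \<int>" if "integral_vector (x - y)" for x y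
    using T.fibre_phase_shift[OF that] unfolding phase n by auto
  have "torus_map T.F \<in> homotopy_class (torus_linear E) \<inter> U_set \<and> analytically_homotopic (torus_map T.F) (torus_linear E)"
  proof (rule T.positive_exponents[where t = t and B = 4 and C = 1 and \<phi>S = "\<lambda>x. H.good_weight (l \<bullet> x) (m \<bullet> x)"
        and \<phi>W = "\<lambda>x. H.bad_weight (l \<bullet> x) (m \<bullet> x)"])
    show "1 \<le> t" by (rule t)
    show "\<bar>H.good_weight (l \<bullet> x) (m \<bullet> x)\<bar> \<le> 4" "\<bar>H.bad_weight (l \<bullet> x) (m \<bullet> x)\<bar> \<le> 4" for x
      using H.weights[of "l \<bullet> x" "m \<bullet> x"] by linarith+
    show "\<bar>H.twist_slope y\<bar> \<le> 1" for y using H.twist_slope_small(1)[of y] by linarith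
    show "H.good_weight (l \<bullet> x) (m \<bullet> x) = H.good_weight (l \<bullet> y) (m \<bullet> y)"
      "H.bad_weight (l \<bullet> x) (m \<bullet> x) = H.bad_weight (l \<bullet> y) (m \<bullet> y)" if "integral_vector (x - y)" for x y
      using H.weights_cong[OF shift[OF that]] .
    fix x :: "real^2" and v w s' X :: real and V :: "nat \<Rightarrow> real"
    assume vw: "(v, w) \<noteq> (0, 0)" and s': "s' = H.twist_slope (m \<bullet> x)" and X: "X = \<alpha> * v + (\<beta> + \<alpha> * s') * w"
      and V: "V = (\<lambda>i. \<gamma> * v + (\<delta> + \<gamma> * s') * w - t * profile H.amp (T.fibre_phase x + real i / real n) * X)"
    define y where "y i = T.fibre_height x + real i * \<sigma> - fibre_profile t H.amp (T.fibre_phase x + real i / 2)" for i :: nat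
    have child: "l \<bullet> T.Y x (i, j) = T.fibre_phase x + real i / 2" "m \<bullet> T.Y x (i, j) = y i + real j / 2" for i j
      unfolding T.Y_coordinates y_def n by simp_all
    show "real n * real q * (fibre_potential t (H.good_weight (l \<bullet> x) (m \<bullet> x)) (H.bad_weight (l \<bullet> x) (m \<bullet> x)) \<alpha> (\<beta> + \<alpha> * s') v w + 1) \<le>
      (\<Sum>i<n. \<Sum>j<q. fibre_potential t (H.good_weight (l \<bullet> T.Y x (i, j)) (m \<bullet> T.Y x (i, j))) (H.bad_weight (l \<bullet> T.Y x (i, j)) (m \<bullet> T.Y x (i, j)))
         \<alpha> (\<beta> + \<alpha> * H.twist_slope (m \<bullet> T.Y x (i, j))) X (V i))"
      using drift[OF order_refl vw phase[of x, symmetric], of y] unfolding child X V s' n \<alpha>\<beta> by simp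
  qed
  then show ?thesis unfolding wanted_map_def by blast
qed

end

theorem theoremA:
  fixes E :: "int^2^2"
  assumes "\<not> homothety (real_matrix E)" and "\<bar>det E\<bar> > 2"
  shows "homotopy_class (torus_linear E) \<inter> U_set \<noteq> {} \<and>
    (\<exists>f \<in> homotopy_class (torus_linear E) \<inter> U_set. analytically_homotopic f (torus_linear E))"
proof -
  have "\<exists>f \<in> homotopy_class (torus_linear E) \<inter> U_set. analytically_homotopic f (torus_linear E)"
    using assms
  proof (cases rule: frame_dichotomy)
    case (fine Ei e e' l m g1 g2 n q)
    interpret fibre_frame E Ei e e' l m g1 g2 n q by (rule fine(1))
    have "\<beta> \<noteq> 0" using fine(3) by (simp add: \<beta>_def)
    moreover have "n = 3 \<or> n \<ge> 4" using fine(2) by linarith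
    ultimately show ?thesis using wanted_map_four_or_more wanted_map_three by (auto simp: wanted_map_def)
  next
    case (coarse Ei e e' l m g1 g2 A B)
    interpret fibre_frame E Ei e e' l m g1 g2 2 2 by (rule coarse(1))
    show ?thesis using wanted_map_two[OF refl refl coarse(2,3)] coarse(4,5) by (auto simp: wanted_map_def \<alpha>_def \<beta>_def)
  qed
  then show ?thesis by blast
qed

end
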